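(* Let $x\in|\mathbb{P}^1|$ be a closed point of degree one, let $K'=K_x'\times\prod_{y\neq x}K_y$ with $K_x'=\{k\in K_x\mid k\equiv \mathrm{id} \bmod (\pi_x)\}$, and let $\Phi_x'$ be the ramified Hecke operator given by the characteristic function of $K'\begin{pmatrix}\pi_x&0\\0&1\end{pmatrix}K'$. If $\lambda\in\mathbb{C}^{\times}$, then $\dim_{\mathbb{C}}\mathcal{A}^{K'}(\Phi_x',\lambda)=1$.
   Context: Let $q$ be a prime power and $F=\mathbb{F}_q(t)$ the function field of $\mathbb{P}^1$ over $\mathbb{F}_q$; $|\mathbb{P}^1|$ is the set of closed points (equivalently, places of $F$). For $y\in|\mathbb{P}^1|$: $F_y$ is the completion of $F$ at $y$, $\mathcal{O}_y$ its ring of integers, $\pi_y\in F$ a uniformizer, $\kappa(y)=\mathcal{O}_y/(\pi_y)$, the degree of $y$ is $|y|=[\kappa(y):\mathbb{F}_q]$, and $|\cdot|_y$ is the absolute value with $|\pi_y|_y=q^{-|y|}$. $\mathbb{A}$ is the adele ring of $F$, $\mathcal{O}_{\mathbb{A}}=\prod_y\mathcal{O}_y$, $G=\mathrm{GL}_2$, $Z$ is the center of $G(\mathbb{A})$, $K=\mathrm{GL}_2(\mathcal{O}_{\mathbb{A}})$, $K_y=\mathrm{GL}_2(\mathcal{O}_y)$. A matrix in $\mathrm{GL}_2(F_y)$ is viewed in $G(\mathbb{A})$ by putting the identity at all other places. $G(\mathbb{A})$ carries the Haar measure with $\mathrm{vol}(K)=1$. A locally constant, compactly supported, bi-$K'$-invariant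 function $\Phi:G(\mathbb{A})\to\mathbb{C}$ (Hecke operator) acts on functions by $\Phi(f)(g)=\int_{G(\mathbb{A})}\Phi(h)f(gh)\,dh$. $\mathcal{A}^{K'}$ is the complex vector space of functions $f:G(\mathbb{A})\to\mathbb{C}$ that are left $G(F)$-invariant, $Z$-invariant, right $K'$-invariant, and of moderate growth, i.e. there are constants $C,N$ with $|f(g)|\le C|g|^N$ for all $g\in G(\mathbb{A})$. Here $|g|=\prod_y |g_y|_y$, with $|g_y|_y$ the maximum of the $y$-adic absolute values of the entries of $g_y$ and of $\det(g_y)^{-1}$. For $\lambda\in\mathbb{C}$, $\mathcal{A}^{K'}(\Phi,\lambda)=\{f\in\mathcal{A}^{K'}\mid\Phi(f)=\lambda f\}$. *)

theory Defs
  imports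
    "HOL-Algebra.QuotRing"
    "HOL-Algebra.Embedded_Algebras"
    "HOL-Analysis.Analysis"
    "HOL-Computational_Algebra.Polynomial"
    "HOL-Computational_Algebra.Fraction_Field"
    "HOL-Library.Function_Algebras"
    "HOL-Library.Groups_Big_Fun"
begin

section \<open>Places of the rational function field\<close>

text \<open>
  The finite field with \<open>q\<close> elements is a type \<open>'k\<close> of class \<open>{field, finite}\<close>, so that
  \<open>q = CARD('k)\<close>.  Its rational function field is the fraction field of \<open>'k poly\<close>.
\<close>

type_synonym 'k ratfun = "'k poly fract"

definition const_rat :: "'k::field \<Rightarrow> 'k ratfun"
  where "const_rat c = Fract [:c:] 1"

text \<open>
  A place (equivalently, a closed point of the projective line) is a normalized discrete
  valuation that is trivial on the constants.  The value at \<open>0\<close> should be infinite; the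
  condition \<open>v 0 = 0\<close> only serves to make the representing function unique, and
  every use of a valuation below treats \<open>0\<close> separately.
\<close>

definition is_normalized_valuation :: "('k::field ratfun \<Rightarrow> int) \<Rightarrow> bool"
  where "is_normalized_valuation v \<longleftrightarrow>
    v 0 = 0 \<and>
    (\<forall>f g. f \<noteq> 0 \<longrightarrow> g \<noteq> 0 \<longrightarrow> v (f * g) = v f + v g) \<and>
    (\<forall>f g. f \<noteq> 0 \<longrightarrow> g \<noteq> 0 \<longrightarrow> f + g \<noteq> 0 \<longrightarrow> min (v f) (v g) \<le> v (f + g)) \<and>
    (\<forall>c. c \<noteq> 0 \<longrightarrow> v (const_rat c) = 0) \<and>
    (\<exists>f. f \<noteq> 0 \<and> v f = 1)"

definition degree_valuation :: "'k::field ratfun \<Rightarrow> int"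
  where "degree_valuation f = (if f = 0 then 0 else
    (THE n. \<exists>a b. a \<noteq> 0 \<and> b \<noteq> 0 \<and> f = Fract a b \<and> n = int (degree b) - int (degree a)))"

lemma degree_valuation_Fract:
  fixes a b :: "'k::field poly"
  assumes "a \<noteq> 0" "b \<noteq> 0"
  shows "degree_valuation (Fract a b) = int (degree b) - int (degree a)"
proof -
  have nz: "Fract a b \<noteq> 0"
    using assms by (simp add: Zero_fract_def eq_fract)
  have "(THE n. \<exists>a' b'. a' \<noteq> 0 \<and> b' \<noteq> 0 \<and> Fract a b = Fract a' b' \<and>
      n = int (degree b') - int (degree a')) = int (degree b) - int (degree a)"
  proof (rule the_equality)
    fix n assume "\<exists>a' b'. a' \<noteq> 0 \<and> b' \<noteq> 0 \<and> Fract a b = Fract a' b' \<and>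
      n = int (degree b') - int (degree a')"
    then obtain a' b' where h: "a' \<noteq> 0" "b' \<noteq> 0" "Fract a b = Fract a' b'"
      "n = int (degree b') - int (degree a')" by blast
    have "a * b' = a' * b"
      using h assms by (simp add: eq_fract)
    then have "degree a + degree b' = degree a' + degree b"
      using h assms by (metis degree_mult_eq)
    then show "n = int (degree b) - int (degree a)" using h by linarith
  qed (use assms in blast)
  then show ?thesis using nz by (simp add: degree_valuation_def)
qed

lemma ratfun_nonzero_cases:
  fixes f :: "'k::field ratfun"
  assumes "f \<noteq> 0"
  obtains a b where "f = Fract a b" "a \<noteq> 0" "b \<noteq> 0"
  by (metis assms Fract_cases_nonzero)

lemma is_normalized_valuation_degree_valuation:
  "is_normalized_valuation (degree_valuation :: 'k::field ratfun \<Rightarrow> int)"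
  unfolding is_normalized_valuation_def
proof (intro conjI allI impI)
  show "degree_valuation (0::'k ratfun) = 0"
    by (simp add: degree_valuation_def)
next
  fix f g :: "'k ratfun" assume "f \<noteq> 0" "g \<noteq> 0"
  then obtain a b c d where h: "f = Fract a b" "a \<noteq> 0" "b \<noteq> 0" "g = Fract c d" "c \<noteq> 0" "d \<noteq> 0"
    by (metis ratfun_nonzero_cases)
  then have "f * g = Fract (a * c) (b * d)" by simp
  then show "degree_valuation (f * g) = degree_valuation f + degree_valuation g"
    using h by (simp add: degree_valuation_Fract degree_mult_eq)
next
  fix f g :: "'k ratfun" assume fg: "f \<noteq> 0" "g \<noteq> 0" "f + g \<noteq> 0"
  then obtain a b c d where h: "f = Fract a b" "a \<noteq> 0" "b \<noteq> 0" "g = Fract c d" "c \<noteq> 0" "d \<noteq> 0"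
    by (metis ratfun_nonzero_cases)
  then have s: "f + g = Fract (a * d + c * b) (b * d)" by simp
  have nz: "a * d + c * b \<noteq> 0"
    using fg(3) s h by (auto simp: Zero_fract_def eq_fract)
  have "degree (a * d + c * b) \<le> max (degree (a * d)) (degree (c * b))"
    by (rule degree_add_le_max)
  then have "int (degree (a * d + c * b)) \<le>
      max (int (degree a) + int (degree d)) (int (degree c) + int (degree b))"
    using h by (auto simp: degree_mult_eq)
  then show "min (degree_valuation f) (degree_valuation g) \<le> degree_valuation (f + g)"
    unfolding s using h nz by (auto simp: degree_valuation_Fract degree_mult_eq)
next
  fix c :: 'k assume "c \<noteq> 0"
  then show "degree_valuation (const_rat c) = 0"
    by (simp add: const_rat_def degree_valuation_Fract)
next
  have "Fract 1 [:0, 1::'k:] \<noteq> 0" by (simp add: Zero_fract_def eq_fract)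
  moreover have "degree_valuation (Fract 1 [:0, 1::'k:]) = 1"
    by (subst degree_valuation_Fract) auto
  ultimately show "\<exists>f. f \<noteq> 0 \<and> degree_valuation (f :: 'k ratfun) = 1" by blast
qed

typedef (overloaded) ('k::"{field,finite}") place =
    "{v :: 'k ratfun \<Rightarrow> int. is_normalized_valuation v}"
  morphisms val Abs_place
  using is_normalized_valuation_degree_valuation by blast

definition uniformizer :: "'k::{field,finite} place \<Rightarrow> 'k ratfun \<Rightarrow> bool"
  where "uniformizer y \<pi> \<longleftrightarrow> \<pi> \<noteq> 0 \<and> val y \<pi> = 1"

definition val_ge :: "'k::{field,finite} place \<Rightarrow> int \<Rightarrow> 'k ratfun \<Rightarrow> bool"
  where "val_ge y N f \<longleftrightarrow> f = 0 \<or> N \<le> val y f"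

lemma val_mult: "f \<noteq> 0 \<Longrightarrow> g \<noteq> 0 \<Longrightarrow> val y (f * g) = val y f + val y g"
  and val_add: "f \<noteq> 0 \<Longrightarrow> g \<noteq> 0 \<Longrightarrow> f + g \<noteq> 0 \<Longrightarrow> min (val y f) (val y g) \<le> val y (f + g)"
  and val_const: "c \<noteq> 0 \<Longrightarrow> val y (const_rat c) = 0"
  using val[of y] by (auto simp: is_normalized_valuation_def)

lemma val_1 [simp]: "val y 1 = 0"
  using val_mult[of 1 1 y] by simp

lemma val_minus [simp]: "val y (- f) = val y f"
proof (cases "f = 0")
  case False
  have "val y (-1) + val y (-1) = 0" using val_mult[of "-1" "-1" y] by simp
  then have "val y (-1) = 0" by simp
  then show ?thesis using val_mult[of "-1" f y] False by simp
qed simp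

lemma val_ge_0 [simp]: "val_ge y N 0"
  by (simp add: val_ge_def)

lemma val_ge_minus [simp]: "val_ge y N (- f) = val_ge y N f"
  by (simp add: val_ge_def)

lemma val_ge_add: "val_ge y N f \<Longrightarrow> val_ge y N g \<Longrightarrow> val_ge y N (f + g)"
  using val_add[of f g y] unfolding val_ge_def by (cases "f = 0"; cases "g = 0"; force)

lemma val_ge_diff: "val_ge y N f \<Longrightarrow> val_ge y N g \<Longrightarrow> val_ge y N (f - g)"
  using val_ge_add[of y N f "- g"] by simp

lemma val_ge_mult: "val_ge y N f \<Longrightarrow> val_ge y M g \<Longrightarrow> val_ge y (N + M) (f * g)"
  unfolding val_ge_def by (cases "f = 0"; cases "g = 0") (auto simp: val_mult)

lemma val_ge_mono: "val_ge y N f \<Longrightarrow> M \<le> N \<Longrightarrow> val_ge y M f"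
  unfolding val_ge_def by auto

section \<open>Completions\<close>

text \<open>
  The completion at \<open>y\<close> is the ring of \<open>y\<close>-adic Cauchy sequences modulo the ideal of null
  sequences; its elements are cosets, hence of type \<open>(nat \<Rightarrow> 'k ratfun) set\<close> for every \<open>y\<close>.
\<close>

type_synonym 'k celem = "(nat \<Rightarrow> 'k ratfun) set"

definition cauchy_at :: "'k::{field,finite} place \<Rightarrow> (nat \<Rightarrow> 'k ratfun) \<Rightarrow> bool"
  where "cauchy_at y s \<longleftrightarrow> (\<forall>N. \<exists>M. \<forall>m\<ge>M. \<forall>n\<ge>M. val_ge y N (s m - s n))"

definition null_at :: "'k::{field,finite} place \<Rightarrow> (nat \<Rightarrow> 'k ratfun) \<Rightarrow> bool"
  where "null_at y s \<longleftrightarrow> (\<forall>N. \<exists>M. \<forall>n\<ge>M. val_ge y N (s n))"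

definition cauchy_ring :: "'k::{field,finite} place \<Rightarrow> (nat \<Rightarrow> 'k ratfun) ring"
  where "cauchy_ring y =
    \<lparr>carrier = {s. cauchy_at y s},
     monoid.mult = (\<lambda>s t n. s n * t n), monoid.one = (\<lambda>n. 1),
     ring.zero = (\<lambda>n. 0), ring.add = (\<lambda>s t n. s n + t n)\<rparr>"

definition local_field :: "'k::{field,finite} place \<Rightarrow> 'k celem ring"
  where "local_field y = cauchy_ring y Quot {s. null_at y s}"

definition cls :: "'k::{field,finite} place \<Rightarrow> (nat \<Rightarrow> 'k ratfun) \<Rightarrow> 'k celem"
  where "cls y s = {s. null_at y s} +>\<^bsub>cauchy_ring y\<^esub> s"

definition emb :: "'k::{field,finite} place \<Rightarrow> 'k ratfun \<Rightarrow> 'k celem"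
  where "emb y f = cls y (\<lambda>_. f)"

text \<open>
  The extension of the valuation to the completion: the valuations along a Cauchy sequence
  that is not a null sequence are eventually constant.
\<close>

definition cval :: "'k::{field,finite} place \<Rightarrow> 'k celem \<Rightarrow> int"
  where "cval y a = (THE n. \<forall>s\<in>a. eventually (\<lambda>k. val y (s k) = n) sequentially)"

definition ring_of_integers :: "'k::{field,finite} place \<Rightarrow> 'k celem set"
  where "ring_of_integers y =
    {a \<in> carrier (local_field y). a = \<zero>\<^bsub>local_field y\<^esub> \<or> 0 \<le> cval y a}"

definition integer_ring :: "'k::{field,finite} place \<Rightarrow> 'k celem ring"
  where "integer_ring y = (local_field y)\<lparr>carrier := ring_of_integers y\<rparr>"

definition uniformizer_ideal :: "'k::{field,finite} place \<Rightarrow> 'k ratfun \<Rightarrow> 'k celem set"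
  where "uniformizer_ideal y \<pi> = PIdl\<^bsub>integer_ring y\<^esub> (emb y \<pi>)"

text \<open>Any two uniformizers generate the same ideal, so the choice below is immaterial.\<close>

definition residue_field :: "'k::{field,finite} place \<Rightarrow> 'k celem set ring"
  where "residue_field y = integer_ring y Quot uniformizer_ideal y (SOME \<pi>. uniformizer y \<pi>)"

definition residue_constants :: "'k::{field,finite} place \<Rightarrow> 'k celem set set"
  where "residue_constants y =
    (\<lambda>c. uniformizer_ideal y (SOME \<pi>. uniformizer y \<pi>) +>\<^bsub>integer_ring y\<^esub> emb y (const_rat c)) ` UNIV"

text \<open>The dimension of the residue field over the image of the constants.\<close>

definition place_degree :: "'k::{field,finite} place \<Rightarrow> nat"
  where "place_degree y =
    (THE d. ring.dimension (residue_field y) d (residue_constants y) (carrier (residue_field y)))"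

definition cabs :: "'k::{field,finite} place \<Rightarrow> 'k celem \<Rightarrow> real"
  where "cabs y a = (if a = \<zero>\<^bsub>local_field y\<^esub> then 0
    else real CARD('k) powi (- (int (place_degree y) * cval y a)))"

definition open_at :: "'k::{field,finite} place \<Rightarrow> 'k celem set \<Rightarrow> bool"
  where "open_at y U \<longleftrightarrow> U \<subseteq> carrier (local_field y) \<and>
    (\<forall>a\<in>U. \<exists>e>0. \<forall>b\<in>carrier (local_field y). cabs y (b \<ominus>\<^bsub>local_field y\<^esub> a) < e \<longrightarrow> b \<in> U)"

subsection \<open>Ring structure\<close>

lemma cauchy_at_bounded:
  assumes "cauchy_at y s"
  obtains B M where "\<And>n. n \<ge> M \<Longrightarrow> val_ge y B (s n)"
proof -
  obtain M where M: "\<And>m n. m \<ge> M \<Longrightarrow> n \<ge> M \<Longrightarrow> val_ge y 0 (s m - s n)"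
    using assms unfolding cauchy_at_def by meson
  define B where "B = min 0 (val y (s M))"
  have "val_ge y B (s n)" if "n \<ge> M" for n
  proof -
    have "val_ge y B (s n - s M)" using M[OF that order_refl] by (rule val_ge_mono) (simp add: B_def)
    moreover have "val_ge y B (s M)" by (simp add: val_ge_def B_def)
    ultimately have "val_ge y B ((s n - s M) + s M)" by (rule val_ge_add)
    then show ?thesis by simp
  qed
  then show ?thesis using that by blast
qed

lemma cauchy_at_const [simp]: "cauchy_at y (\<lambda>_. f)"
  by (simp add: cauchy_at_def)

lemma cauchy_at_add:
  assumes "cauchy_at y s" "cauchy_at y t"
  shows "cauchy_at y (\<lambda>n. s n + t n)"
  unfolding cauchy_at_def
proof
  fix N
  obtain M1 where M1: "\<And>m n. m \<ge> M1 \<Longrightarrow> n \<ge> M1 \<Longrightarrow> val_ge y N (s m - s n)"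
    using assms(1) unfolding cauchy_at_def by meson
  obtain M2 where M2: "\<And>m n. m \<ge> M2 \<Longrightarrow> n \<ge> M2 \<Longrightarrow> val_ge y N (t m - t n)"
    using assms(2) unfolding cauchy_at_def by meson
  have "val_ge y N (s m + t m - (s n + t n))" if "m \<ge> max M1 M2" "n \<ge> max M1 M2" for m n
    using val_ge_add[OF M1[of m n] M2[of m n]] that by (simp add: algebra_simps)
  then show "\<exists>M. \<forall>m\<ge>M. \<forall>n\<ge>M. val_ge y N (s m + t m - (s n + t n))" by blast
qed

lemma cauchy_at_minus: "cauchy_at y s \<Longrightarrow> cauchy_at y (\<lambda>n. - s n)"
  unfolding cauchy_at_def
  by (metis (no_types, lifting) minus_diff_minus val_ge_minus)

lemma cauchy_at_mult:
  assumes "cauchy_at y s" "cauchy_at y t"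
  shows "cauchy_at y (\<lambda>n. s n * t n)"
  unfolding cauchy_at_def
proof
  fix N
  obtain B1 L1 where B1: "\<And>n. n \<ge> L1 \<Longrightarrow> val_ge y B1 (s n)"
    using cauchy_at_bounded[OF assms(1)] by blast
  obtain B2 L2 where B2: "\<And>n. n \<ge> L2 \<Longrightarrow> val_ge y B2 (t n)"
    using cauchy_at_bounded[OF assms(2)] by blast
  obtain M1 where M1: "\<And>m n. m \<ge> M1 \<Longrightarrow> n \<ge> M1 \<Longrightarrow> val_ge y (N - B2) (s m - s n)"
    using assms(1) unfolding cauchy_at_def by meson
  obtain M2 where M2: "\<And>m n. m \<ge> M2 \<Longrightarrow> n \<ge> M2 \<Longrightarrow> val_ge y (N - B1) (t m - t n)"
    using assms(2) unfolding cauchy_at_def by meson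
  define M where "M = max (max L1 L2) (max M1 M2)"
  have "val_ge y N (s m * t m - s n * t n)" if "m \<ge> M" "n \<ge> M" for m n
  proof -
    have "val_ge y (B1 + (N - B1)) (s m * (t m - t n))"
      using that by (intro val_ge_mult B1 M2) (auto simp: M_def)
    moreover have "val_ge y ((N - B2) + B2) ((s m - s n) * t n)"
      using that by (intro val_ge_mult B2 M1) (auto simp: M_def)
    ultimately have "val_ge y N (s m * (t m - t n) + (s m - s n) * t n)"
      by (intro val_ge_add) auto
    then show ?thesis by (simp add: algebra_simps)
  qed
  then show "\<exists>M. \<forall>m\<ge>M. \<forall>n\<ge>M. val_ge y N (s m * t m - s n * t n)" by blast
qed

lemma null_at_cauchy: "null_at y s \<Longrightarrow> cauchy_at y s"
  unfolding null_at_def cauchy_at_def by (meson val_ge_diff)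

lemma null_at_add:
  assumes "null_at y s" "null_at y t"
  shows "null_at y (\<lambda>n. s n + t n)"
  unfolding null_at_def
proof
  fix N
  obtain M1 M2 where "\<And>n. n \<ge> M1 \<Longrightarrow> val_ge y N (s n)" "\<And>n. n \<ge> M2 \<Longrightarrow> val_ge y N (t n)"
    using assms unfolding null_at_def by meson
  then have "\<forall>n\<ge>max M1 M2. val_ge y N (s n + t n)" by (auto intro: val_ge_add)
  then show "\<exists>M. \<forall>n\<ge>M. val_ge y N (s n + t n)" by blast
qed

lemma null_at_minus: "null_at y s \<Longrightarrow> null_at y (\<lambda>n. - s n)"
  by (simp add: null_at_def)

lemma null_at_mult:
  assumes "null_at y s" "cauchy_at y t"
  shows "null_at y (\<lambda>n. s n * t n)"
  unfolding null_at_def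
proof
  fix N
  obtain B L where B: "\<And>n. n \<ge> L \<Longrightarrow> val_ge y B (t n)"
    using cauchy_at_bounded[OF assms(2)] by blast
  obtain M where M: "\<And>n. n \<ge> M \<Longrightarrow> val_ge y (N - B) (s n)"
    using assms(1) unfolding null_at_def by meson
  have "val_ge y N (s n * t n)" if "n \<ge> max L M" for n
    using val_ge_mult[OF M[of n] B[of n]] that by simp
  then show "\<exists>M. \<forall>n\<ge>M. val_ge y N (s n * t n)" by blast
qed

lemma cauchy_ring_cring: "cring (cauchy_ring y)"
proof (rule cringI)
  show "abelian_group (cauchy_ring y)"
  proof (rule abelian_groupI)
    fix s assume "s \<in> carrier (cauchy_ring y)"
    then have "(\<lambda>n. - s n) \<in> carrier (cauchy_ring y) \<and>
        (\<lambda>n. - s n) \<oplus>\<^bsub>cauchy_ring y\<^esub> s = \<zero>\<^bsub>cauchy_ring y\<^esub>"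
      by (auto simp: cauchy_ring_def cauchy_at_minus)
    then show "\<exists>t\<in>carrier (cauchy_ring y). t \<oplus>\<^bsub>cauchy_ring y\<^esub> s = \<zero>\<^bsub>cauchy_ring y\<^esub>" by blast
  qed (auto simp: cauchy_ring_def cauchy_at_add algebra_simps)
  show "Group.comm_monoid (cauchy_ring y)"
    by (rule comm_monoidI) (auto simp: cauchy_ring_def cauchy_at_mult algebra_simps)
qed (auto simp: cauchy_ring_def algebra_simps)

lemma null_ideal: "ideal {s. null_at y s} (cauchy_ring y)"
proof -
  interpret C: cring "cauchy_ring y" by (rule cauchy_ring_cring)
  have inv: "inv\<^bsub>add_monoid (cauchy_ring y)\<^esub> s = (\<lambda>n. - s n)" if "cauchy_at y s" for s
    using C.minus_equality[of "\<lambda>n. - s n" s] that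
    by (simp add: a_inv_def) (simp add: cauchy_ring_def cauchy_at_minus)
  show ?thesis
  proof (rule idealI)
    show "ring (cauchy_ring y)" by (rule C.ring_axioms)
    show "subgroup {s. null_at y s} (add_monoid (cauchy_ring y))"
    proof (rule subgroup.intro)
      show "{s. null_at y s} \<subseteq> carrier (add_monoid (cauchy_ring y))"
        by (auto simp: cauchy_ring_def null_at_cauchy)
      fix s assume "s \<in> {s. null_at y s}"
      then show "inv\<^bsub>add_monoid (cauchy_ring y)\<^esub> s \<in> {s. null_at y s}"
        by (simp only: inv null_at_cauchy null_at_minus mem_Collect_eq)
    qed (auto simp: cauchy_ring_def null_at_add, simp add: null_at_def)
  next
    fix s t assume "s \<in> {s. null_at y s}" "t \<in> carrier (cauchy_ring y)"
    then have "null_at y (\<lambda>n. s n * t n)" by (auto simp: cauchy_ring_def null_at_mult)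
    then show "t \<otimes>\<^bsub>cauchy_ring y\<^esub> s \<in> {s. null_at y s}" "s \<otimes>\<^bsub>cauchy_ring y\<^esub> t \<in> {s. null_at y s}"
      by (simp_all add: cauchy_ring_def mult.commute)
  qed
qed

lemma local_field_cring: "cring (local_field y)"
  unfolding local_field_def by (rule ideal.quotient_is_cring[OF null_ideal cauchy_ring_cring])

lemma cls_eq: "cauchy_at y s \<Longrightarrow> cls y s = {t. null_at y (\<lambda>n. t n - s n)}"
proof -
  assume "cauchy_at y s"
  have "t \<in> cls y s \<longleftrightarrow> null_at y (\<lambda>n. t n - s n)" for t
  proof -
    have "t \<in> cls y s \<longleftrightarrow> (\<exists>u. null_at y u \<and> t = (\<lambda>n. u n + s n))"
      by (auto simp: cls_def a_r_coset_def r_coset_def cauchy_ring_def)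
    also have "\<dots> \<longleftrightarrow> null_at y (\<lambda>n. t n - s n)"
      by (auto intro!: exI[of _ "\<lambda>n. t n - s n"])
    finally show ?thesis .
  qed
  then show ?thesis by blast
qed

lemma carrier_local_field: "carrier (local_field y) = cls y ` {s. cauchy_at y s}"
  by (auto simp: local_field_def FactRing_def A_RCOSETS_def RCOSETS_def cls_def a_r_coset_def cauchy_ring_def)

lemma cls_hom: "cls y \<in> ring_hom (cauchy_ring y) (local_field y)"
  unfolding local_field_def cls_def[abs_def] using ideal.rcos_ring_hom[OF null_ideal] .

lemma cls_add: "cauchy_at y s \<Longrightarrow> cauchy_at y t \<Longrightarrow> cls y s \<oplus>\<^bsub>local_field y\<^esub> cls y t = cls y (\<lambda>n. s n + t n)"
  and cls_mult: "cauchy_at y s \<Longrightarrow> cauchy_at y t \<Longrightarrow> cls y s \<otimes>\<^bsub>local_field y\<^esub> cls y t = cls y (\<lambda>n. s n * t n)"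
  and cls_one: "\<one>\<^bsub>local_field y\<^esub> = cls y (\<lambda>_. 1)"
  using ring_hom_add[OF cls_hom, of s y t] ring_hom_mult[OF cls_hom, of s y t] ring_hom_one[OF cls_hom, of y]
  by (simp_all add: cauchy_ring_def)

lemma cls_zero: "\<zero>\<^bsub>local_field y\<^esub> = cls y (\<lambda>_. 0)"
  by (simp add: cls_eq) (simp add: local_field_def FactRing_def)

lemma cls_minus: "cauchy_at y s \<Longrightarrow> \<ominus>\<^bsub>local_field y\<^esub> cls y s = cls y (\<lambda>n. - s n)"
proof -
  interpret C: cring "local_field y" by (rule local_field_cring)
  assume s: "cauchy_at y s"
  show ?thesis
    by (rule C.minus_equality)
      (use s in \<open>auto simp: carrier_local_field cls_add cls_zero cauchy_at_minus\<close>)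
qed

lemma cls_eq_iff:
  assumes "cauchy_at y s" "cauchy_at y t"
  shows "cls y s = cls y t \<longleftrightarrow> null_at y (\<lambda>n. s n - t n)"
proof
  assume "cls y s = cls y t"
  moreover have "s \<in> cls y s" using assms by (simp add: cls_eq) (simp add: null_at_def)
  ultimately show "null_at y (\<lambda>n. s n - t n)" using assms by (simp add: cls_eq)
next
  assume *: "null_at y (\<lambda>n. s n - t n)"
  show "cls y s = cls y t"
  proof -
    have "null_at y (\<lambda>n. u n - t n)" if "null_at y (\<lambda>n. u n - s n)" for u
      using null_at_add[OF that *] by simp
    moreover have "null_at y (\<lambda>n. u n - s n)" if "null_at y (\<lambda>n. u n - t n)" for u
      using null_at_add[OF that null_at_minus[OF *]] by simp
    ultimately show ?thesis using assms by (auto simp: cls_eq)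
  qed
qed

lemma local_field_one_neq_zero: "\<one>\<^bsub>local_field y\<^esub> \<noteq> \<zero>\<^bsub>local_field y\<^esub>"
proof
  assume "\<one>\<^bsub>local_field y\<^esub> = \<zero>\<^bsub>local_field y\<^esub>"
  then have "null_at y (\<lambda>_. 1)" by (simp add: cls_one cls_zero cls_eq_iff)
  then have "val_ge y 1 1" unfolding null_at_def by blast
  then show False by (simp add: val_ge_def)
qed

lemma val_eq_if_close:
  assumes "f \<noteq> 0" "val_ge y (val y f + 1) (g - f)"
  shows "g \<noteq> 0 \<and> val y g = val y f"
proof (cases "g = f")
  case False
  then have d: "val y f + 1 \<le> val y (g - f)" using assms by (simp add: val_ge_def)
  have g: "g \<noteq> 0" using d by (auto simp: val_minus[of y f, symmetric] simp del: val_minus)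
  have "min (val y f) (val y (g - f)) \<le> val y g"
    using val_add[of f "g - f" y] assms False g by simp
  moreover have "min (val y g) (val y (f - g)) \<le> val y f"
    using val_add[of g "f - g" y] assms False g by simp
  moreover have "val y (f - g) = val y (g - f)" using val_minus[of y "g - f"] by simp
  ultimately show ?thesis using d g by linarith
qed (use assms in auto)

lemma cval_cls:
  assumes "cauchy_at y s" "\<not> null_at y s"
  obtains M where "\<And>n. n \<ge> M \<Longrightarrow> s n \<noteq> 0 \<and> val y (s n) = cval y (cls y s)"
proof -
  obtain N where N: "\<And>M. \<exists>n\<ge>M. \<not> val_ge y N (s n)"
    using assms(2) unfolding null_at_def by meson
  obtain M where M: "\<And>m n. m \<ge> M \<Longrightarrow> n \<ge> M \<Longrightarrow> val_ge y N (s m - s n)"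
    using assms(1) unfolding cauchy_at_def by meson
  obtain k where k: "k \<ge> M" "\<not> val_ge y N (s k)" using N by blast
  have sk: "s k \<noteq> 0" "val y (s k) + 1 \<le> N" using k by (auto simp: val_ge_def)
  have const: "s n \<noteq> 0 \<and> val y (s n) = val y (s k)" if "n \<ge> M" for n
    using val_eq_if_close[OF sk(1)] val_ge_mono[OF M[OF that k(1)] sk(2)] by blast
  have "cval y (cls y s) = val y (s k)"
    unfolding cval_def
  proof (rule the_equality)
    show "\<forall>t\<in>cls y s. eventually (\<lambda>j. val y (t j) = val y (s k)) sequentially"
    proof
      fix t assume "t \<in> cls y s"
      then have "null_at y (\<lambda>n. t n - s n)" using assms by (simp add: cls_eq)
      then obtain L where L: "\<And>n. n \<ge> L \<Longrightarrow> val_ge y (val y (s k) + 1) (t n - s n)"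
        unfolding null_at_def by meson
      have "val y (t n) = val y (s k)" if "n \<ge> max L M" for n
        using val_eq_if_close[of "s n" y "t n"] const[of n] L[of n] that by auto
      then show "eventually (\<lambda>j. val y (t j) = val y (s k)) sequentially"
        unfolding eventually_sequentially by blast
    qed
  next
    fix n assume "\<forall>t\<in>cls y s. eventually (\<lambda>j. val y (t j) = n) sequentially"
    moreover have "s \<in> cls y s" using assms by (simp add: cls_eq) (simp add: null_at_def)
    ultimately obtain L where "\<And>j. j \<ge> L \<Longrightarrow> val y (s j) = n"
      unfolding eventually_sequentially by blast
    then show "n = val y (s k)" using const[of "max L M"] by (metis max.cobounded1 max.cobounded2)
  qed
  then show ?thesis using const that by metis
qed

lemma cls_in_ring_of_integers_iff:
  assumes "cauchy_at y s"
  shows "cls y s \<in> ring_of_integers y \<longleftrightarrow> (\<exists>M. \<forall>n\<ge>M. val_ge y 0 (s n))"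
proof (cases "null_at y s")
  case True
  then have "cls y s = \<zero>\<^bsub>local_field y\<^esub>" using assms by (simp add: cls_zero cls_eq_iff)
  moreover have "\<exists>M. \<forall>n\<ge>M. val_ge y 0 (s n)" using True by (simp add: null_at_def)
  ultimately show ?thesis using assms by (auto simp: ring_of_integers_def carrier_local_field)
next
  case False
  then obtain M where M: "\<And>n. n \<ge> M \<Longrightarrow> s n \<noteq> 0 \<and> val y (s n) = cval y (cls y s)"
    using cval_cls[OF assms] by blast
  have nz: "cls y s \<noteq> \<zero>\<^bsub>local_field y\<^esub>" using assms False by (simp add: cls_zero cls_eq_iff)
  have "(\<exists>L. \<forall>n\<ge>L. val_ge y 0 (s n)) \<longleftrightarrow> 0 \<le> cval y (cls y s)"
  proof
    assume "\<exists>L. \<forall>n\<ge>L. val_ge y 0 (s n)"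
    then obtain L where "\<And>n. n \<ge> L \<Longrightarrow> val_ge y 0 (s n)" by blast
    then have "val_ge y 0 (s (max L M))" by simp
    then show "0 \<le> cval y (cls y s)" using M[of "max L M"] by (simp add: val_ge_def)
  next
    assume "0 \<le> cval y (cls y s)"
    then have "\<forall>n\<ge>M. val_ge y 0 (s n)" using M by (auto simp: val_ge_def)
    then show "\<exists>L. \<forall>n\<ge>L. val_ge y 0 (s n)" by blast
  qed
  then show ?thesis using nz assms by (auto simp: ring_of_integers_def carrier_local_field)
qed

lemma ring_of_integers_carrier: "a \<in> ring_of_integers y \<Longrightarrow> a \<in> carrier (local_field y)"
  by (simp add: ring_of_integers_def)

lemma ring_of_integers_cases:
  assumes "a \<in> ring_of_integers y"
  obtains s M where "cauchy_at y s" "a = cls y s" "\<And>n. n \<ge> M \<Longrightarrow> val_ge y 0 (s n)"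
proof -
  obtain s where s: "cauchy_at y s" "a = cls y s"
    using ring_of_integers_carrier[OF assms] by (auto simp: carrier_local_field)
  then show ?thesis using cls_in_ring_of_integers_iff[OF s(1)] assms that by blast
qed

lemma ring_of_integers_0: "\<zero>\<^bsub>local_field y\<^esub> \<in> ring_of_integers y"
  and ring_of_integers_1: "\<one>\<^bsub>local_field y\<^esub> \<in> ring_of_integers y"
  by (auto simp: cls_zero cls_one cls_in_ring_of_integers_iff val_ge_def)

lemma ring_of_integers_add:
  assumes "a \<in> ring_of_integers y" "b \<in> ring_of_integers y"
  shows "a \<oplus>\<^bsub>local_field y\<^esub> b \<in> ring_of_integers y"
proof -
  obtain s M where s: "cauchy_at y s" "a = cls y s" "\<And>n. n \<ge> M \<Longrightarrow> val_ge y 0 (s n)"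
    using ring_of_integers_cases[OF assms(1)] by blast
  obtain t L where t: "cauchy_at y t" "b = cls y t" "\<And>n. n \<ge> L \<Longrightarrow> val_ge y 0 (t n)"
    using ring_of_integers_cases[OF assms(2)] by blast
  have "\<forall>n\<ge>max M L. val_ge y 0 (s n + t n)" using s t by (auto intro: val_ge_add)
  then have "\<exists>M. \<forall>n\<ge>M. val_ge y 0 (s n + t n)" by blast
  then show ?thesis using s t by (simp add: cls_add cls_in_ring_of_integers_iff cauchy_at_add)
qed

lemma ring_of_integers_mult:
  assumes "a \<in> ring_of_integers y" "b \<in> ring_of_integers y"
  shows "a \<otimes>\<^bsub>local_field y\<^esub> b \<in> ring_of_integers y"
proof -
  obtain s M where s: "cauchy_at y s" "a = cls y s" "\<And>n. n \<ge> M \<Longrightarrow> val_ge y 0 (s n)"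
    using ring_of_integers_cases[OF assms(1)] by blast
  obtain t L where t: "cauchy_at y t" "b = cls y t" "\<And>n. n \<ge> L \<Longrightarrow> val_ge y 0 (t n)"
    using ring_of_integers_cases[OF assms(2)] by blast
  have "\<forall>n\<ge>max M L. val_ge y 0 (s n * t n)"
    using s t val_ge_mult[of y 0 _ 0] by auto
  then have "\<exists>M. \<forall>n\<ge>M. val_ge y 0 (s n * t n)" by blast
  then show ?thesis using s t by (simp add: cls_mult cls_in_ring_of_integers_iff cauchy_at_mult)
qed

lemma ring_of_integers_minus:
  assumes "a \<in> ring_of_integers y"
  shows "\<ominus>\<^bsub>local_field y\<^esub> a \<in> ring_of_integers y"
proof -
  obtain s M where s: "cauchy_at y s" "a = cls y s" "\<And>n. n \<ge> M \<Longrightarrow> val_ge y 0 (s n)"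
    using ring_of_integers_cases[OF assms] by blast
  then show ?thesis by (auto simp: cls_minus cls_in_ring_of_integers_iff cauchy_at_minus)
qed

section \<open>The adele ring\<close>

typedef (overloaded) ('k::"{field,finite}") adele =
    "{a :: 'k place \<Rightarrow> 'k celem.
       (\<forall>y. a y \<in> carrier (local_field y)) \<and> finite {y. a y \<notin> ring_of_integers y}}"
  morphisms comp Abs_adele
  by (rule exI[of _ "\<lambda>y. \<zero>\<^bsub>local_field y\<^esub>"]) (auto simp: ring_of_integers_0 ring_of_integers_carrier)

setup_lifting type_definition_adele

lemma comp_carrier [simp]: "comp a y \<in> carrier (local_field y)"
  using comp[of a] by blast

instantiation adele :: ("{field,finite}") comm_ring_1
begin

lift_definition zero_adele :: "'a adele" is "\<lambda>y. \<zero>\<^bsub>local_field y\<^esub>"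
  by (simp add: ring_of_integers_0 ring_of_integers_carrier)

lift_definition one_adele :: "'a adele" is "\<lambda>y. \<one>\<^bsub>local_field y\<^esub>"
  by (simp add: ring_of_integers_1 ring_of_integers_carrier)

lift_definition plus_adele :: "'a adele \<Rightarrow> 'a adele \<Rightarrow> 'a adele"
  is "\<lambda>a b y. a y \<oplus>\<^bsub>local_field y\<^esub> b y"
proof (intro conjI allI)
  fix a b :: "'a place \<Rightarrow> 'a celem"
  assume a: "(\<forall>y. a y \<in> carrier (local_field y)) \<and> finite {y. a y \<notin> ring_of_integers y}"
    and b: "(\<forall>y. b y \<in> carrier (local_field y)) \<and> finite {y. b y \<notin> ring_of_integers y}"
  show "a y \<oplus>\<^bsub>local_field y\<^esub> b y \<in> carrier (local_field y)" for y
    using a b by (simp add: cring.cring_simprules(1)[OF local_field_cring])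
  have "{y. a y \<oplus>\<^bsub>local_field y\<^esub> b y \<notin> ring_of_integers y} \<subseteq>
      {y. a y \<notin> ring_of_integers y} \<union> {y. b y \<notin> ring_of_integers y}"
    using ring_of_integers_add by blast
  then show "finite {y. a y \<oplus>\<^bsub>local_field y\<^esub> b y \<notin> ring_of_integers y}"
    using a b finite_subset by blast
qed

lift_definition times_adele :: "'a adele \<Rightarrow> 'a adele \<Rightarrow> 'a adele"
  is "\<lambda>a b y. a y \<otimes>\<^bsub>local_field y\<^esub> b y"
proof (intro conjI allI)
  fix a b :: "'a place \<Rightarrow> 'a celem"
  assume a: "(\<forall>y. a y \<in> carrier (local_field y)) \<and> finite {y. a y \<notin> ring_of_integers y}"
    and b: "(\<forall>y. b y \<in> carrier (local_field y)) \<and> finite {y. b y \<notin> ring_of_integers y}"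
  show "a y \<otimes>\<^bsub>local_field y\<^esub> b y \<in> carrier (local_field y)" for y
    using a b by (simp add: cring.cring_simprules(5)[OF local_field_cring])
  have "{y. a y \<otimes>\<^bsub>local_field y\<^esub> b y \<notin> ring_of_integers y} \<subseteq>
      {y. a y \<notin> ring_of_integers y} \<union> {y. b y \<notin> ring_of_integers y}"
    using ring_of_integers_mult by blast
  then show "finite {y. a y \<otimes>\<^bsub>local_field y\<^esub> b y \<notin> ring_of_integers y}"
    using a b finite_subset by blast
qed

lift_definition uminus_adele :: "'a adele \<Rightarrow> 'a adele"
  is "\<lambda>a y. \<ominus>\<^bsub>local_field y\<^esub> a y"
  by (auto intro: cring.cring_simprules(3)[OF local_field_cring]
      elim!: finite_subset[rotated] dest: ring_of_integers_minus)

definition minus_adele :: "'a adele \<Rightarrow> 'a adele \<Rightarrow> 'a adele"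
  where "minus_adele a b = a + - b"

instance
proof
  fix a b c :: "'a adele"
  note cr = cring.cring_simprules[OF local_field_cring]
  show "a + b + c = a + (b + c)" by transfer (auto simp: cr)
  show "a + b = b + a" by transfer (auto simp: cr(10))
  show "0 + a = a" by transfer (auto simp: cr)
  show "- a + a = 0" by transfer (auto simp: cr)
  show "a - b = a + - b" by (rule minus_adele_def)
  show "a * b * c = a * (b * c)" by transfer (auto simp: cr)
  show "a * b = b * a" by transfer (auto simp: cr(14))
  show "1 * a = a" by transfer (auto simp: cr(12))
  show "(a + b) * c = a * c + b * c" by transfer (auto simp: cr(13))
  show "(0::'a adele) \<noteq> 1"
    by transfer (use local_field_one_neq_zero in metis)
qed

end

text \<open>The restricted product topology.\<close>

definition adele_boxes :: "'k::{field,finite} adele set set"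
  where "adele_boxes = {{a. \<forall>y. comp a y \<in> U y} | U.
    (\<forall>y. open_at y (U y)) \<and> finite {y. U y \<noteq> ring_of_integers y}}"

instantiation adele :: ("{field,finite}") topological_space
begin

definition open_adele :: "'a adele set \<Rightarrow> bool"
  where "open_adele = generate_topology adele_boxes"

instance
  by standard (auto simp: open_adele_def intro: generate_topology.intros)

end

definition adele_integers :: "'k::{field,finite} adele set"
  where "adele_integers = {a. \<forall>y. comp a y \<in> ring_of_integers y}"

text \<open>The adele \<open>a\<close> with its component at \<open>x\<close> replaced by \<open>c\<close>.\<close>

lift_definition adele_upd :: "'k::{field,finite} adele \<Rightarrow> 'k place \<Rightarrow> 'k celem \<Rightarrow> 'k adele"
  is "\<lambda>a x c. if c \<in> carrier (local_field x) then a(x := c) else a"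
proof -
  fix a :: "'k place \<Rightarrow> 'k celem" and x c
  assume a: "(\<forall>y. a y \<in> carrier (local_field y)) \<and> finite {y. a y \<notin> ring_of_integers y}"
  have "finite {y. (a(x := c)) y \<notin> ring_of_integers y}"
    by (rule finite_subset[of _ "insert x {y. a y \<notin> ring_of_integers y}"]) (use a in auto)
  then show "(\<forall>y. (if c \<in> carrier (local_field x) then a(x := c) else a) y \<in> carrier (local_field y)) \<and>
      finite {y. (if c \<in> carrier (local_field x) then a(x := c) else a) y \<notin> ring_of_integers y}"
    using a by auto
qed

section \<open>The adelic general linear group\<close>

typedef (overloaded) ('k::"{field,finite}") gl2 = "{g :: 'k adele^2^2. invertible g}"
  morphisms mat_of Abs_gl2
  by (rule exI[of _ "mat 1"]) (simp add: invertible_def exI[of _ "mat 1"])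

setup_lifting type_definition_gl2

lemma matrix_inv_invertible:
  fixes A :: "'a::semiring_1^'n^'n"
  assumes "invertible A"
  shows "A ** matrix_inv A = mat 1" "matrix_inv A ** A = mat 1"
  using someI_ex[OF assms[unfolded invertible_def]] unfolding matrix_inv_def by auto

lemma invertible_matrix_inv:
  fixes A :: "'a::semiring_1^'n^'n"
  assumes "invertible A"
  shows "invertible (matrix_inv A)"
  using matrix_inv_invertible[OF assms] unfolding invertible_def by blast

instantiation gl2 :: ("{field,finite}") "{monoid_mult, inverse}"
begin

lift_definition one_gl2 :: "'a gl2" is "mat 1"
  by (simp add: invertible_def exI[of _ "mat 1"])

lift_definition times_gl2 :: "'a gl2 \<Rightarrow> 'a gl2 \<Rightarrow> 'a gl2" is "(**)"
  by (rule invertible_mult)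

lift_definition inverse_gl2 :: "'a gl2 \<Rightarrow> 'a gl2" is matrix_inv
  by (rule invertible_matrix_inv)

definition divide_gl2 :: "'a gl2 \<Rightarrow> 'a gl2 \<Rightarrow> 'a gl2"
  where "divide_gl2 g h = g * inverse h"

instance
  by standard (transfer, simp add: matrix_mul_assoc)+

end

lemma gl2_inverse: "inverse g * g = 1" "g * inverse g = (1 :: 'k::{field,finite} gl2)"
  by (transfer, simp add: matrix_inv_invertible)+

text \<open>
  The topology of \<open>GL\<^sub>2\<close> of a topological ring is the initial one for
  \<open>g \<mapsto> (g, g\<^sup>-\<^sup>1)\<close>; the subspace topology would not make inversion continuous.
\<close>

instantiation gl2 :: ("{field,finite}") topological_space
begin

definition open_gl2 :: "'a gl2 set \<Rightarrow> bool"
  where "open_gl2 U \<longleftrightarrow> (\<exists>V. open V \<and> U = {g. (mat_of g, mat_of (inverse g)) \<in> V})"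

instance
proof
  show "open (UNIV :: 'a gl2 set)"
    unfolding open_gl2_def by (rule exI[of _ UNIV]) simp
next
  fix S T :: "'a gl2 set" assume "open S" "open T"
  then obtain V W where "open V" "S = {g. (mat_of g, mat_of (inverse g)) \<in> V}"
    "open W" "T = {g. (mat_of g, mat_of (inverse g)) \<in> W}" unfolding open_gl2_def by blast
  then show "open (S \<inter> T)"
    unfolding open_gl2_def by (intro exI[of _ "V \<inter> W"]) auto
next
  fix \<S> :: "'a gl2 set set" assume "\<forall>S\<in>\<S>. open S"
  then have "\<forall>S\<in>\<S>. \<exists>V. open V \<and> S = {g. (mat_of g, mat_of (inverse g)) \<in> V}"
    by (simp only: open_gl2_def)
  then obtain V where V: "\<forall>S\<in>\<S>. open (V S) \<and> S = {g. (mat_of g, mat_of (inverse g)) \<in> V S}"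
    by (rule bchoice[THEN exE])
  have "g \<in> S \<longleftrightarrow> (mat_of g, mat_of (inverse g)) \<in> V S" if "S \<in> \<S>" for g S
  proof -
    have "S = {g. (mat_of g, mat_of (inverse g)) \<in> V S}" using bspec[OF V that] by (rule conjunct2)
    then show ?thesis by (metis (mono_tags) mem_Collect_eq)
  qed
  then have "\<Union>\<S> = {g. (mat_of g, mat_of (inverse g)) \<in> (\<Union>S\<in>\<S>. V S)}"
    by auto
  moreover have "open (\<Union>S\<in>\<S>. V S)"
    using V by (intro open_UN ballI) (drule (1) bspec, erule conjunct1)
  ultimately show "open (\<Union>\<S>)"
    unfolding open_gl2_def by (intro exI conjI)
qed

end

abbreviation entry :: "'k::{field,finite} gl2 \<Rightarrow> 2 \<Rightarrow> 2 \<Rightarrow> 'k place \<Rightarrow> 'k celem"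
  where "entry g i j y \<equiv> comp (mat_of g $ i $ j) y"

text \<open>
  The diagonally embedded group of rational points: all local components of \<open>g\<close> come from
  one and the same invertible matrix over the rational function field.
\<close>

definition gl2_rational :: "'k::{field,finite} gl2 set"
  where "gl2_rational = {g. \<exists>\<gamma> :: 'k ratfun^2^2. invertible \<gamma> \<and>
    (\<forall>i j y. entry g i j y = emb y (\<gamma> $ i $ j))}"

definition gl2_center :: "'k::{field,finite} gl2 set"
  where "gl2_center = {z. \<forall>g. z * g = g * z}"

definition gl2_integral :: "'k::{field,finite} gl2 set"
  where "gl2_integral = {g. \<forall>i j. mat_of g $ i $ j \<in> adele_integers \<and>
    mat_of (inverse g) $ i $ j \<in> adele_integers}"

text \<open>
  Integral matrices that are congruent to the identity at \<open>x\<close>; at the other places there is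
  no condition besides integrality.
\<close>

definition congruence_subgroup :: "'k::{field,finite} place \<Rightarrow> 'k ratfun \<Rightarrow> 'k gl2 set"
  where "congruence_subgroup x \<pi> = {k \<in> gl2_integral.
    \<forall>i j. entry k i j x \<ominus>\<^bsub>local_field x\<^esub> entry 1 i j x \<in> uniformizer_ideal x \<pi>}"

text \<open>
  A matrix over the completion at \<open>x\<close>, viewed in the adelic group by putting the identity at
  all other places (meaningful if the matrix is invertible).
\<close>

definition gl2_at :: "'k::{field,finite} place \<Rightarrow> 'k celem^2^2 \<Rightarrow> 'k gl2"
  where "gl2_at x m = Abs_gl2 (\<chi> i j. adele_upd (mat 1 $ i $ j) x (m $ i $ j))"

section \<open>Hecke operators and automorphic forms\<close>

text \<open>Left-invariant Radon measures that are positive on nonempty open sets.\<close>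

definition haar_measure :: "'g::{topological_space,times} measure \<Rightarrow> bool"
  where "haar_measure \<mu> \<longleftrightarrow>
    sets \<mu> = sets borel \<and>
    (\<forall>g. \<forall>A\<in>sets borel. emeasure \<mu> ((*) g ` A) = emeasure \<mu> A) \<and>
    (\<forall>C. compact C \<longrightarrow> emeasure \<mu> C < \<infinity>) \<and>
    (\<forall>U. open U \<longrightarrow> U \<noteq> {} \<longrightarrow> 0 < emeasure \<mu> U) \<and>
    (\<forall>A\<in>sets borel. emeasure \<mu> A = (INF U\<in>{U. open U \<and> A \<subseteq> U}. emeasure \<mu> U)) \<and>
    (\<forall>U. open U \<longrightarrow> emeasure \<mu> U = (SUP C\<in>{C. compact C \<and> C \<subseteq> U}. emeasure \<mu> C))"

definition hecke_action ::
    "'k::{field,finite} gl2 measure \<Rightarrow> ('k gl2 \<Rightarrow> complex) \<Rightarrow> ('k gl2 \<Rightarrow> complex) \<Rightarrow> 'k gl2 \<Rightarrow> complex"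
  where "hecke_action \<mu> \<Phi> f g = (\<integral>h. \<Phi> h * f (g * h) \<partial>\<mu>)"

definition local_size :: "'k::{field,finite} place \<Rightarrow> 'k gl2 \<Rightarrow> real"
  where "local_size y g = Max (insert (cabs y (inv\<^bsub>local_field y\<^esub> (comp (det (mat_of g)) y)))
    {cabs y (entry g i j y) | i j. True})"

text \<open>
  \<open>Prod_any\<close> is the product over the finitely many \<open>y\<close> with factor different from \<open>1\<close>.
\<close>

definition adelic_size :: "'k::{field,finite} gl2 \<Rightarrow> real"
  where "adelic_size g = Prod_any (\<lambda>y. local_size y g)"

definition moderate_growth :: "('k::{field,finite} gl2 \<Rightarrow> complex) \<Rightarrow> bool"
  where "moderate_growth f \<longleftrightarrow> (\<exists>C N :: real. \<forall>g. norm (f g) \<le> C * adelic_size g powr N)"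

definition automorphic_forms :: "'k::{field,finite} gl2 set \<Rightarrow> ('k gl2 \<Rightarrow> complex) set"
  where "automorphic_forms K' = {f.
    (\<forall>\<gamma>\<in>gl2_rational. \<forall>g. f (\<gamma> * g) = f g) \<and>
    (\<forall>z\<in>gl2_center. \<forall>g. f (z * g) = f g) \<and>
    (\<forall>k\<in>K'. \<forall>g. f (g * k) = f g) \<and>
    moderate_growth f}"

definition hecke_eigenspace :: "'k::{field,finite} gl2 measure \<Rightarrow> 'k gl2 set \<Rightarrow>
    ('k gl2 \<Rightarrow> complex) \<Rightarrow> complex \<Rightarrow> ('k gl2 \<Rightarrow> complex) set"
  where "hecke_eigenspace \<mu> K' \<Phi> l =
    {f \<in> automorphic_forms K'. hecke_action \<mu> \<Phi> f = (\<lambda>g. l * f g)}"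

definition ramified_hecke :: "'k::{field,finite} place \<Rightarrow> 'k ratfun \<Rightarrow> 'k gl2 \<Rightarrow> complex"
  where "ramified_hecke x \<pi> = indicator
    {k * gl2_at x (vector [vector [emb x \<pi>, emb x 0], vector [emb x 0, emb x 1]]) * k' | k k'.
      k \<in> congruence_subgroup x \<pi> \<and> k' \<in> congruence_subgroup x \<pi>}"

text \<open>Complex-valued functions as a complex vector space; this provides \<open>cfun.dim\<close>.\<close>

global_interpretation cfun: vector_space "\<lambda>(c::complex) (f::'a \<Rightarrow> complex) x. c * f x"
  by unfold_locales (auto simp: algebra_simps)

end

theory Submission
  imports Defs "HOL-Computational_Algebra.Polynomial_Factorial"
begin

text \<open>
  Since \<open>x\<close> has degree one, there is a coordinate \<open>s\<close> of the projective line whose only pole,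
  a simple one, is at \<open>x\<close> (\<open>degree_one_coordinate\<close>); the functions that are regular away from
  \<open>x\<close> are the polynomials in \<open>s\<close>.  Strong approximation removes all places but \<open>x\<close>, and a
  Euclidean reduction at \<open>x\<close> brings every element of the adelic group, modulo rational matrices
  on the left, the center, and the congruence subgroup \<open>K'\<close> on the right, to
  \<open>diag(s\<^sup>n, 1) \<kappa>\<close> at \<open>x\<close> with \<open>n \<ge> 0\<close> and a constant matrix \<open>\<kappa>\<close> (\<open>located_exists\<close>).  This is the
  rank two bundle \<open>O(n) \<oplus> O\<close> together with a basis \<open>\<kappa>\<close> of its fibre at \<open>x\<close>.  The number \<open>n\<close> is
  determined by the double coset, and for \<open>n > 0\<close> so is the question whether the second basis
  vector spans the fibre of \<open>O(n)\<close>, that is, whether \<open>\<kappa>\<^sub>2\<^sub>2 = 0\<close> (\<open>located_unique\<close>).  Call the basis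
  special in this case and transversal otherwise.

  The double coset of \<open>diag(\<pi>, 1)\<close> is the union of \<open>q\<close> cosets \<open>\<xi> K'\<close>, so on functions that are
  right invariant under \<open>K'\<close> the Hecke operator is \<open>vol(K')\<close> times a sum of \<open>q\<close> values
  (\<open>hecke_action_sum\<close>).  A transversal point at \<open>n + 1\<close> has all its \<open>q\<close> neighbours in the
  transversal class at \<open>n\<close> (\<open>hecke_down\<close>); a special point at \<open>n\<close>, or any point at \<open>n = 0\<close>, has one special
  and \<open>q - 1\<close> transversal neighbours at \<open>n + 1\<close> (\<open>hecke_up\<close>).  With \<open>l' = l / vol(K') \<noteq> 0\<close> the
  eigenvalue equation therefore says that the transversal values are \<open>(q/l')\<^sup>n f(1)\<close> and that the
  special values satisfy \<open>b\<^sub>n\<^sub>+\<^sub>1 = l' b\<^sub>n - (q - 1) (q/l')\<^sup>n\<^sup>+\<^sup>1 f(1)\<close> with \<open>b\<^sub>0 = f(1)\<close>.  So an eigenfunction is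
  determined by \<open>f(1)\<close> (\<open>eigenfunction_unique\<close>), and conversely these formulas define one
  (\<open>eigenform_hecke\<close>).  Its values grow at most exponentially in \<open>n\<close>, and the product formula bounds
  \<open>q\<^sup>n\<close> by the third power of the adelic size (\<open>adelic_size_lower_bound\<close>), which gives moderate growth.

  In the double cosets the completions enter only through the density of the rational functions: modulo \<open>K'\<close> every
  adelic matrix is a family of rational matrices, one for each place (\<open>family_approximation\<close>), so
  the local computations take place in the rational function field.
\<close>

section \<open>Rational functions as quotients of polynomials in a coordinate\<close>

lemma const_rat_0 [simp]: "const_rat 0 = 0"
  by (simp add: const_rat_def Zero_fract_def)

lemma const_rat_1 [simp]: "const_rat 1 = 1"
  by (simp add: const_rat_def One_fract_def one_pCons)

lemma const_rat_add: "const_rat (a + b) = const_rat a + const_rat b"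
  by (simp add: const_rat_def)

lemma const_rat_mult: "const_rat (a * b) = const_rat a * const_rat b"
  by (simp add: const_rat_def mult.commute)

lemma const_rat_minus: "const_rat (- a) = - const_rat a"
  by (simp add: const_rat_def)

lemma const_rat_diff: "const_rat (a - b) = const_rat a - const_rat b"
  by (simp add: const_rat_def)

lemma const_rat_eq_0_iff [simp]: "const_rat c = 0 \<longleftrightarrow> c = 0"
  by (simp add: const_rat_def Zero_fract_def eq_fract)

lemma const_rat_inverse: "c \<noteq> 0 \<Longrightarrow> const_rat (inverse c) = inverse (const_rat c)"
  using const_rat_mult[of c "inverse c"] by (simp add: inverse_unique)

definition ev :: "'k::field ratfun \<Rightarrow> 'k poly \<Rightarrow> 'k ratfun"
  where "ev s P = poly (map_poly const_rat P) s"

lemma ev_0 [simp]: "ev s 0 = 0"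
  by (simp add: ev_def)

lemma ev_pCons: "ev s (pCons a P) = const_rat a + s * ev s P"
  by (simp add: ev_def map_poly_pCons)

lemma ev_const [simp]: "ev s [:c:] = const_rat c"
  by (simp add: ev_pCons)

lemma ev_1 [simp]: "ev s 1 = 1"
  using ev_const[of s 1] by (simp add: one_pCons)

lemma ev_add: "ev s (P + Q) = ev s P + ev s Q"
  by (induction P Q rule: poly_induct2) (auto simp: ev_pCons algebra_simps const_rat_add)

lemma ev_minus: "ev s (- P) = - ev s P"
  using ev_add[of s P "- P"] by (simp add: eq_neg_iff_add_eq_0 add.commute)

lemma ev_diff: "ev s (P - Q) = ev s P - ev s Q"
  using ev_add[of s P "- Q"] by (simp add: ev_minus)

lemma ev_smult: "ev s (smult c P) = const_rat c * ev s P"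
  by (induction P) (auto simp: ev_pCons algebra_simps const_rat_mult)

lemma ev_mult: "ev s (P * Q) = ev s P * ev s Q"
  by (induction P) (auto simp: ev_pCons ev_add ev_smult algebra_simps)

lemma ev_power: "ev s (P ^ n) = ev s P ^ n"
  by (induction n) (auto simp: ev_mult)

lemma val_0 [simp]: "val y 0 = 0"
  using val[of y] by (simp add: is_normalized_valuation_def)

lemma val_power: "f \<noteq> 0 \<Longrightarrow> val y (f ^ n) = int n * val y f"
  by (induction n) (auto simp: val_mult algebra_simps)

lemma val_inverse: "val y (inverse f) = - val y f"
proof (cases "f = 0")
  case False
  then show ?thesis using val_mult[of f "inverse f" y] by simp
qed simp

lemma val_divide: "f \<noteq> 0 \<Longrightarrow> g \<noteq> 0 \<Longrightarrow> val y (f / g) = val y f - val y g"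
  by (simp add: divide_inverse val_mult val_inverse)

lemma val_powi: "f \<noteq> 0 \<Longrightarrow> val y (f powi n) = n * val y f"
  by (cases n) (auto simp: power_int_def val_power val_inverse algebra_simps)

lemma val_ge_const [simp]: "val_ge y 0 (const_rat c)"
  by (cases "c = 0") (auto simp: val_ge_def val_const)

lemma val_ge_one [simp]: "val_ge y 0 1"
  by (simp add: val_ge_def)

lemma val_ge_iff: "f \<noteq> 0 \<Longrightarrow> val_ge y N f \<longleftrightarrow> N \<le> val y f"
  by (simp add: val_ge_def)

lemma val_ge_mult_left: "val_ge y 0 f \<Longrightarrow> val_ge y N g \<Longrightarrow> val_ge y N (f * g)"
  using val_ge_mult[of y 0 f N g] by simp

lemma val_ge_mult_right: "val_ge y N f \<Longrightarrow> val_ge y 0 g \<Longrightarrow> val_ge y N (f * g)"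
  using val_ge_mult[of y N f 0 g] by simp

lemma val_ge_ev: "val_ge y 0 s \<Longrightarrow> val_ge y 0 (ev s P)"
  by (induction P) (auto simp: ev_pCons intro!: val_ge_add val_ge_mult_left)

lemma val_ge_power: "val_ge y 0 f \<Longrightarrow> val_ge y 0 (f ^ n)"
  by (induction n) (auto intro!: val_ge_mult_left)

lemma val_ge_all_eq_0:
  assumes "\<And>n. val_ge y (int n) f"
  shows "f = 0"
  using assms[of "nat (val y f + 1)"] by (auto simp: val_ge_def split: if_splits)

text \<open>At a pole of \<open>s\<close> the leading term of a polynomial in \<open>s\<close> dominates.\<close>

lemma val_ev_pole:
  assumes "val y s < 0" "P \<noteq> 0"
  shows "ev s P \<noteq> 0 \<and> val y (ev s P) = int (degree P) * val y s"
  using assms(2)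
proof (induction P)
  case (pCons a P)
  have s: "s \<noteq> 0" using assms by auto
  show ?case
  proof (cases "P = 0")
    case True
    then show ?thesis using pCons by (simp add: val_const)
  next
    case False
    then have IH: "ev s P \<noteq> 0" "val y (ev s P) = int (degree P) * val y s" using pCons by auto
    have v: "val y (s * ev s P) = int (Suc (degree P)) * val y s"
      using s IH by (simp add: val_mult algebra_simps)
    have "int (Suc (degree P)) * val y s < 0" using assms(1) by (simp add: mult_pos_neg)
    then have "val_ge y (val y (s * ev s P) + 1) (const_rat a)"
      unfolding v by (intro val_ge_mono[OF val_ge_const]) simp
    then have "ev s (pCons a P) \<noteq> 0 \<and> val y (ev s (pCons a P)) = val y (s * ev s P)"
      using val_eq_if_close[of "s * ev s P" y "ev s (pCons a P)"] s IH by (simp add: ev_pCons)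
    then show ?thesis using v False by simp
  qed
qed simp

subsection \<open>Prime factors\<close>

lemma prime_power_factor:
  fixes p P :: "'k::field poly"
  assumes "degree p \<ge> 1" "P \<noteq> 0"
  obtains n R where "P = p ^ n * R" "\<not> p dvd R"
  using assms(2)
proof (induction "degree P" arbitrary: P thesis rule: less_induct)
  case less
  show ?case
  proof (cases "p dvd P")
    case True
    then obtain Q where Q: "P = p * Q" by (rule dvdE)
    then have "Q \<noteq> 0" "p \<noteq> 0" using less by auto
    then have "degree Q < degree P" using Q assms(1) by (simp add: degree_mult_eq)
    then obtain n R where "Q = p ^ n * R" "\<not> p dvd R" using less(1) \<open>Q \<noteq> 0\<close> by blast
    then show ?thesis using less(2)[of "Suc n" R] Q by (simp add: mult.assoc)
  next
    case False
    then show ?thesis using less(2)[of 0 P] by simp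
  qed
qed

text \<open>
  A nonconstant divisor of minimal degree is irreducible, and irreducible polynomials over a field are prime.
\<close>

lemma exists_prime_factor:
  fixes P :: "'k::field poly"
  assumes "degree P \<ge> 1"
  obtains p where "p dvd P" "degree p \<ge> 1" "prime_elem p"
proof -
  obtain p where p: "p dvd P \<and> degree p \<ge> 1" "\<And>r. r dvd P \<and> degree r \<ge> 1 \<Longrightarrow> degree p \<le> degree r"
    using assms ex_has_least_nat[of "\<lambda>p. p dvd P \<and> degree p \<ge> 1" P degree] by auto
  have "irreducible p"
  proof (rule irreducibleI)
    show "p \<noteq> 0" using p by auto
    show "\<not> p dvd 1" using p \<open>p \<noteq> 0\<close> by (auto simp: is_unit_iff_degree)
    fix a b assume ab: "p = a * b"
    then have nz: "a \<noteq> 0" "b \<noteq> 0" using \<open>p \<noteq> 0\<close> by auto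
    have "degree a = 0 \<or> degree b = 0"
    proof (rule ccontr)
      assume *: "\<not> ?thesis"
      then have "degree p \<le> degree a" using p(1) ab by (intro p(2)) (auto intro: dvd_trans)
      then show False using * nz ab by (simp add: degree_mult_eq)
    qed
    then show "a dvd 1 \<or> b dvd 1" using nz by (simp add: is_unit_iff_degree)
  qed
  then show ?thesis using that p field_poly_irreducible_imp_prime by blast
qed

subsection \<open>Coordinates\<close>

text \<open>
  A coordinate with its simple pole at \<open>x\<close>: it turns the complement of \<open>x\<close> into the affine
  line, so that \<open>x\<close> plays the role of the point at infinity.
\<close>

locale coordinate =
  fixes x :: "'k::{field,finite} place" and s :: "'k ratfun"
  assumes val_s: "val x s = -1"
    and generator: "\<And>f. \<exists>P Q. Q \<noteq> 0 \<and> f = ev s P / ev s Q"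
begin

lemma s_nz [simp]: "s \<noteq> 0"
  using val_s by auto

lemma ev_nz [simp]: "ev s P = 0 \<longleftrightarrow> P = 0"
  using val_ev_pole[of x s P] val_s by auto

lemma ev_inj: "ev s P = ev s Q \<longleftrightarrow> P = Q"
  using ev_nz[of "P - Q"] by (simp add: ev_diff)

lemma val_x_ev: "P \<noteq> 0 \<Longrightarrow> val x (ev s P) = - int (degree P)"
  using val_ev_pole[of x s P] val_s by auto

lemma fraction_cases:
  obtains P Q where "Q \<noteq> 0" "f = ev s P / ev s Q" "f \<noteq> 0 \<Longrightarrow> P \<noteq> 0"
  using generator[of f] by force

lemma place_eqI:
  assumes "\<And>P. P \<noteq> 0 \<Longrightarrow> val y (ev s P) = val z (ev s P)"
  shows "y = z"
proof -
  have "val y f = val z f" for f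
  proof (cases "f = 0")
    case False
    then obtain P Q where "Q \<noteq> 0" "f = ev s P / ev s Q" "P \<noteq> 0" by (metis fraction_cases)
    then show ?thesis using assms by (simp add: val_divide)
  qed simp
  then show ?thesis by (simp add: val_inject[symmetric] fun_eq_iff)
qed

lemma exists_val_1:
  obtains P Q where "P \<noteq> 0" "Q \<noteq> 0" "val y (ev s P) - val y (ev s Q) = 1"
proof -
  obtain f where "f \<noteq> 0" "val y f = 1"
    using val[of y] by (auto simp: is_normalized_valuation_def)
  moreover then obtain P Q where "Q \<noteq> 0" "f = ev s P / ev s Q" "P \<noteq> 0" by (metis fraction_cases)
  ultimately show ?thesis using that by (simp add: val_divide)
qed

text \<open>
  If \<open>s\<close> has a pole of order \<open>m\<close> at \<open>y\<close>, then all values of the valuation are multiples of \<open>m\<close>, so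
  normalization forces \<open>m = 1\<close>, and the valuation is minus the degree.
\<close>

lemma pole_unique:
  assumes "val y s < 0"
  shows "y = x"
proof (rule place_eqI)
  obtain P Q where PQ: "P \<noteq> 0" "Q \<noteq> 0" "val y (ev s P) - val y (ev s Q) = 1" by (rule exists_val_1)
  then have "(int (degree P) - int (degree Q)) * val y s = 1"
    using val_ev_pole[OF assms] by (simp add: algebra_simps)
  then have "val y s = -1" using assms by (auto simp: zmult_eq_1_iff)
  then show "val y (ev s P) = val x (ev s P)" if "P \<noteq> 0" for P
    using val_ev_pole[OF assms that] that by (simp add: val_x_ev)
qed

lemma val_ge_s: "y \<noteq> x \<Longrightarrow> val_ge y 0 s"
  using pole_unique[of y] by (force simp: val_ge_def)

lemma val_ge_ev': "y \<noteq> x \<Longrightarrow> val_ge y 0 (ev s P)"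
  by (rule val_ge_ev[OF val_ge_s])

lemma val_ev_nonneg: "y \<noteq> x \<Longrightarrow> 0 \<le> val y (ev s P)"
  using val_ge_ev'[of y P] by (cases "ev s P = 0") (auto simp: val_ge_def)

subsection \<open>Places away from the pole correspond to prime polynomials\<close>

text \<open>
  Any polynomial of minimal degree among those that vanish at \<open>y\<close> serves; it is unique up to a constant factor.
\<close>

definition prime_of :: "'k place \<Rightarrow> 'k poly"
  where "prime_of y = (SOME p. (p \<noteq> 0 \<and> val y (ev s p) > 0) \<and>
    (\<forall>P. P \<noteq> 0 \<and> val y (ev s P) > 0 \<longrightarrow> degree p \<le> degree P))"

context
  fixes y assumes yx: "y \<noteq> x"
begin

lemma prime_of_props:
  "prime_of y \<noteq> 0" "val y (ev s (prime_of y)) > 0"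
  "\<And>P. P \<noteq> 0 \<Longrightarrow> val y (ev s P) > 0 \<Longrightarrow> degree (prime_of y) \<le> degree P"
proof -
  obtain P Q where PQ: "P \<noteq> 0" "Q \<noteq> 0" "val y (ev s P) - val y (ev s Q) = 1" by (rule exists_val_1)
  have "val y (ev s P) > 0" using PQ val_ev_nonneg[OF yx, of Q] by linarith
  then have "\<exists>p. (p \<noteq> 0 \<and> val y (ev s p) > 0) \<and>
    (\<forall>P. P \<noteq> 0 \<and> val y (ev s P) > 0 \<longrightarrow> degree p \<le> degree P)"
    using PQ ex_has_least_nat[of "\<lambda>p. p \<noteq> 0 \<and> val y (ev s p) > 0" P degree] by blast
  from someI_ex[OF this] show
    "prime_of y \<noteq> 0" "val y (ev s (prime_of y)) > 0"
    "\<And>P. P \<noteq> 0 \<Longrightarrow> val y (ev s P) > 0 \<Longrightarrow> degree (prime_of y) \<le> degree P"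
    unfolding prime_of_def[symmetric] by auto
qed

lemma degree_prime_of: "degree (prime_of y) \<ge> 1"
proof (rule ccontr)
  assume "\<not> ?thesis"
  then obtain c where c: "prime_of y = [:c:]" by (metis degree_eq_zeroE less_one not_le)
  then show False using prime_of_props(1,2) by (simp add: val_const)
qed

text \<open>
  The polynomials that vanish at \<open>y\<close> form an ideal, so division with remainder by an element of
  minimal degree leaves remainder \<open>0\<close>.
\<close>

lemma prime_of_dvd_iff: "prime_of y dvd P \<longleftrightarrow> val_ge y 1 (ev s P)"
proof
  assume "prime_of y dvd P"
  then obtain Q where "P = prime_of y * Q" by (rule dvdE)
  moreover have "val_ge y 1 (ev s (prime_of y))" using prime_of_props(1,2) by (simp add: val_ge_def)
  ultimately show "val_ge y 1 (ev s P)" by (simp add: ev_mult val_ge_mult_right val_ge_ev'[OF yx])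
next
  assume P: "val_ge y 1 (ev s P)"
  have "val_ge y 1 (ev s (prime_of y))" using prime_of_props(1,2) by (simp add: val_ge_def)
  then have "val_ge y 1 (ev s (P - prime_of y * (P div prime_of y)))"
    unfolding ev_diff ev_mult by (intro val_ge_diff P val_ge_mult_right val_ge_ev'[OF yx])
  then have r: "val_ge y 1 (ev s (P mod prime_of y))" by (simp add: minus_mult_div_eq_mod)
  have "P mod prime_of y = 0"
  proof (rule ccontr)
    assume nz: "P mod prime_of y \<noteq> 0"
    then have "degree (P mod prime_of y) < degree (prime_of y)"
      using degree_mod_less[OF prime_of_props(1), of P] by simp
    moreover have "degree (prime_of y) \<le> degree (P mod prime_of y)"
      using r nz by (intro prime_of_props(3)) (auto simp: val_ge_def)
    ultimately show False by simp
  qed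
  then show "prime_of y dvd P" by (simp add: dvd_eq_mod_eq_0)
qed

lemma prime_of_prime: "prime_of y dvd P * Q \<Longrightarrow> prime_of y dvd P \<or> prime_of y dvd Q"
  using val_ev_nonneg[OF yx, of P] val_ev_nonneg[OF yx, of Q]
  by (cases "P = 0"; cases "Q = 0") (auto simp: prime_of_dvd_iff ev_mult val_ge_iff val_mult)

lemma val_ev_not_dvd: "\<not> prime_of y dvd P \<Longrightarrow> val y (ev s P) = 0"
  using val_ev_nonneg[OF yx, of P] by (cases "P = 0") (auto simp: prime_of_dvd_iff val_ge_iff)

lemma val_prime_of [simp]: "val y (ev s (prime_of y)) = 1"
proof -
  have *: "\<exists>k. val y (ev s P) = k * val y (ev s (prime_of y))" if nz: "P \<noteq> 0" for P
  proof -
    obtain n R where R: "P = prime_of y ^ n * R" "\<not> prime_of y dvd R"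
      using prime_power_factor[OF degree_prime_of nz] by blast
    then have "R \<noteq> 0" by auto
    then have "val y (ev s P) = int n * val y (ev s (prime_of y))"
      using R prime_of_props(1) by (simp add: ev_mult ev_power val_mult val_power val_ev_not_dvd)
    then show ?thesis by blast
  qed
  obtain P Q where PQ: "P \<noteq> 0" "Q \<noteq> 0" "val y (ev s P) - val y (ev s Q) = 1" by (rule exists_val_1)
  obtain k l where "val y (ev s P) = k * val y (ev s (prime_of y))" "val y (ev s Q) = l * val y (ev s (prime_of y))"
    using * PQ by blast
  then have "(k - l) * val y (ev s (prime_of y)) = 1" using PQ(3) by (simp add: algebra_simps)
  then show ?thesis using prime_of_props(2) by (auto simp: zmult_eq_1_iff)
qed

lemma val_ev_prime_of_power:
  assumes "\<not> prime_of y dvd R"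
  shows "val y (ev s (prime_of y ^ n * R)) = int n"
  using assms prime_of_props(1) by (cases "R = 0") (auto simp: ev_mult ev_power val_mult val_power val_ev_not_dvd)

lemma fraction_coprime:
  assumes "val_ge y 0 f"
  obtains P Q where "\<not> prime_of y dvd Q" "f = ev s P / ev s Q"
proof -
  obtain P Q where PQ: "Q \<noteq> 0" "f = ev s P / ev s Q" by (metis fraction_cases)
  obtain n R where R: "Q = prime_of y ^ n * R" "\<not> prime_of y dvd R"
    using prime_power_factor[OF degree_prime_of PQ(1)] by blast
  have "prime_of y ^ n dvd P"
  proof (cases "P = 0")
    case False
    obtain m A where A: "P = prime_of y ^ m * A" "\<not> prime_of y dvd A"
      using prime_power_factor[OF degree_prime_of False] by blast
    have "val y f = int m - int n"
      using PQ False R A by (simp add: val_divide val_ev_prime_of_power)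
    moreover have "f \<noteq> 0" using PQ False by simp
    ultimately have "n \<le> m" using assms by (simp add: val_ge_iff)
    then show ?thesis using A by (simp add: le_imp_power_dvd)
  qed simp
  then obtain B where "P = prime_of y ^ n * B" by (rule dvdE)
  then have "f = ev s B / ev s R" using PQ R prime_of_props(1) by (simp add: ev_mult ev_power)
  then show ?thesis using that R by blast
qed

text \<open>
  An element of minimal degree in the ideal generated by \<open>Q\<close> and \<open>prime_of y\<close> divides both.  Since
  \<open>prime_of y\<close> does not divide it, comparing degrees shows that it is constant.
\<close>

lemma inverse_mod_prime_of:
  assumes "\<not> prime_of y dvd Q"
  obtains u where "prime_of y dvd 1 - u * Q"
proof -
  let ?I = "\<lambda>a. a \<noteq> 0 \<and> (\<exists>u w. a = u * Q + w * prime_of y)"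
  have "?I (prime_of y)" using prime_of_props(1) by (intro conjI exI[of _ 0] exI[of _ 1]) auto
  then obtain a where a: "?I a" "\<And>b. ?I b \<Longrightarrow> degree a \<le> degree b"
    using ex_has_least_nat[of ?I "prime_of y" degree] by blast
  then obtain u w where uw: "a = u * Q + w * prime_of y" by blast
  have dvd: "a dvd c" if "c = u' * Q + w' * prime_of y" for c u' w'
  proof -
    have "c mod a = c - a * (c div a)" by (simp add: minus_mult_div_eq_mod)
    also have "\<dots> = (u' - u * (c div a)) * Q + (w' - w * (c div a)) * prime_of y"
      unfolding that uw by (simp add: algebra_simps)
    finally have "c mod a = 0 \<or> ?I (c mod a)" by blast
    then show ?thesis
      using a degree_mod_less[of a c] by (force simp: dvd_eq_mod_eq_0)
  qed
  have "a dvd Q" by (rule dvd[of _ 1 0]) simp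
  have "a dvd prime_of y" by (rule dvd[of _ 0 1]) simp
  then obtain b where b: "prime_of y = a * b" by (rule dvdE)
  have "\<not> prime_of y dvd a" using \<open>a dvd Q\<close> assms dvd_trans by blast
  then have "prime_of y dvd b" using prime_of_prime[of a b] b by auto
  then have "degree (prime_of y) \<le> degree b" using b prime_of_props(1) by (intro dvd_imp_degree_le) auto
  then have "degree a = 0" using b a prime_of_props(1) by (auto simp: degree_mult_eq)
  then obtain c where c: "a = [:c:]" "c \<noteq> 0" using a by (metis degree_eq_zeroE pCons_0_0)
  have "1 = smult (inverse c) a" using c by (simp add: one_pCons)
  then have "1 = smult (inverse c) u * Q + smult (inverse c) w * prime_of y"
    unfolding uw by (simp add: smult_add_right)
  then have "1 - smult (inverse c) u * Q = smult (inverse c) w * prime_of y"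
    by (metis add_diff_cancel_left')
  then show ?thesis using that by (metis dvd_triv_right)
qed

text \<open>
  Every residue class at \<open>y\<close> is represented by a polynomial: invert the denominator modulo
  \<open>prime_of y\<close> and reduce.
\<close>

lemma residue_polynomial:
  assumes "val_ge y 0 f"
  obtains R where "R = 0 \<or> degree R < degree (prime_of y)" "val_ge y 1 (f - ev s R)"
proof -
  obtain P Q where PQ: "\<not> prime_of y dvd Q" "f = ev s P / ev s Q" using fraction_coprime[OF assms] by blast
  obtain u where u: "prime_of y dvd 1 - u * Q" using inverse_mod_prime_of[OF PQ(1)] by blast
  define R where "R = (P * u) mod prime_of y"
  have "P - Q * R = P * (1 - u * Q) + Q * (P * u - R)" by (simp add: algebra_simps)
  moreover have "prime_of y dvd P * u - R" by (simp add: R_def dvd_minus_mod)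
  ultimately have "prime_of y dvd P - Q * R" using u by simp
  then have v: "val_ge y 1 (ev s (P - Q * R))" by (simp add: prime_of_dvd_iff)
  have Q0: "Q \<noteq> 0" using PQ(1) by auto
  then have "f - ev s R = ev s (P - Q * R) * inverse (ev s Q)"
    using PQ(2) by (simp add: ev_diff ev_mult field_simps)
  moreover have "val_ge y 0 (inverse (ev s Q))"
    using val_ev_not_dvd[OF PQ(1)] Q0 by (simp add: val_ge_iff val_inverse)
  ultimately have "val_ge y 1 (f - ev s R)" using v by (simp add: val_ge_mult_right)
  moreover have "R = 0 \<or> degree R < degree (prime_of y)"
    unfolding R_def by (rule degree_mod_less[OF prime_of_props(1)])
  ultimately show ?thesis using that by blast
qed

lemma approximate_integral:
  assumes "val_ge y 0 f"
  shows "\<exists>R. val_ge y (int n) (f - ev s R)"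
  using assms
proof (induction n arbitrary: f)
  case 0
  then show ?case by (intro exI[of _ 0]) simp
next
  case (Suc n)
  obtain R where R: "val_ge y 1 (f - ev s R)" using residue_polynomial[OF Suc.prems] by blast
  define g where "g = (f - ev s R) / ev s (prime_of y)"
  have pn: "ev s (prime_of y) \<noteq> 0" using prime_of_props(1) by simp
  have "val_ge y 0 g"
  proof (cases "g = 0")
    case False
    then have "f - ev s R \<noteq> 0" by (auto simp: g_def)
    then show ?thesis using R pn False by (simp add: g_def val_ge_iff val_divide)
  qed simp
  then obtain R' where R': "val_ge y (int n) (g - ev s R')" using Suc.IH by blast
  have "f - ev s (R + prime_of y * R') = ev s (prime_of y) * (g - ev s R')"
    using pn by (simp add: g_def ev_add ev_mult field_simps)
  moreover have "val_ge y (1 + int n) (ev s (prime_of y) * (g - ev s R'))"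
    by (rule val_ge_mult[OF _ R']) (simp add: val_ge_def)
  ultimately show ?case by (metis of_nat_Suc)
qed

end

text \<open>
  If \<open>prime_of y\<close> vanished at \<open>z\<close>, the two prime polynomials would be associated and hence define
  the same valuation.
\<close>

lemma val_prime_of_other:
  assumes "y \<noteq> x" "z \<noteq> x" "y \<noteq> z"
  shows "val z (ev s (prime_of y)) = 0"
proof (rule ccontr)
  assume "val z (ev s (prime_of y)) \<noteq> 0"
  then have d: "prime_of z dvd prime_of y" using val_ev_not_dvd assms by blast
  then obtain Q where Q: "prime_of y = prime_of z * Q" by (rule dvdE)
  have nz: "prime_of y \<noteq> 0" "prime_of z \<noteq> 0" "Q \<noteq> 0" using Q prime_of_props(1)[OF assms(1)] by auto
  have "\<not> prime_of y dvd Q"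
  proof
    assume "prime_of y dvd Q"
    then have "degree (prime_of y) \<le> degree Q" using nz by (intro dvd_imp_degree_le)
    then show False using Q nz degree_prime_of[OF assms(2)] by (simp add: degree_mult_eq)
  qed
  then have d': "prime_of y dvd prime_of z" using prime_of_prime[OF assms(1), of "prime_of z" Q] Q by auto
  have "y = z"
  proof (rule place_eqI)
    fix P :: "'k poly" assume "P \<noteq> 0"
    then obtain n R where R: "P = prime_of y ^ n * R" "\<not> prime_of y dvd R"
      using prime_power_factor[OF degree_prime_of[OF assms(1)]] by blast
    then have "\<not> prime_of z dvd R" using d' dvd_trans by blast
    have "val z (ev s (prime_of y)) = 1"
    proof -
      have "\<not> prime_of z dvd Q" using \<open>\<not> prime_of y dvd Q\<close> d' dvd_trans by blast
      then have "val z (ev s (prime_of z ^ 1 * Q)) = int 1" by (rule val_ev_prime_of_power[OF assms(2)])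
      then show ?thesis by (simp add: Q)
    qed
    moreover have "R \<noteq> 0" using R by auto
    ultimately have "val z (ev s P) = int n"
      using nz val_ev_not_dvd[OF assms(2) \<open>\<not> prime_of z dvd R\<close>] R(1)
      by (simp add: ev_mult ev_power val_mult val_power)
    then show "val y (ev s P) = val z (ev s P)"
      using val_ev_prime_of_power[OF assms(1) R(2), of n] R(1) by simp
  qed
  then show False using assms by simp
qed

text \<open>
  Multiplying by a power of \<open>prime_of y\<close> makes \<open>f\<close> integral at \<open>y\<close>, where polynomials are dense;
  dividing the approximating polynomial by that power creates poles at \<open>x\<close> and \<open>y\<close> only.
\<close>

lemma strong_approximation:
  assumes "y \<noteq> x"
  obtains g where "\<And>z. z \<noteq> x \<Longrightarrow> z \<noteq> y \<Longrightarrow> val_ge z 0 g" "val_ge y N (f - g)"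
proof -
  let ?p = "ev s (prime_of y)"
  have pn: "?p \<noteq> 0" using prime_of_props(1)[OF assms] by simp
  define k where "k = nat (- val y f)"
  have "val_ge y 0 (?p ^ k * f)"
  proof (cases "f = 0")
    case False
    then show ?thesis using pn assms
      by (simp add: val_ge_iff val_mult val_power k_def)
  qed simp
  then obtain R where R: "val_ge y (int (nat (N + int k))) (?p ^ k * f - ev s R)"
    using approximate_integral[OF assms] by blast
  define g where "g = ev s R / ?p ^ k"
  have "val_ge z 0 g" if "z \<noteq> x" "z \<noteq> y" for z
    unfolding g_def divide_inverse
    using pn val_prime_of_other[OF assms that(1)] that
    by (intro val_ge_mult_left val_ge_ev') (auto simp: val_ge_iff val_inverse val_power)
  moreover have "val_ge y N (f - g)"
  proof -
    have "f - g = (?p ^ k * f - ev s R) * inverse (?p ^ k)" using pn by (simp add: g_def field_simps)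
    moreover have "val_ge y (int (nat (N + int k)) + - int k) ((?p ^ k * f - ev s R) * inverse (?p ^ k))"
      by (rule val_ge_mult[OF R]) (use pn assms in \<open>simp add: val_ge_iff val_inverse val_power\<close>)
    moreover have "N \<le> int (nat (N + int k)) + - int k" by linarith
    ultimately show ?thesis by (metis val_ge_mono)
  qed
  ultimately show ?thesis using that by blast
qed

end

subsection \<open>Every prime polynomial has a place\<close>

context coordinate
begin

text \<open>
  The valuation counts the factors \<open>p\<close>.  It is the number \<open>n\<close> in a representation of \<open>f\<close> as \<open>p\<^sup>n\<close> times
  a quotient of polynomials that are prime to \<open>p\<close>.
\<close>

lemma place_of_prime:
  assumes p: "prime_elem p" "degree p \<ge> 1"
  obtains y where "y \<noteq> x" "val y (ev s p) > 0"
proof -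
  let ?p = "ev s p"
  have p0: "p \<noteq> 0" using p by auto
  have prime: "p dvd a * b \<Longrightarrow> p dvd a \<or> p dvd b" for a b
    using p(1) by (rule prime_elem_dvd_multD)
  \<comment> \<open>\<open>rel f n\<close> is the graph of the valuation to be constructed.\<close>
  define rel where "rel f n \<longleftrightarrow> (\<exists>P Q. \<not> p dvd P \<and> \<not> p dvd Q \<and> f = ?p powi n * (ev s P / ev s Q))" for f n
  have relI: "rel (?p powi n * (ev s P / ev s Q)) n" if "\<not> p dvd P" "\<not> p dvd Q" for P Q n
    using that unfolding rel_def by blast
  have le: "n \<le> m" if "rel f n" "rel f m" for f n m
  proof (rule ccontr)
    assume "\<not> n \<le> m"
    define k where "k = nat (n - m)"
    have k: "n = m + int k" "k > 0" using \<open>\<not> n \<le> m\<close> by (auto simp: k_def)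
    obtain P Q A B where h: "\<not> p dvd P" "\<not> p dvd Q" "f = ?p powi n * (ev s P / ev s Q)"
      "\<not> p dvd A" "\<not> p dvd B" "f = ?p powi m * (ev s A / ev s B)"
      using \<open>rel f n\<close> \<open>rel f m\<close> unfolding rel_def by blast
    have nz: "Q \<noteq> 0" "B \<noteq> 0" using h by auto
    have "?p powi n = ?p powi m * ?p ^ k"
      using k p0 by (simp add: power_int_add)
    then have "?p powi m * (?p ^ k * (ev s P / ev s Q)) = ?p powi m * (ev s A / ev s B)"
      using h(3,6) by (simp only: mult.assoc)
    then have "?p ^ k * (ev s P / ev s Q) = ev s A / ev s B"
      using p0 by (subst (asm) mult_left_cancel) auto
    then have "ev s (p ^ k * P * B) = ev s (A * Q)"
      using nz by (simp add: ev_mult ev_power field_simps)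
    then have "p ^ k * P * B = A * Q" by (simp add: ev_inj)
    moreover have "p dvd p ^ k * P * B" using k by (simp add: dvd_power dvd_mult2)
    ultimately show False using prime h by metis
  qed
  have uniq: "n = m" if "rel f n" "rel f m" for f n m
    using le[OF that] le[OF that(2,1)] by simp
  have poly_rel: "\<exists>n. rel (ev s P) (int n)" if nz: "P \<noteq> 0" for P
  proof -
    obtain n R where "P = p ^ n * R" "\<not> p dvd R" using prime_power_factor[OF p(2) nz] by blast
    moreover have "\<not> p dvd 1" using p(1) by auto
    ultimately have "rel (?p powi int n * (ev s R / ev s 1)) (int n)" by (intro relI)
    then show ?thesis using \<open>P = _\<close> by (auto simp: ev_mult ev_power)
  qed
  have mult: "rel (f * g) (n + m)" if fg: "rel f n" "rel g m" for f g n m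
  proof -
    obtain P Q A B where h: "\<not> p dvd P" "\<not> p dvd Q" "f = ?p powi n * (ev s P / ev s Q)"
      "\<not> p dvd A" "\<not> p dvd B" "g = ?p powi m * (ev s A / ev s B)"
      using fg unfolding rel_def by blast
    have "rel (?p powi (n + m) * (ev s (P * A) / ev s (Q * B))) (n + m)"
      using h prime by (intro relI) blast+
    moreover have "?p powi (n + m) * (ev s (P * A) / ev s (Q * B)) = f * g"
      using h p0 by (simp add: ev_mult power_int_add)
    ultimately show ?thesis by simp
  qed
  have inv: "rel (inverse f) (- n)" if f: "rel f n" for f n
  proof -
    obtain P Q where h: "\<not> p dvd P" "\<not> p dvd Q" "f = ?p powi n * (ev s P / ev s Q)"
      using f unfolding rel_def by blast
    have "inverse f = ?p powi (- n) * (ev s Q / ev s P)"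
      unfolding h(3) inverse_mult_distrib power_int_minus inverse_divide ..
    then show ?thesis using relI[OF h(2,1)] by metis
  qed
  have ex: "\<exists>n. rel f n" if f: "f \<noteq> 0" for f
  proof -
    obtain P Q where "Q \<noteq> 0" "f = ev s P / ev s Q" "P \<noteq> 0" using f by (metis fraction_cases)
    then show ?thesis using poly_rel[of P] poly_rel[of Q] mult inv by (metis divide_inverse)
  qed
  define w where "w f = (if f = 0 then 0 else THE n. rel f n)" for f
  have nz: "f \<noteq> 0" if "rel f n" for f n
    using that p0 unfolding rel_def by auto
  have w: "w f = n" if "rel f n" for f n
    using that uniq nz[OF that] by (auto simp: w_def)
  have nonneg: "0 \<le> w (ev s P)" for P
    using poly_rel[of P] w by (cases "P = 0") (auto simp: w_def[of 0])
  have w_mult: "w (f * g) = w f + w g" if fg: "f \<noteq> 0" "g \<noteq> 0" for f g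
    using ex[OF fg(1)] ex[OF fg(2)] mult w by metis
  have w_add': "w f \<le> w (f + g)" if fg: "f \<noteq> 0" "g \<noteq> 0" "f + g \<noteq> 0" "w f \<le> w g" for f g
  proof -
    obtain n m where nm: "rel f n" "rel g m" using ex fg by metis
    then have "n \<le> m" using w fg by metis
    define k where "k = nat (m - n)"
    have k: "m = n + int k" using \<open>n \<le> m\<close> by (auto simp: k_def)
    obtain P Q A B where h: "\<not> p dvd P" "\<not> p dvd Q" "f = ?p powi n * (ev s P / ev s Q)"
      "\<not> p dvd A" "\<not> p dvd B" "g = ?p powi m * (ev s A / ev s B)"
      using nm unfolding rel_def by blast
    have QB: "Q \<noteq> 0" "B \<noteq> 0" using h by auto
    have frac: "a * (u / v) + a * K * (c / d) = a / (v * d) * (u * d + K * c * v)"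
      if "v \<noteq> 0" "d \<noteq> 0" for a u v c d K :: "'k ratfun"
      using that by (simp add: field_simps)
    have "?p powi m = ?p powi n * ?p ^ k" using k p0 by (simp add: power_int_add)
    then have sum: "f + g = ?p powi n / ev s (Q * B) * ev s (P * B + p ^ k * A * Q)"
      unfolding h(3,6) ev_mult ev_add ev_power using QB by (simp only: frac ev_nz not_False_eq_True)
    have "w (f + g) = w (?p powi n / ev s (Q * B)) + w (ev s (P * B + p ^ k * A * Q))"
      unfolding sum by (rule w_mult) (use fg(3) sum in auto)
    moreover have "w (?p powi n / ev s (Q * B)) = n"
    proof (rule w)
      have "\<not> p dvd 1" "\<not> p dvd Q * B" using p(1) h prime by auto
      then have "rel (?p powi n * (ev s 1 / ev s (Q * B))) n" by (rule relI)
      then show "rel (?p powi n / ev s (Q * B)) n" by simp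
    qed
    ultimately show ?thesis using nonneg[of "P * B + p ^ k * A * Q"] w[OF nm(1)] by simp
  qed
  have "is_normalized_valuation w"
    unfolding is_normalized_valuation_def
  proof (intro conjI allI impI)
    show "w 0 = 0" by (simp add: w_def)
    show "w (f * g) = w f + w g" if "f \<noteq> 0" "g \<noteq> 0" for f g using w_mult that .
    show "min (w f) (w g) \<le> w (f + g)" if "f \<noteq> 0" "g \<noteq> 0" "f + g \<noteq> 0" for f g
      using w_add'[of f g] w_add'[of g f] that by (auto simp: add.commute min_def)
    show "w (const_rat c) = 0" if "c \<noteq> 0" for c
    proof (rule w)
      have "\<not> p dvd [:c:]"
        using p(2) that p0 dvd_imp_degree_le[of p "[:c:]"] by auto
      moreover have "\<not> p dvd 1" using p(1) by auto
      ultimately have "rel (?p powi 0 * (ev s [:c:] / ev s 1)) 0" by (rule relI)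
      then show "rel (const_rat c) 0" by simp
    qed
    have "\<not> p dvd 1" using p(1) by auto
    then have "rel (?p powi 1 * (ev s 1 / ev s 1)) 1" by (intro relI)
    then have "w ?p = 1" using w by simp
    then show "\<exists>f. f \<noteq> 0 \<and> w f = 1" using p0 by (intro exI[of _ ?p]) simp
  qed
  then have v: "val (Abs_place w) = w" by (simp add: Abs_place_inverse)
  have "\<not> p dvd 1" using p(1) by auto
  then have "rel (?p powi 1 * (ev s 1 / ev s 1)) 1" by (intro relI)
  then have "w ?p = 1" using w by simp
  moreover have "Abs_place w \<noteq> x"
    using nonneg[of p] \<open>w ?p = 1\<close> val_x_ev[OF p0] v by force
  ultimately show ?thesis using that v by simp
qed

lemma zero_of_polynomial:
  assumes "degree P \<ge> 1"
  obtains y where "y \<noteq> x" "prime_of y dvd P"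
proof -
  obtain p where p: "p dvd P" "degree p \<ge> 1" "prime_elem p" using exists_prime_factor[OF assms] by blast
  then obtain y where y: "y \<noteq> x" "val y (ev s p) > 0" using place_of_prime by blast
  then have "prime_of y dvd p" by (simp add: prime_of_dvd_iff val_ge_def)
  then show ?thesis using that p y dvd_trans by blast
qed

text \<open>
  In a representation with denominator of minimal degree the denominator is constant: otherwise
  it would vanish at some place, where regularity forces the numerator to vanish as well.
\<close>

lemma regular_is_polynomial:
  assumes "\<And>y. y \<noteq> x \<Longrightarrow> val_ge y 0 f"
  obtains P where "f = ev s P"
proof -
  let ?ok = "\<lambda>Q. Q \<noteq> 0 \<and> (\<exists>P. f = ev s P / ev s Q)"
  obtain Q0 where "?ok Q0" using generator by blast
  then obtain Q where Q: "?ok Q" "\<And>R. ?ok R \<Longrightarrow> degree Q \<le> degree R"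
    using ex_has_least_nat[of ?ok Q0 degree] by blast
  then obtain P where P: "f = ev s P / ev s Q" by blast
  have "degree Q = 0"
  proof (rule ccontr)
    assume "degree Q \<noteq> 0"
    then obtain y where y: "y \<noteq> x" "prime_of y dvd Q" using zero_of_polynomial[of Q] by (metis less_one not_le)
    have "ev s P = f * ev s Q" using P Q by simp
    then have "val_ge y 1 (ev s P)"
      using assms[OF y(1)] y by (simp add: val_ge_mult_left prime_of_dvd_iff)
    then have "prime_of y dvd P" by (simp add: prime_of_dvd_iff y)
    then obtain A B where AB: "P = prime_of y * A" "Q = prime_of y * B" using y by (metis dvdE)
    then have "f = ev s A / ev s B" using P prime_of_props(1)[OF y(1)] by (simp add: ev_mult)
    then have "?ok B" using Q AB by auto
    then have "degree Q \<le> degree B" by (rule Q)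
    moreover have "degree Q = degree (prime_of y) + degree B"
      using AB Q(1) by (metis degree_mult_eq mult_eq_0_iff)
    ultimately show False using degree_prime_of[OF y(1)] by simp
  qed
  then obtain c where c: "Q = [:c:]" "c \<noteq> 0" using Q by (metis degree_eq_zeroE pCons_0_0)
  have "f = ev s (smult (inverse c) P)"
    using c P by (simp add: ev_smult const_rat_inverse divide_inverse mult.commute)
  then show ?thesis using that by blast
qed

lemma regular_at_pole:
  "val_ge x 0 (ev s P) \<Longrightarrow> \<exists>c. P = [:c:]"
  by (cases "P = 0") (auto simp: val_ge_iff val_x_ev intro: degree_eq_zeroE)

lemma vanishing_at_pole: "val_ge x 1 (ev s P) \<Longrightarrow> P = 0"
  by (cases "P = 0") (auto simp: val_ge_iff val_x_ev)

lemma polynomial_part: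
  obtains P where "val_ge x 1 (f - ev s P)"
proof -
  obtain A B where AB: "B \<noteq> 0" "f = ev s A / ev s B" by (metis fraction_cases)
  have "f - ev s (A div B) = ev s (A mod B) / ev s B"
    using AB by (simp add: ev_diff ev_mult minus_mult_div_eq_mod[symmetric] field_simps)
  moreover have "val_ge x 1 (ev s (A mod B) / ev s B)"
  proof (cases "A mod B = 0")
    case False
    then have "degree (A mod B) < degree B" using degree_mod_less[OF AB(1), of A] by simp
    then show ?thesis using False AB by (simp add: val_ge_iff val_divide val_x_ev)
  qed simp
  ultimately show ?thesis using that by metis
qed

lemma residue_at_pole:
  assumes "val_ge x 0 f"
  obtains c where "val_ge x 1 (f - const_rat c)"
proof -
  obtain P where P: "val_ge x 1 (f - ev s P)" using polynomial_part by blast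
  have "val_ge x 0 (f - (f - ev s P))" by (rule val_ge_diff[OF assms val_ge_mono[OF P]]) simp
  then obtain c where "P = [:c:]" using regular_at_pole[of P] by auto
  then show ?thesis using P that by auto
qed

subsection \<open>The product formula\<close>

definition pdeg :: "'k place \<Rightarrow> nat"
  where "pdeg y = (if y = x then 1 else degree (prime_of y))"

definition balanced :: "'k ratfun \<Rightarrow> bool"
  where "balanced f \<longleftrightarrow> (\<exists>T. finite T \<and> (\<forall>y. y \<notin> T \<longrightarrow> val y f = 0) \<and>
    (\<Sum>y\<in>T. int (pdeg y) * val y f) = 0)"

lemma balancedD:
  assumes "balanced f" "finite T" "\<And>y. y \<notin> T \<Longrightarrow> val y f = 0"
  shows "(\<Sum>y\<in>T. int (pdeg y) * val y f) = 0"
proof -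
  obtain S where S: "finite S" "\<And>y. y \<notin> S \<Longrightarrow> val y f = 0" "(\<Sum>y\<in>S. int (pdeg y) * val y f) = 0"
    using assms(1) unfolding balanced_def by blast
  have "(\<Sum>y\<in>T. int (pdeg y) * val y f) = (\<Sum>y\<in>S \<union> T. int (pdeg y) * val y f)"
    using assms S by (intro sum.mono_neutral_left) auto
  also have "\<dots> = (\<Sum>y\<in>S. int (pdeg y) * val y f)"
    using assms S by (intro sum.mono_neutral_right) auto
  finally show ?thesis using S by simp
qed

lemma balanced_mult:
  assumes "balanced f" "balanced g" "f \<noteq> 0" "g \<noteq> 0"
  shows "balanced (f * g)"
proof -
  obtain S where S: "finite S" "\<And>y. y \<notin> S \<Longrightarrow> val y f = 0" using assms(1) unfolding balanced_def by blast
  obtain T where T: "finite T" "\<And>y. y \<notin> T \<Longrightarrow> val y g = 0" using assms(2) unfolding balanced_def by blast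
  have "(\<Sum>y\<in>S \<union> T. int (pdeg y) * val y (f * g)) =
    (\<Sum>y\<in>S \<union> T. int (pdeg y) * val y f) + (\<Sum>y\<in>S \<union> T. int (pdeg y) * val y g)"
    using assms by (simp add: val_mult algebra_simps sum.distrib)
  also have "\<dots> = 0"
    using balancedD[OF assms(1), of "S \<union> T"] balancedD[OF assms(2), of "S \<union> T"] S T by auto
  finally show ?thesis using S T assms unfolding balanced_def
    by (intro exI[of _ "S \<union> T"]) (auto simp: val_mult)
qed

lemma balanced_inverse: "balanced f \<Longrightarrow> balanced (inverse f)"
  unfolding balanced_def by (simp add: val_inverse sum_negf)

text \<open>
  The zero of \<open>prime_of y\<close> at \<open>y\<close>, counted with its degree, cancels against the pole at \<open>x\<close>.
\<close>

lemma balanced_prime_of: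
  assumes "y \<noteq> x"
  shows "balanced (ev s (prime_of y))"
  unfolding balanced_def
  using assms val_prime_of_other[OF assms] prime_of_props(1)[OF assms]
  by (intro exI[of _ "{x, y}"]) (auto simp: pdeg_def val_x_ev)

lemma balanced_ev: "P \<noteq> 0 \<Longrightarrow> balanced (ev s P)"
proof (induction "degree P" arbitrary: P rule: less_induct)
  case less
  show ?case
  proof (cases "degree P = 0")
    case True
    then obtain c where "P = [:c:]" "c \<noteq> 0" using less by (metis degree_eq_zeroE pCons_0_0)
    then show ?thesis unfolding balanced_def by (intro exI[of _ "{}"]) (simp add: val_const)
  next
    case False
    then obtain y where y: "y \<noteq> x" "prime_of y dvd P" using zero_of_polynomial[of P] by (metis less_one not_le)
    then obtain Q where Q: "P = prime_of y * Q" by (metis dvdE)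
    then have nz: "Q \<noteq> 0" "prime_of y \<noteq> 0" using less by auto
    then have "degree Q < degree P" using Q degree_prime_of[OF y(1)] by (simp add: degree_mult_eq)
    then have "balanced (ev s Q)" using less nz by blast
    then show ?thesis using balanced_prime_of[OF y(1)] nz Q by (simp add: ev_mult balanced_mult)
  qed
qed

text \<open>
  Every rational function is a product of the polynomials \<open>prime_of y\<close>, their inverses, and a constant.
\<close>

lemma product_formula: "f \<noteq> 0 \<Longrightarrow> balanced f"
proof -
  assume "f \<noteq> 0"
  then obtain P Q where "Q \<noteq> 0" "f = ev s P / ev s Q" "P \<noteq> 0" by (metis fraction_cases)
  then show ?thesis
    by (simp add: divide_inverse balanced_mult balanced_inverse balanced_ev)
qed

lemma finite_support: "finite {y :: 'k place. val y f \<noteq> 0}"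
proof (cases "f = 0")
  case False
  from product_formula[OF this] obtain T where T: "finite T" "\<forall>y. y \<notin> T \<longrightarrow> val y f = 0"
    unfolding balanced_def by blast
  then show ?thesis by (intro finite_subset[OF _ T(1)]) blast
qed simp

end

subsection \<open>Coordinates for the places of degree one\<close>

lemma ev_affine: "ev (Fract [:0, 1:] 1) P = Fract P 1"
proof (induction P)
  case (pCons a P)
  then show ?case by (simp add: ev_pCons const_rat_def)
qed (simp add: Zero_fract_def)

text \<open>The degree valuation is the place at infinity of the standard coordinate.\<close>

lemma coordinate_degree_valuation:
  "coordinate (Abs_place degree_valuation) (Fract [:0, 1:] (1 :: 'k::{field,finite} poly))"
proof
  have "val (Abs_place degree_valuation) = (degree_valuation :: 'k ratfun \<Rightarrow> int)"
    using is_normalized_valuation_degree_valuation by (intro Abs_place_inverse) simp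
  then show "val (Abs_place degree_valuation) (Fract [:0, 1:] (1 :: 'k poly)) = -1"
    by (simp add: degree_valuation_Fract)
  fix f :: "'k ratfun"
  obtain P Q where "f = Fract P Q" "Q \<noteq> 0" by (cases f) blast
  then show "\<exists>P Q. Q \<noteq> 0 \<and> f = ev (Fract [:0, 1:] 1) P / ev (Fract [:0, 1:] 1) Q"
    by (intro exI[of _ P] exI[of _ Q]) (simp add: ev_affine)
qed

text \<open>Inverting a linear polynomial moves the pole of the coordinate to the zero of that polynomial.\<close>

lemma (in coordinate) coordinate_linear:
  assumes "y \<noteq> x" "degree (prime_of y) = 1"
  shows "coordinate y (inverse (ev s (prime_of y)))"
proof
  let ?t = "inverse (ev s (prime_of y))"
  show v: "val y ?t = -1" using assms by (simp add: val_inverse)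
  obtain a b where ab: "prime_of y = [:a, b:]" "b \<noteq> 0"
    using assms(2) by (metis degree_eq_zeroE degree_pCons_eq_if One_nat_def pCons_cases nat.inject pCons_eq_0_iff zero_neq_one)
  have st: "s * ?t = ev ?t [:inverse (b :: 'k), - a / b:]"
  proof -
    define u A B where "u = ev s (prime_of y)" and "A = const_rat a" and "B = const_rat b"
    have nz: "u \<noteq> 0" "B \<noteq> 0" using ab prime_of_props(1)[OF assms(1)] by (auto simp: u_def B_def)
    have sB: "s * B = u - A" using ab by (simp add: ev_pCons u_def A_def B_def)
    have "s * inverse u = (s * B) * (inverse u * inverse B)" using nz by simp
    also have "\<dots> = (u - A) * (inverse u * inverse B)" by (simp only: sB)
    also have "(u - A) * (inverse u * inverse B) = inverse B + inverse u * (- A * inverse B)"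
      using nz by (simp add: left_diff_distrib)
    also have "\<dots> = ev (inverse u) [:inverse b, - a / b:]"
      using ab by (simp add: ev_pCons divide_inverse const_rat_mult const_rat_minus const_rat_inverse A_def B_def)
    finally show ?thesis by (simp add: u_def)
  qed
  have t0: "?t \<noteq> 0" using prime_of_props(1)[OF assms(1)] by simp
  have T: "ev ?t [:0, 1:] = ?t" by (simp add: ev_pCons)
  have poly: "\<exists>n A. ev s P * ?t ^ n = ev ?t A" for P
  proof (induction P)
    case 0
    then show ?case by (intro exI[of _ 0]) simp
  next
    case (pCons c P)
    then obtain n A where A: "ev s P * ?t ^ n = ev ?t A" by blast
    have "ev s (pCons c P) * ?t ^ Suc n = const_rat c * ?t ^ Suc n + (s * ?t) * (ev s P * ?t ^ n)"
      by (simp add: ev_pCons algebra_simps)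
    also have "\<dots> = ev ?t (smult c ([:0, 1:] ^ Suc n) + [:inverse b, - a / b:] * A)"
      unfolding st A by (simp only: ev_add ev_mult ev_smult ev_power T)
    finally show ?case by blast
  qed
  fix f
  obtain P Q where PQ: "Q \<noteq> 0" "f = ev s P / ev s Q" by (metis fraction_cases)
  obtain n A where A: "ev s P * ?t ^ n = ev ?t A" using poly by blast
  obtain m B where B: "ev s Q * ?t ^ m = ev ?t B" using poly by blast
  have B0: "B \<noteq> 0" using B PQ t0 by auto
  have "f = (ev s P * ?t ^ n) * ?t ^ m / ((ev s Q * ?t ^ m) * ?t ^ n)"
    using PQ t0 by (simp add: field_simps)
  also have "\<dots> = ev ?t (A * [:0, 1:] ^ m) / ev ?t (B * [:0, 1:] ^ n)"
    unfolding A B by (simp only: ev_mult ev_power T)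
  finally show "\<exists>P Q. Q \<noteq> 0 \<and> f = ev ?t P / ev ?t Q"
    using B0 by (intro exI[of _ "A * [:0, 1:] ^ m"] exI[of _ "B * [:0, 1:] ^ n"]) simp
qed

section \<open>Completions\<close>

text \<open>
  The function \<open>cval\<close> carries no information at \<open>0\<close>, whose valuation should be infinite; this
  predicate is therefore the form in which valuations of elements of the completion are used.
\<close>

definition cval_ge :: "'k::{field,finite} place \<Rightarrow> int \<Rightarrow> 'k celem \<Rightarrow> bool"
  where "cval_ge y N c \<longleftrightarrow> c \<in> carrier (local_field y) \<and> (c = \<zero>\<^bsub>local_field y\<^esub> \<or> N \<le> cval y c)"

lemma cval_ge_cls:
  assumes "cauchy_at y s"
  shows "cval_ge y N (cls y s) \<longleftrightarrow> (\<exists>M. \<forall>n\<ge>M. val_ge y N (s n))"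
proof (cases "null_at y s")
  case True
  then have "cls y s = \<zero>\<^bsub>local_field y\<^esub>" using assms by (simp add: cls_zero cls_eq_iff)
  moreover have "\<exists>M. \<forall>n\<ge>M. val_ge y N (s n)" using True by (simp add: null_at_def)
  ultimately show ?thesis using assms by (auto simp: cval_ge_def carrier_local_field)
next
  case False
  then obtain M where M: "\<And>n. n \<ge> M \<Longrightarrow> s n \<noteq> 0 \<and> val y (s n) = cval y (cls y s)"
    using cval_cls[OF assms] by blast
  have nz: "cls y s \<noteq> \<zero>\<^bsub>local_field y\<^esub>" using assms False by (simp add: cls_zero cls_eq_iff)
  have "(\<exists>L. \<forall>n\<ge>L. val_ge y N (s n)) \<longleftrightarrow> N \<le> cval y (cls y s)"
  proof
    assume "\<exists>L. \<forall>n\<ge>L. val_ge y N (s n)"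
    then obtain L where "\<And>n. n \<ge> L \<Longrightarrow> val_ge y N (s n)" by blast
    then have "val_ge y N (s (max L M))" by simp
    then show "N \<le> cval y (cls y s)" using M[of "max L M"] by (simp add: val_ge_def)
  next
    assume "N \<le> cval y (cls y s)"
    then have "\<forall>n\<ge>M. val_ge y N (s n)" using M by (auto simp: val_ge_def)
    then show "\<exists>L. \<forall>n\<ge>L. val_ge y N (s n)" by blast
  qed
  then show ?thesis using nz assms by (auto simp: cval_ge_def carrier_local_field)
qed

lemma cval_ge_carrier: "cval_ge y N c \<Longrightarrow> c \<in> carrier (local_field y)"
  by (simp add: cval_ge_def)

lemma local_field_cases:
  assumes "c \<in> carrier (local_field y)"
  obtains s where "cauchy_at y s" "c = cls y s"
  using assms by (auto simp: carrier_local_field)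

lemma cval_ge_cases:
  assumes "cval_ge y N c"
  obtains s M where "cauchy_at y s" "c = cls y s" "\<And>n. n \<ge> M \<Longrightarrow> val_ge y N (s n)"
  using assms cval_ge_cls by (metis cval_ge_carrier local_field_cases)

lemma ring_of_integers_eq: "ring_of_integers y = {c. cval_ge y 0 c}"
  by (auto simp: ring_of_integers_def cval_ge_def)

lemma cval_ge_zero [simp]: "cval_ge y N \<zero>\<^bsub>local_field y\<^esub>"
  by (simp add: cval_ge_def cls_zero carrier_local_field)

lemma cval_ge_mono: "cval_ge y N c \<Longrightarrow> M \<le> N \<Longrightarrow> cval_ge y M c"
  by (auto simp: cval_ge_def)

lemma cval_ge_add:
  assumes "cval_ge y N a" "cval_ge y N b"
  shows "cval_ge y N (a \<oplus>\<^bsub>local_field y\<^esub> b)"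
proof -
  obtain s M where s: "cauchy_at y s" "a = cls y s" "\<And>n. n \<ge> M \<Longrightarrow> val_ge y N (s n)"
    using cval_ge_cases[OF assms(1)] by metis
  obtain t L where t: "cauchy_at y t" "b = cls y t" "\<And>n. n \<ge> L \<Longrightarrow> val_ge y N (t n)"
    using cval_ge_cases[OF assms(2)] by metis
  have "\<forall>n\<ge>max M L. val_ge y N (s n + t n)" using s t by (auto intro: val_ge_add)
  then have "\<exists>M. \<forall>n\<ge>M. val_ge y N (s n + t n)" by blast
  then show ?thesis using s t by (simp add: cls_add cval_ge_cls cauchy_at_add)
qed

lemma cval_ge_mult:
  assumes "cval_ge y N a" "cval_ge y K b"
  shows "cval_ge y (N + K) (a \<otimes>\<^bsub>local_field y\<^esub> b)"
proof -
  obtain s M where s: "cauchy_at y s" "a = cls y s" "\<And>n. n \<ge> M \<Longrightarrow> val_ge y N (s n)"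
    using cval_ge_cases[OF assms(1)] by metis
  obtain t L where t: "cauchy_at y t" "b = cls y t" "\<And>n. n \<ge> L \<Longrightarrow> val_ge y K (t n)"
    using cval_ge_cases[OF assms(2)] by metis
  have "\<forall>n\<ge>max M L. val_ge y (N + K) (s n * t n)" using s t by (auto intro: val_ge_mult)
  then have "\<exists>M. \<forall>n\<ge>M. val_ge y (N + K) (s n * t n)" by blast
  then show ?thesis using s t by (simp add: cls_mult cval_ge_cls cauchy_at_mult)
qed

lemma cval_ge_minus:
  assumes "cval_ge y N a"
  shows "cval_ge y N (\<ominus>\<^bsub>local_field y\<^esub> a)"
proof -
  obtain s M where s: "cauchy_at y s" "a = cls y s" "\<And>n. n \<ge> M \<Longrightarrow> val_ge y N (s n)"
    using cval_ge_cases[OF assms(1)] by metis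
  then show ?thesis by (auto simp: cls_minus cval_ge_cls cauchy_at_minus)
qed

lemma cval_ge_bounded:
  assumes "c \<in> carrier (local_field y)"
  obtains N where "cval_ge y N c"
  using assms by (cases "c = \<zero>\<^bsub>local_field y\<^esub>") (auto simp: cval_ge_def)

lemma emb_carrier [simp]: "emb y f \<in> carrier (local_field y)"
  by (simp add: emb_def carrier_local_field)

lemma emb_0: "emb y 0 = \<zero>\<^bsub>local_field y\<^esub>"
  by (simp add: emb_def cls_zero)

lemma emb_1: "emb y 1 = \<one>\<^bsub>local_field y\<^esub>"
  by (simp add: emb_def cls_one)

lemma emb_add: "emb y (f + g) = emb y f \<oplus>\<^bsub>local_field y\<^esub> emb y g"
  by (simp add: emb_def cls_add)

lemma emb_mult: "emb y (f * g) = emb y f \<otimes>\<^bsub>local_field y\<^esub> emb y g"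
  by (simp add: emb_def cls_mult)

lemma emb_minus: "emb y (- f) = \<ominus>\<^bsub>local_field y\<^esub> emb y f"
  by (simp add: emb_def cls_minus)

lemma emb_diff: "emb y (f - g) = emb y f \<ominus>\<^bsub>local_field y\<^esub> emb y g"
  using emb_add[of y f "- g"] by (simp add: a_minus_def emb_minus)

lemma cval_ge_emb [simp]: "cval_ge y N (emb y f) \<longleftrightarrow> val_ge y N f"
  by (auto simp: emb_def cval_ge_cls)

lemma emb_eq_0_iff [simp]: "emb y f = \<zero>\<^bsub>local_field y\<^esub> \<longleftrightarrow> f = 0"
  using val_ge_all_eq_0[of y f] cval_ge_emb[of y _ f] cval_ge_zero[of y] emb_0 by metis

lemma emb_inj [simp]: "emb y f = emb y g \<longleftrightarrow> f = g"
proof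
  interpret cring "local_field y" by (rule local_field_cring)
  assume "emb y f = emb y g"
  then have "emb y (f - g) = \<zero>\<^bsub>local_field y\<^esub>" by (simp add: emb_diff r_right_minus_eq)
  then show "f = g" by simp
qed simp

lemma emb_dense:
  assumes "c \<in> carrier (local_field y)"
  obtains f where "cval_ge y N (c \<ominus>\<^bsub>local_field y\<^esub> emb y f)"
proof -
  interpret cring "local_field y" by (rule local_field_cring)
  obtain s where s: "cauchy_at y s" "c = cls y s" using local_field_cases[OF assms] .
  obtain M where M: "\<And>m n. m \<ge> M \<Longrightarrow> n \<ge> M \<Longrightarrow> val_ge y N (s m - s n)"
    using s(1) unfolding cauchy_at_def by meson
  have "c \<ominus>\<^bsub>local_field y\<^esub> emb y (s M) = cls y (\<lambda>n. s n + - s M)"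
    using s by (simp add: a_minus_def emb_minus[symmetric]) (simp add: emb_def cls_add)
  moreover have "cval_ge y N \<dots>"
    using M[of _ M] by (subst cval_ge_cls[OF cauchy_at_add[OF s(1) cauchy_at_const]]) auto
  ultimately show ?thesis using that by metis
qed

lemma cval_unique:
  assumes "cauchy_at y s" "\<And>n. n \<ge> M \<Longrightarrow> s n \<noteq> 0 \<and> val y (s n) = v"
  shows "cls y s \<noteq> \<zero>\<^bsub>local_field y\<^esub>" "cval y (cls y s) = v"
proof -
  have nn: "\<not> null_at y s"
  proof
    assume "null_at y s"
    then obtain L where "\<And>n. n \<ge> L \<Longrightarrow> val_ge y (v + 1) (s n)" unfolding null_at_def by meson
    then have "val_ge y (v + 1) (s (max L M))" by simp
    then show False using assms(2)[of "max L M"] by (simp add: val_ge_def)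
  qed
  then show "cls y s \<noteq> \<zero>\<^bsub>local_field y\<^esub>" using assms(1) by (simp add: cls_zero cls_eq_iff)
  obtain L where "\<And>n. n \<ge> L \<Longrightarrow> s n \<noteq> 0 \<and> val y (s n) = cval y (cls y s)"
    using cval_cls[OF assms(1) nn] by blast
  from this[of "max L M"] assms(2)[of "max L M"] show "cval y (cls y s) = v" by simp
qed

lemma cval_emb: "f \<noteq> 0 \<Longrightarrow> cval y (emb y f) = val y f"
  unfolding emb_def by (rule cval_unique) auto

lemma cval_mult:
  assumes "a \<in> carrier (local_field y)" "b \<in> carrier (local_field y)"
    and "a \<noteq> \<zero>\<^bsub>local_field y\<^esub>" "b \<noteq> \<zero>\<^bsub>local_field y\<^esub>"
  shows "a \<otimes>\<^bsub>local_field y\<^esub> b \<noteq> \<zero>\<^bsub>local_field y\<^esub>"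
    "cval y (a \<otimes>\<^bsub>local_field y\<^esub> b) = cval y a + cval y b"
proof -
  obtain s where s: "cauchy_at y s" "a = cls y s" using local_field_cases[OF assms(1)] .
  obtain t where t: "cauchy_at y t" "b = cls y t" using local_field_cases[OF assms(2)] .
  have "\<not> null_at y s" "\<not> null_at y t" using s t assms by (auto simp: cls_zero cls_eq_iff)
  then obtain M L where eqs: "\<And>n. n \<ge> M \<Longrightarrow> s n \<noteq> 0 \<and> val y (s n) = cval y a"
    "\<And>n. n \<ge> L \<Longrightarrow> t n \<noteq> 0 \<and> val y (t n) = cval y b"
    using cval_cls s t by metis
  have "s n * t n \<noteq> 0 \<and> val y (s n * t n) = cval y a + cval y b" if "n \<ge> max M L" for n
    using eqs[of n] that by (auto simp: val_mult)
  from cval_unique[of y "\<lambda>n. s n * t n" "max M L", OF cauchy_at_mult[OF s(1) t(1)] this]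
  show "a \<otimes>\<^bsub>local_field y\<^esub> b \<noteq> \<zero>\<^bsub>local_field y\<^esub>"
    "cval y (a \<otimes>\<^bsub>local_field y\<^esub> b) = cval y a + cval y b"
    using s t by (auto simp: cls_mult)
qed

lemma cabs_nonneg [simp]: "0 \<le> cabs y a"
  by (simp add: cabs_def)

lemma card_field_ge_2: "CARD('k::{field,finite}) \<ge> 2"
proof -
  have "card {0, 1 :: 'k} \<le> CARD('k)" by (rule card_mono) auto
  then show ?thesis by simp
qed

lemma cabs_mult:
  fixes a :: "'k::{field,finite} celem"
  assumes "a \<in> carrier (local_field y)" "b \<in> carrier (local_field y)"
  shows "cabs y (a \<otimes>\<^bsub>local_field y\<^esub> b) = cabs y a * cabs y b"
proof -
  interpret cring "local_field y" by (rule local_field_cring)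
  have q: "real CARD('k) \<noteq> 0" using card_field_ge_2[where 'k='k] by linarith
  show ?thesis
  proof (cases "a = \<zero>\<^bsub>local_field y\<^esub> \<or> b = \<zero>\<^bsub>local_field y\<^esub>")
    case True
    then show ?thesis using assms by (auto simp: cabs_def)
  next
    case False
    then show ?thesis using assms cval_mult[OF assms] q
      by (simp add: cabs_def power_int_add[symmetric] algebra_simps)
  qed
qed

lemma cabs_le:
  assumes "cval_ge y N a"
  shows "cabs y (a :: 'k::{field,finite} celem) \<le> real CARD('k) powi (- (int (place_degree y) * N))"
proof -
  have "real CARD('k) \<ge> 1" using card_field_ge_2[where 'k='k] by linarith
  then show ?thesis using assms
    by (auto simp: cabs_def cval_ge_def intro!: power_int_increasing mult_left_mono)
qed

lemma cabs_add_le: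
  assumes "a \<in> carrier (local_field y)" "b \<in> carrier (local_field y)" "cabs y a \<le> r" "cabs y b \<le> r"
  shows "cabs y (a \<oplus>\<^bsub>local_field y\<^esub> b) \<le> r"
proof -
  interpret cring "local_field y" by (rule local_field_cring)
  show ?thesis
  proof (cases "a = \<zero>\<^bsub>local_field y\<^esub> \<or> b = \<zero>\<^bsub>local_field y\<^esub>")
    case True
    then show ?thesis using assms by auto
  next
    case False
    define N where "N = min (cval y a) (cval y b)"
    have "cval_ge y N (a \<oplus>\<^bsub>local_field y\<^esub> b)" using False assms by (intro cval_ge_add) (auto simp: cval_ge_def N_def)
    note le = cabs_le[OF this]
    have "N = cval y a \<or> N = cval y b" unfolding N_def by linarith
    then show ?thesis
    proof
      assume "N = cval y a"
      then show ?thesis using le assms(3) False by (simp add: cabs_def)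
    next
      assume "N = cval y b"
      then show ?thesis using le assms(4) False by (simp add: cabs_def)
    qed
  qed
qed

lemma cabs_emb:
  "f \<noteq> 0 \<Longrightarrow> cabs y (emb y f) = real CARD('k) powi (- (int (place_degree y) * val y (f :: 'k::{field,finite} ratfun)))"
  by (simp add: cabs_def cval_emb)

subsection \<open>The residue field\<close>

lemma integer_ring_simps:
  "carrier (integer_ring y) = {c. cval_ge y 0 c}"
  "a \<oplus>\<^bsub>integer_ring y\<^esub> b = a \<oplus>\<^bsub>local_field y\<^esub> b"
  "a \<otimes>\<^bsub>integer_ring y\<^esub> b = a \<otimes>\<^bsub>local_field y\<^esub> b"
  "\<zero>\<^bsub>integer_ring y\<^esub> = \<zero>\<^bsub>local_field y\<^esub>" "\<one>\<^bsub>integer_ring y\<^esub> = \<one>\<^bsub>local_field y\<^esub>"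
  by (simp_all add: integer_ring_def ring_of_integers_eq)

lemma integer_ring_cring: "cring (integer_ring y)"
proof -
  interpret cring "local_field y" by (rule local_field_cring)
  have "subring {c. cval_ge y 0 c} (local_field y)"
    by (rule subringI)
      (auto simp: cval_ge_carrier emb_1[symmetric] intro: cval_ge_add cval_ge_minus cval_ge_mult[of y 0 _ 0, simplified])
  then show ?thesis
    using subcring_iff[of "{c. cval_ge y 0 c}"] subcringI' cval_ge_carrier
    unfolding integer_ring_def ring_of_integers_eq by blast
qed

lemma uniformizer_ideal_eq:
  assumes "uniformizer y \<pi>"
  shows "uniformizer_ideal y \<pi> = {c. cval_ge y 1 c}"
proof -
  interpret cring "local_field y" by (rule local_field_cring)
  have \<pi>: "\<pi> \<noteq> 0" "val y \<pi> = 1" using assms by (auto simp: uniformizer_def)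
  have "c \<in> uniformizer_ideal y \<pi>" if c: "cval_ge y 1 c" for c
  proof -
    have "cval_ge y (1 + - 1) (c \<otimes>\<^bsub>local_field y\<^esub> emb y (inverse \<pi>))"
      using \<pi> by (intro cval_ge_mult c) (simp add: val_ge_iff val_inverse)
    moreover have "c \<otimes>\<^bsub>local_field y\<^esub> emb y (inverse \<pi>) \<otimes>\<^bsub>local_field y\<^esub> emb y \<pi> = c"
      using \<pi> cval_ge_carrier[OF c] by (simp add: m_assoc emb_mult[symmetric] emb_1)
    ultimately show ?thesis
      unfolding uniformizer_ideal_def cgenideal_def integer_ring_simps by force
  qed
  moreover have "cval_ge y 1 c" if c: "c \<in> uniformizer_ideal y \<pi>" for c
  proof -
    obtain a where a: "cval_ge y 0 a" "c = a \<otimes>\<^bsub>local_field y\<^esub> emb y \<pi>"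
      using c unfolding uniformizer_ideal_def cgenideal_def integer_ring_simps by auto
    have "cval_ge y (0 + 1) c" unfolding a(2) using \<pi> by (intro cval_ge_mult a) (simp add: val_ge_iff)
    then show ?thesis by simp
  qed
  ultimately show ?thesis by blast
qed

lemma uniformizer_exists: "\<exists>\<pi>. uniformizer y \<pi>"
  using val[of y] by (auto simp: is_normalized_valuation_def uniformizer_def)

lemma some_uniformizer_ideal: "uniformizer_ideal y (SOME \<pi>. uniformizer y \<pi>) = {c. cval_ge y 1 c}"
  by (rule uniformizer_ideal_eq[OF someI_ex[OF uniformizer_exists]])

definition residue :: "'k::{field,finite} place \<Rightarrow> 'k ratfun \<Rightarrow> 'k celem set"
  where "residue y f = {c. cval_ge y 1 c} +>\<^bsub>integer_ring y\<^esub> emb y f"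

lemma residue_ideal: "ideal {c. cval_ge y 1 c} (integer_ring y)"
proof -
  obtain \<pi> where \<pi>: "uniformizer y \<pi>" using uniformizer_exists by blast
  interpret cring "integer_ring y" by (rule integer_ring_cring)
  have "ideal (uniformizer_ideal y \<pi>) (integer_ring y)"
    unfolding uniformizer_ideal_def
    using \<pi> by (intro cgenideal_ideal) (auto simp: integer_ring_simps uniformizer_def val_ge_iff)
  then show ?thesis by (simp add: uniformizer_ideal_eq[OF \<pi>])
qed

lemma residue_field_eq: "residue_field y = integer_ring y Quot {c. cval_ge y 1 c}"
  by (simp add: residue_field_def some_uniformizer_ideal)

lemma residue_field_ring: "ring (residue_field y)"
  unfolding residue_field_eq by (rule ideal.quotient_is_ring[OF residue_ideal])

lemma residue_constants_eq: "residue_constants y = range (\<lambda>c. residue y (const_rat c))"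
  by (simp add: residue_constants_def residue_def some_uniformizer_ideal)

lemma residue_hom: "(\<lambda>a. {c. cval_ge y 1 c} +>\<^bsub>integer_ring y\<^esub> a) \<in> ring_hom (integer_ring y) (residue_field y)"
  unfolding residue_field_eq by (rule ideal.rcos_ring_hom[OF residue_ideal])

lemma residue_carrier: "val_ge y 0 f \<Longrightarrow> residue y f \<in> carrier (residue_field y)"
  using ring_hom_closed[OF residue_hom, of "emb y f" y] by (simp add: residue_def integer_ring_simps)

lemma residue_add: "val_ge y 0 f \<Longrightarrow> val_ge y 0 g \<Longrightarrow>
    residue y (f + g) = residue y f \<oplus>\<^bsub>residue_field y\<^esub> residue y g"
  using ring_hom_add[OF residue_hom, of "emb y f" y "emb y g"]
  by (simp add: residue_def integer_ring_simps emb_add)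

lemma residue_mult: "val_ge y 0 f \<Longrightarrow> val_ge y 0 g \<Longrightarrow>
    residue y (f * g) = residue y f \<otimes>\<^bsub>residue_field y\<^esub> residue y g"
  using ring_hom_mult[OF residue_hom, of "emb y f" y "emb y g"]
  by (simp add: residue_def integer_ring_simps emb_mult)

lemma residue_one: "residue y 1 = \<one>\<^bsub>residue_field y\<^esub>"
  using ring_hom_one[OF residue_hom, of y] by (simp add: residue_def integer_ring_simps emb_1)

lemma residue_coset_eq_iff:
  assumes "cval_ge y 0 a" "cval_ge y 0 b"
  shows "{c. cval_ge y 1 c} +>\<^bsub>integer_ring y\<^esub> a = {c. cval_ge y 1 c} +>\<^bsub>integer_ring y\<^esub> b \<longleftrightarrow>
    cval_ge y 1 (a \<ominus>\<^bsub>local_field y\<^esub> b)"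
proof -
  interpret L: cring "local_field y" by (rule local_field_cring)
  interpret I: ideal "{c. cval_ge y 1 c}" "integer_ring y" by (rule residue_ideal)
  have ab: "a \<in> carrier (local_field y)" "b \<in> carrier (local_field y)" using assms by (auto simp: cval_ge_carrier)
  have "a \<in> {c. cval_ge y 1 c} +>\<^bsub>integer_ring y\<^esub> b \<longleftrightarrow> (\<exists>h. cval_ge y 1 h \<and> a = h \<oplus>\<^bsub>local_field y\<^esub> b)"
    by (auto simp: a_r_coset_def r_coset_def integer_ring_simps)
  also have "\<dots> \<longleftrightarrow> cval_ge y 1 (a \<ominus>\<^bsub>local_field y\<^esub> b)"
  proof
    assume "\<exists>h. cval_ge y 1 h \<and> a = h \<oplus>\<^bsub>local_field y\<^esub> b"
    then obtain h where h: "cval_ge y 1 h" "a = h \<oplus>\<^bsub>local_field y\<^esub> b" by blast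
    then have "a \<ominus>\<^bsub>local_field y\<^esub> b = h"
      using ab cval_ge_carrier[OF h(1)] by (simp add: L.minus_eq L.a_assoc L.r_neg)
    then show "cval_ge y 1 (a \<ominus>\<^bsub>local_field y\<^esub> b)" using h by simp
  next
    assume "cval_ge y 1 (a \<ominus>\<^bsub>local_field y\<^esub> b)"
    moreover have "a = (a \<ominus>\<^bsub>local_field y\<^esub> b) \<oplus>\<^bsub>local_field y\<^esub> b"
      using ab by (simp add: L.minus_eq L.a_assoc L.l_neg)
    ultimately show "\<exists>h. cval_ge y 1 h \<and> a = h \<oplus>\<^bsub>local_field y\<^esub> b" by blast
  qed
  finally show ?thesis
    using I.a_repr_independence'[of a b] I.a_rcos_self[of a] assms by (auto simp: integer_ring_simps)
qed

lemma residue_eq_iff: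
  "val_ge y 0 f \<Longrightarrow> val_ge y 0 g \<Longrightarrow> residue y f = residue y g \<longleftrightarrow> val_ge y 1 (f - g)"
  by (simp add: residue_def residue_coset_eq_iff emb_diff[symmetric])

lemma residue_zero: "residue y 0 = \<zero>\<^bsub>residue_field y\<^esub>"
proof -
  interpret R: ring "residue_field y" by (rule residue_field_ring)
  have "residue y 0 \<oplus>\<^bsub>residue_field y\<^esub> residue y 0 = residue y 0"
    using residue_add[of y 0 0] by simp
  then show ?thesis using residue_carrier[of y 0] by (simp add: R.add.l_cancel_one)
qed

text \<open>Rational functions are dense in the completion.\<close>

lemma residue_surj:
  assumes "X \<in> carrier (residue_field y)"
  obtains f where "val_ge y 0 f" "X = residue y f"
proof -
  interpret L: cring "local_field y" by (rule local_field_cring)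
  obtain a where a: "cval_ge y 0 a" "X = {c. cval_ge y 1 c} +>\<^bsub>integer_ring y\<^esub> a"
    using assms unfolding residue_field_eq
    by (auto simp: FactRing_def A_RCOSETS_def RCOSETS_def a_r_coset_def integer_ring_simps)
  then obtain f where f: "cval_ge y 1 (a \<ominus>\<^bsub>local_field y\<^esub> emb y f)"
    using emb_dense[of a y 1] cval_ge_carrier by metis
  have ac: "a \<in> carrier (local_field y)" using a by (simp add: cval_ge_carrier)
  have "emb y f = a \<oplus>\<^bsub>local_field y\<^esub> (\<ominus>\<^bsub>local_field y\<^esub> (a \<ominus>\<^bsub>local_field y\<^esub> emb y f))"
    using ac by (simp add: L.minus_eq L.minus_add L.a_assoc[symmetric] L.r_neg)
  moreover have "cval_ge y 0 \<dots>" using a(1) f by (intro cval_ge_add cval_ge_minus) (auto intro: cval_ge_mono)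
  ultimately have "cval_ge y 0 (emb y f)" by metis
  then show ?thesis using that a f residue_coset_eq_iff[of y a "emb y f"] by (simp add: residue_def)
qed

lemma residue_constants_subfield: "subfield (residue_constants y) (residue_field y)"
proof -
  interpret R: ring "residue_field y" by (rule residue_field_ring)
  let ?K = "residue_constants y"
  have neg: "\<ominus>\<^bsub>residue_field y\<^esub> residue y (const_rat c) = residue y (const_rat (- c))" for c
    by (rule R.minus_equality)
      (auto simp: residue_carrier residue_add[symmetric] const_rat_add[symmetric] residue_zero)
  have comm: "residue y (const_rat a) \<otimes>\<^bsub>residue_field y\<^esub> residue y (const_rat b) = residue y (const_rat (a * b))" for a b
    by (simp add: residue_mult[symmetric] const_rat_mult)
  have add: "residue y (const_rat a) \<oplus>\<^bsub>residue_field y\<^esub> residue y (const_rat b) = residue y (const_rat (a + b))" for a b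
    by (simp add: residue_add[symmetric] const_rat_add)
  have one: "\<one>\<^bsub>residue_field y\<^esub> = residue y (const_rat 1)" by (simp add: residue_one)
  have one_in: "residue y 1 \<in> range (\<lambda>c. residue y (const_rat c))"
    by (rule range_eqI[of _ _ 1]) simp
  have "subring ?K (residue_field y)"
    unfolding residue_constants_eq
    by (rule R.subringI) (auto simp: residue_carrier neg comm add one one_in)
  then have sub: "subcring ?K (residue_field y)"
    by (rule R.subcringI) (auto simp: residue_constants_eq comm mult.commute)
  have "Units ((residue_field y)\<lparr>carrier := ?K\<rparr>) = ?K - {\<zero>\<^bsub>residue_field y\<^esub>}"
  proof (intro equalityI subsetI)
    fix u assume "u \<in> Units ((residue_field y)\<lparr>carrier := ?K\<rparr>)"
    then obtain v where uv: "u \<in> ?K" "v \<in> ?K" "v \<otimes>\<^bsub>residue_field y\<^esub> u = \<one>\<^bsub>residue_field y\<^esub>"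
      by (auto simp: Units_def)
    have "u \<noteq> \<zero>\<^bsub>residue_field y\<^esub>"
    proof
      assume "u = \<zero>\<^bsub>residue_field y\<^esub>"
      moreover have "v \<in> carrier (residue_field y)" using uv(2) by (auto simp: residue_constants_eq residue_carrier)
      ultimately have "residue y 1 = residue y 0" using uv(3) by (simp add: residue_one residue_zero)
      then show False by (simp add: residue_eq_iff val_ge_iff)
    qed
    then show "u \<in> ?K - {\<zero>\<^bsub>residue_field y\<^esub>}" using uv by blast
  next
    fix u assume u: "u \<in> ?K - {\<zero>\<^bsub>residue_field y\<^esub>}"
    then obtain c where c: "u = residue y (const_rat c)" by (auto simp: residue_constants_eq)
    then have "c \<noteq> 0" using u by (auto simp: residue_zero)
    then have "residue y (const_rat (inverse c)) \<otimes>\<^bsub>residue_field y\<^esub> u = \<one>\<^bsub>residue_field y\<^esub>"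
      "u \<otimes>\<^bsub>residue_field y\<^esub> residue y (const_rat (inverse c)) = \<one>\<^bsub>residue_field y\<^esub>"
      unfolding c comm one by auto
    moreover have "residue y (const_rat (inverse c)) \<in> ?K" by (simp add: residue_constants_eq)
    ultimately show "u \<in> Units ((residue_field y)\<lparr>carrier := ?K\<rparr>)" using u by (auto simp: Units_def)
  qed
  then show ?thesis using sub by (rule R.subfieldI[rotated])
qed

context coordinate
begin

text \<open>The residue field at \<open>y\<close> has the basis \<open>1, s, \<dots>, s\<^sup>d\<^sup>-\<^sup>1\<close> with \<open>d\<close> the degree of the prime polynomial of \<open>y\<close>.\<close>

lemma place_degree_eq:
  assumes yx: "y \<noteq> x"
  shows "place_degree y = degree (prime_of y)"
proof -
  interpret R: ring "residue_field y" by (rule residue_field_ring)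
  let ?R = "residue_field y" let ?K = "residue_constants y"
  \<comment> \<open>\<open>E n\<close> is the span of the first \<open>n\<close> powers of \<open>s\<close>; one power at a time extends it by a line.\<close>
  define E where "E n = {residue y (ev s P) | P. \<forall>i\<ge>n. coeff P i = 0}" for n :: nat
  have int [simp]: "val_ge y 0 (ev s P)" for P by (rule val_ge_ev'[OF yx])
  have mono: "const_rat c * ev s (monom 1 n) = ev s (monom c n)" for c n
    by (simp add: ev_smult[symmetric] smult_monom)
  have "R.dimension n ?K (E n)" if "n \<le> degree (prime_of y)" for n
    using that
  proof (induction n)
    case 0
    have "E 0 = {\<zero>\<^bsub>?R\<^esub>}"
      by (auto simp: E_def residue_zero[symmetric] poly_eq_iff[of _ 0] intro!: arg_cong[of _ _ "residue y"] exI[of _ "0 :: 'k poly"])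
    then show ?case by simp
  next
    case (Suc n)
    have "E (Suc n) = R.line_extension ?K (residue y (ev s (monom 1 n))) (E n)"
    proof (intro equalityI subsetI)
      fix X assume "X \<in> E (Suc n)"
      then obtain P where P: "X = residue y (ev s P)" "\<forall>i\<ge>Suc n. coeff P i = 0" by (auto simp: E_def)
      define c Q where "c = coeff P n" and "Q = P - monom c n"
      have "P = monom c n + Q" by (simp add: Q_def)
      then have "X = residue y (const_rat c) \<otimes>\<^bsub>?R\<^esub> residue y (ev s (monom 1 n)) \<oplus>\<^bsub>?R\<^esub> residue y (ev s Q)"
        using P by (simp add: residue_mult[symmetric] mono residue_add[symmetric] ev_add)
      moreover have "\<forall>i\<ge>n. coeff Q i = 0"
        using P(2) by (auto simp: Q_def c_def le_Suc_eq Suc_le_eq)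
      ultimately show "X \<in> R.line_extension ?K (residue y (ev s (monom 1 n))) (E n)"
        unfolding R.line_extension_mem_iff residue_constants_eq E_def by blast
    next
      fix X assume "X \<in> R.line_extension ?K (residue y (ev s (monom 1 n))) (E n)"
      then obtain c Q where "\<forall>i\<ge>n. coeff Q i = 0"
        "X = residue y (const_rat c) \<otimes>\<^bsub>?R\<^esub> residue y (ev s (monom 1 n)) \<oplus>\<^bsub>?R\<^esub> residue y (ev s Q)"
        unfolding R.line_extension_mem_iff residue_constants_eq E_def by blast
      then have "X = residue y (ev s (monom c n + Q))" "\<forall>i\<ge>Suc n. coeff (monom c n + Q) i = 0"
        by (auto simp: residue_mult[symmetric] mono residue_add[symmetric] ev_add)
      then show "X \<in> E (Suc n)" unfolding E_def by blast
    qed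
    moreover have "residue y (ev s (monom 1 n)) \<notin> E n"
    proof
      assume "residue y (ev s (monom 1 n)) \<in> E n"
      then obtain P where P: "residue y (ev s (monom 1 n)) = residue y (ev s P)" "\<forall>i\<ge>n. coeff P i = 0"
        by (auto simp: E_def)
      then have d: "prime_of y dvd monom 1 n - P"
        by (simp add: residue_eq_iff prime_of_dvd_iff[OF yx] ev_diff)
      have "coeff (monom 1 n - P) n \<noteq> 0" using P by simp
      then have nz: "monom 1 n - P \<noteq> 0" by (metis coeff_0)
      have "degree (monom 1 n - P) \<le> n" using P by (intro degree_le) auto
      then show False using dvd_imp_degree_le[OF d nz] Suc.prems by simp
    qed
    ultimately show ?case using Suc by (auto intro!: R.Suc_dim simp: residue_carrier)
  qed
  then have dim: "R.dimension (degree (prime_of y)) ?K (E (degree (prime_of y)))" by simp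
  have "E (degree (prime_of y)) = carrier ?R"
  proof (intro equalityI subsetI)
    fix X assume "X \<in> carrier ?R"
    then obtain f where f: "val_ge y 0 f" "X = residue y f" using residue_surj by metis
    obtain P where P: "P = 0 \<or> degree P < degree (prime_of y)" "val_ge y 1 (f - ev s P)"
      using residue_polynomial[OF yx f(1)] by blast
    then have "X = residue y (ev s P)" using f by (simp add: residue_eq_iff)
    moreover have "\<forall>i\<ge>degree (prime_of y). coeff P i = 0" using P by (auto simp: coeff_eq_0)
    ultimately show "X \<in> E (degree (prime_of y))" unfolding E_def by blast
  qed (auto simp: E_def residue_carrier)
  with dim have dim: "R.dimension (degree (prime_of y)) ?K (carrier ?R)" by simp
  show ?thesis
    unfolding place_degree_def
  proof (rule the_equality)
    show "R.dimension (degree (prime_of y)) ?K (carrier ?R)" by (rule dim)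
    show "n = degree (prime_of y)" if "R.dimension n ?K (carrier ?R)" for n
      using R.unique_dimension[OF residue_constants_subfield] R.finite_dimensionI[OF dim] dim that by blast
  qed
qed

end

text \<open>
  At infinity the standard coordinate does it; any other place of degree one is the zero of a
  linear polynomial, which can be inverted.
\<close>

lemma degree_one_coordinate:
  assumes "place_degree x = 1"
  obtains s where "coordinate x s"
proof -
  interpret A: coordinate "Abs_place degree_valuation" "Fract [:0, 1:] (1 :: 'a poly)"
    by (rule coordinate_degree_valuation)
  show ?thesis
  proof (cases "x = Abs_place degree_valuation")
    case True
    then show ?thesis using that A.coordinate_axioms by blast
  next
    case False
    then have "degree (A.prime_of x) = 1" using A.place_degree_eq assms by simp
    then show ?thesis using A.coordinate_linear[OF False] that by blast
  qed
qed

section \<open>Adeles and families of rational functions\<close>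

lemma adele_eqI: "(\<And>y. comp a y = comp b y) \<Longrightarrow> a = b"
  by (metis comp_inject ext)

lemma comp_add: "comp (a + b) y = comp a y \<oplus>\<^bsub>local_field y\<^esub> comp b y"
  by (simp add: plus_adele.rep_eq)

lemma comp_mult: "comp (a * b) y = comp a y \<otimes>\<^bsub>local_field y\<^esub> comp b y"
  by (simp add: times_adele.rep_eq)

lemma comp_minus: "comp (- a) y = \<ominus>\<^bsub>local_field y\<^esub> comp a y"
  by (simp add: uminus_adele.rep_eq)

lemma comp_diff: "comp (a - b) y = comp a y \<ominus>\<^bsub>local_field y\<^esub> comp b y"
  by (simp only: diff_conv_add_uminus comp_add comp_minus a_minus_def)

lemma comp_0: "comp 0 y = \<zero>\<^bsub>local_field y\<^esub>"
  by (simp add: zero_adele.rep_eq)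

lemma comp_1: "comp 1 y = \<one>\<^bsub>local_field y\<^esub>"
  by (simp add: one_adele.rep_eq)

definition aval_ge :: "'k::{field,finite} place \<Rightarrow> int \<Rightarrow> 'k adele \<Rightarrow> bool"
  where "aval_ge y N a \<longleftrightarrow> cval_ge y N (comp a y)"

lemma aval_ge_0 [simp]: "aval_ge y N 0"
  by (simp add: aval_ge_def comp_0)

lemma aval_ge_1 [simp]: "aval_ge y N 1 \<longleftrightarrow> N \<le> 0"
  by (simp add: aval_ge_def comp_1 emb_1[symmetric] val_ge_iff)

lemma aval_ge_mono: "aval_ge y N a \<Longrightarrow> M \<le> N \<Longrightarrow> aval_ge y M a"
  unfolding aval_ge_def by (rule cval_ge_mono)

lemma aval_ge_add: "aval_ge y N a \<Longrightarrow> aval_ge y N b \<Longrightarrow> aval_ge y N (a + b)"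
  by (simp add: aval_ge_def comp_add cval_ge_add)

lemma aval_ge_minus [simp]: "aval_ge y N (- a) \<longleftrightarrow> aval_ge y N a"
  using cval_ge_minus[of y N "comp a y"] cval_ge_minus[of y N "comp (- a) y"]
  by (auto simp: aval_ge_def comp_minus[symmetric])

lemma aval_ge_diff: "aval_ge y N a \<Longrightarrow> aval_ge y N b \<Longrightarrow> aval_ge y N (a - b)"
  using aval_ge_add[of y N a "- b"] by simp

lemma aval_ge_mult: "aval_ge y N a \<Longrightarrow> aval_ge y M b \<Longrightarrow> aval_ge y (N + M) (a * b)"
  by (simp add: aval_ge_def comp_mult cval_ge_mult)

lemma aval_ge_mult_left: "aval_ge y 0 a \<Longrightarrow> aval_ge y N b \<Longrightarrow> aval_ge y N (a * b)"
  using aval_ge_mult[of y 0 a N b] by simp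

lemma aval_ge_mult_right: "aval_ge y N a \<Longrightarrow> aval_ge y 0 b \<Longrightarrow> aval_ge y N (a * b)"
  using aval_ge_mult[of y N a 0 b] by simp

lemma aval_ge_bounded: obtains N where "aval_ge y N a"
  using cval_ge_bounded[OF comp_carrier[of a y]] that unfolding aval_ge_def by metis

lemma finite_not_aval_ge: "finite {y. \<not> aval_ge y 0 a}"
  using comp[of a] by (simp add: aval_ge_def ring_of_integers_eq)

text \<open>If \<open>a\<close> is congruent to \<open>1\<close>, multiplying by \<open>b = 1 - (a - 1) b\<close> gains valuation as long as
  \<open>b\<close> is not yet integral.\<close>

lemma aval_ge_inverse_of_unit:
  assumes "a * b = 1" "aval_ge y 1 (a - 1)"
  shows "aval_ge y 0 b"
proof -
  obtain N where N: "aval_ge y N b" by (rule aval_ge_bounded)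
  have "aval_ge y (min 0 (N + int n)) b" for n
  proof (induction n)
    case 0
    show ?case using N by (auto intro: aval_ge_mono)
  next
    case (Suc n)
    have "b = 1 - (a - 1) * b" using assms(1) by (simp add: left_diff_distrib)
    moreover have "aval_ge y (min 0 (N + int (Suc n))) (1 - (a - 1) * b)"
      by (intro aval_ge_diff aval_ge_mono[OF aval_ge_mult[OF assms(2) Suc]]) auto
    ultimately show ?case by metis
  qed
  from this[of "nat (- N)"] show ?thesis by (auto simp: min_def split: if_splits)
qed

text \<open>
  The value \<open>0\<close> outside the condition is a default: the family only defines an adele if it is
  integral at almost all places.
\<close>

definition adele_of :: "('k::{field,finite} place \<Rightarrow> 'k ratfun) \<Rightarrow> 'k adele"
  where "adele_of F = Abs_adele (\<lambda>y. if finite {y. \<not> val_ge y 0 (F y)} then emb y (F y) else \<zero>\<^bsub>local_field y\<^esub>)"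

lemma comp_adele_of: "finite {y. \<not> val_ge y 0 (F y)} \<Longrightarrow> comp (adele_of F) y = emb y (F y)"
  unfolding adele_of_def by (subst Abs_adele_inverse) (auto simp: ring_of_integers_eq)

lemma aval_ge_adele_of: "finite {y. \<not> val_ge y 0 (F y)} \<Longrightarrow> aval_ge y N (adele_of F) \<longleftrightarrow> val_ge y N (F y)"
  by (simp add: aval_ge_def comp_adele_of)

lemma local_approximation:
  obtains f where "cval_ge y N (comp a y \<ominus>\<^bsub>local_field y\<^esub> emb y f)"
  using emb_dense[OF comp_carrier[of a y]] by metis

section \<open>Two-by-two matrices\<close>

lemma mat2_eq_iff:
  "(A :: 'a^2^2) = B \<longleftrightarrow> A$1$1 = B$1$1 \<and> A$1$2 = B$1$2 \<and> A$2$1 = B$2$1 \<and> A$2$2 = B$2$2"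
  by (auto simp: vec_eq_iff forall_2)

lemma mat2_mult: "((A :: 'a::semiring_1^2^2) ** B) $ i $ j = A$i$1 * B$1$j + A$i$2 * B$2$j"
  by (simp add: matrix_matrix_mult_def sum_2)

lemma mat2_diff_mult: "((A :: 'a::ring_1^2^2) - B) ** C = A ** C - B ** (C :: 'a::ring_1^2^2)"
  unfolding mat2_eq_iff by (simp add: mat2_mult algebra_simps)

lemma mat2_mult_diff: "(A :: 'a::ring_1^2^2) ** (B - C) = A ** B - A ** (C :: 'a::ring_1^2^2)"
  unfolding mat2_eq_iff by (simp add: mat2_mult algebra_simps)

lemma mat2_one [simp]:
  "(mat 1 :: 'a::semiring_1^2^2)$1$1 = 1" "(mat 1 :: 'a::semiring_1^2^2)$2$2 = 1"
  "(mat 1 :: 'a::semiring_1^2^2)$1$2 = 0" "(mat 1 :: 'a::semiring_1^2^2)$2$1 = 0"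
  by (simp_all add: mat_def)

definition mat2 :: "'a \<Rightarrow> 'a \<Rightarrow> 'a \<Rightarrow> 'a \<Rightarrow> 'a::zero^2^2"
  where "mat2 a b c d = vector [vector [a, b], vector [c, d]]"

lemma mat2_entries [simp]:
  "mat2 a b c d $ 1 $ 1 = a" "mat2 a b c d $ 1 $ 2 = b" "mat2 a b c d $ 2 $ 1 = c" "mat2 a b c d $ 2 $ 2 = d"
  by (simp_all add: mat2_def)

lemma mat2_mult_mat2: "mat2 a b c d ** mat2 a' b' c' d' =
    mat2 (a * a' + b * c') (a * b' + b * d') (c * a' + d * c') (c * b' + d * (d' :: 'a::semiring_1))"
  by (simp add: mat2_eq_iff mat2_mult)

lemma mat2_one_eq: "mat 1 = mat2 1 0 0 (1 :: 'a::semiring_1)"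
  by (simp add: mat2_eq_iff)

lemma det_mat2 [simp]: "det (mat2 a b c d) = a * d - b * (c :: 'a::comm_ring_1)"
  by (simp add: det_2)

lemma mat2_all: "(\<forall>i j. P i j) \<longleftrightarrow> P 1 1 \<and> P 1 2 \<and> P 2 1 \<and> P (2::2) (2::2)"
  by (auto simp: forall_2)

text \<open>Cramer's rule, stated without division so that it applies to the ring of adeles.\<close>

lemma right_inverse_entries:
  fixes A B :: "'a::comm_ring_1^2^2"
  assumes "A ** B = mat 1"
  shows "B$1$1 = det B * A$2$2" "B$1$2 = - (det B * A$1$2)" "B$2$1 = - (det B * A$2$1)" "B$2$2 = det B * A$1$1"
    "det A * det B = 1"
proof -
  have e: "A$1$1 * B$1$1 + A$1$2 * B$2$1 = 1" "A$1$1 * B$1$2 + A$1$2 * B$2$2 = 0"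
    "A$2$1 * B$1$1 + A$2$2 * B$2$1 = 0" "A$2$1 * B$1$2 + A$2$2 * B$2$2 = 1"
    using assms by (simp_all add: mat2_eq_iff mat2_mult)
  have "det B * A$2$2 = B$1$1 * (A$2$1 * B$1$2 + A$2$2 * B$2$2) - B$1$2 * (A$2$1 * B$1$1 + A$2$2 * B$2$1)"
    by (simp add: det_2 algebra_simps)
  then show "B$1$1 = det B * A$2$2" using e by simp
  have "det B * A$1$2 = B$1$1 * (A$1$1 * B$1$2 + A$1$2 * B$2$2) - B$1$2 * (A$1$1 * B$1$1 + A$1$2 * B$2$1)"
    by (simp add: det_2 algebra_simps)
  then show "B$1$2 = - (det B * A$1$2)" using e by simp
  have "det B * A$2$1 = B$2$2 * (A$2$1 * B$1$1 + A$2$2 * B$2$1) - B$2$1 * (A$2$1 * B$1$2 + A$2$2 * B$2$2)"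
    by (simp add: det_2 algebra_simps)
  then show "B$2$1 = - (det B * A$2$1)" using e by simp
  have "det B * A$1$1 = B$2$2 * (A$1$1 * B$1$1 + A$1$2 * B$2$1) - B$2$1 * (A$1$1 * B$1$2 + A$1$2 * B$2$2)"
    by (simp add: det_2 algebra_simps)
  then show "B$2$2 = det B * A$1$1" using e by simp
  show "det A * det B = 1" using assms by (metis det_mul det_I)
qed

lemma matrix_inv_field:
  fixes A :: "'a::field^2^2"
  assumes "det A \<noteq> 0"
  shows "A ** matrix_inv A = mat 1" "matrix_inv A ** A = mat 1" "det (matrix_inv A) = inverse (det A)"
proof -
  show *: "A ** matrix_inv A = mat 1" "matrix_inv A ** A = mat 1"
    using assms by (simp_all add: invertible_det_nz matrix_inv_invertible)
  show "det (matrix_inv A) = inverse (det A)"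
    using right_inverse_entries(5)[OF *(1)] by (simp add: inverse_unique)
qed

definition gl2O :: "'k::{field,finite} place \<Rightarrow> 'k ratfun^2^2 \<Rightarrow> bool"
  where "gl2O y A \<longleftrightarrow> (\<forall>i j. val_ge y 0 (A$i$j)) \<and> det A \<noteq> 0 \<and> val y (det A) = 0"

lemma gl2O_entry: "gl2O y A \<Longrightarrow> val_ge y 0 (A$i$j)"
  by (simp add: gl2O_def)

lemma gl2O_1 [simp]: "gl2O y (mat 1)"
  by (simp add: gl2O_def mat2_all)

lemma gl2O_mult: "gl2O y A \<Longrightarrow> gl2O y B \<Longrightarrow> gl2O y (A ** B)"
  by (auto simp: gl2O_def mat2_mult det_mul val_mult intro!: val_ge_add val_ge_mult_left)

lemma gl2O_inverse:
  assumes "gl2O y A"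
  shows "gl2O y (matrix_inv A)"
proof -
  have d: "det A \<noteq> 0" "val y (det A) = 0" using assms by (auto simp: gl2O_def)
  note m = matrix_inv_field[OF d(1)]
  have i: "val_ge y 0 (inverse (det A))" using d by (simp add: val_ge_iff val_inverse)
  have "val_ge y 0 (det (matrix_inv A) * A$i$j)" for i j
    unfolding m(3) by (rule val_ge_mult_left[OF i gl2O_entry[OF assms]])
  then have "\<forall>i j. val_ge y 0 (matrix_inv A$i$j)"
    unfolding mat2_all using right_inverse_entries(1-4)[OF m(1)] by (metis val_ge_minus)
  then show ?thesis using d m(3) by (simp add: gl2O_def val_inverse)
qed

section \<open>The adelic group\<close>

lemma mat_of_mult: "mat_of (g * h) = mat_of g ** mat_of h"
  by (rule times_gl2.rep_eq)

lemma mat_of_1: "mat_of 1 = mat 1"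
  by (rule one_gl2.rep_eq)

lemma gl2_eqI: "(\<And>i j y. entry g i j y = entry h i j y) \<Longrightarrow> g = h"
  by (metis mat_of_inject vec_eq_iff adele_eqI)

lemma gl2_inverse_cancel [simp]:
  "inverse g * (g * h) = h" "g * (inverse g * h) = (h :: 'k::{field,finite} gl2)"
  by (simp_all add: mult.assoc[symmetric] gl2_inverse)

lemma gl2_inverse_unique: "g * h = 1 \<Longrightarrow> inverse g = (h :: 'k::{field,finite} gl2)"
  by (metis gl2_inverse_cancel(1) mult.right_neutral)

lemma gl2_inverse_mult: "inverse (g * h) = inverse h * inverse (g :: 'k::{field,finite} gl2)"
  by (rule gl2_inverse_unique) (simp add: mult.assoc gl2_inverse)

lemma gl2_inverse_inverse [simp]: "inverse (inverse g) = (g :: 'k::{field,finite} gl2)"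
  by (rule gl2_inverse_unique) (simp add: gl2_inverse)

lemma mat_of_inverse:
  "mat_of g ** mat_of (inverse g) = mat 1" "mat_of (inverse g) ** mat_of g = mat 1"
  by (simp_all add: mat_of_mult[symmetric] gl2_inverse mat_of_1)

subsection \<open>Level structure\<close>

text \<open>
  Integrality of the inverse matrix is expressed through its determinant; by Cramer's rule this
  is equivalent, and it is much easier to verify.
\<close>

definition level :: "'k::{field,finite} place \<Rightarrow> 'k gl2 set"
  where "level x = {k. (\<forall>i j y. aval_ge y 0 (mat_of k$i$j)) \<and> (\<forall>y. aval_ge y 0 (det (mat_of (inverse k)))) \<and>
    (\<forall>i j. aval_ge x 1 (mat_of k$i$j - mat 1$i$j))}"

definition integral_gl2 :: "'k::{field,finite} gl2 set"
  where "integral_gl2 = {k. (\<forall>i j y. aval_ge y 0 (mat_of k$i$j)) \<and> (\<forall>y. aval_ge y 0 (det (mat_of (inverse k))))}"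

lemma integral_gl2_inverse_entry:
  assumes "k \<in> integral_gl2"
  shows "aval_ge y 0 (mat_of (inverse k)$i$j)"
proof -
  have "aval_ge y 0 (det (mat_of (inverse k)) * mat_of k$i$j)" for i j
    using assms by (auto simp: integral_gl2_def intro!: aval_ge_mult_left)
  then have "\<forall>i j. aval_ge y 0 (mat_of (inverse k)$i$j)"
    unfolding mat2_all using right_inverse_entries(1-4)[OF mat_of_inverse(1)[of k]] by (metis aval_ge_minus)
  then show ?thesis by blast
qed

lemma aval_ge_mat2_mult:
  fixes A B :: "'k::{field,finite} adele^2^2"
  shows "(\<And>i j. aval_ge y N (A$i$j)) \<Longrightarrow> (\<And>i j. aval_ge y M (B$i$j)) \<Longrightarrow> aval_ge y (N + M) ((A ** B)$i$j)"
  by (auto simp: mat2_mult intro!: aval_ge_add aval_ge_mult)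

lemma aval_ge_det: "(\<And>i j. aval_ge y 0 (A$i$j)) \<Longrightarrow> aval_ge y 0 (det (A :: 'k::{field,finite} adele^2^2))"
  by (auto simp: det_2 intro!: aval_ge_diff aval_ge_mult_left)

lemma gl2_integral_eq: "gl2_integral = integral_gl2"
proof (intro equalityI subsetI)
  fix k :: "'a gl2" assume "k \<in> gl2_integral"
  then show "k \<in> integral_gl2"
    by (auto simp: gl2_integral_def integral_gl2_def adele_integers_def ring_of_integers_eq aval_ge_def[symmetric] intro: aval_ge_det)
next
  fix k :: "'a gl2" assume "k \<in> integral_gl2"
  then show "k \<in> gl2_integral"
    using integral_gl2_inverse_entry[of k]
    by (auto simp: gl2_integral_def integral_gl2_def adele_integers_def ring_of_integers_eq aval_ge_def[symmetric])
qed

lemma level_integral: "level x \<subseteq> integral_gl2"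
  by (auto simp: level_def integral_gl2_def)

lemma congruence_subgroup_eq:
  assumes "uniformizer x \<pi>"
  shows "congruence_subgroup x \<pi> = level x"
proof -
  have "cval_ge x 1 (entry k i j x \<ominus>\<^bsub>local_field x\<^esub> entry 1 i j x) \<longleftrightarrow> aval_ge x 1 (mat_of k$i$j - mat 1$i$j)" for k i j
    by (simp add: aval_ge_def comp_diff mat_of_1)
  then show ?thesis
    by (auto simp: congruence_subgroup_def uniformizer_ideal_eq[OF assms] gl2_integral_eq level_def integral_gl2_def)
qed

lemma level_near: "k \<in> level x \<Longrightarrow> aval_ge x 1 (mat_of k$i$j - mat 1$i$j)"
  by (simp add: level_def)

lemma integral_gl2_mult: "g \<in> integral_gl2 \<Longrightarrow> h \<in> integral_gl2 \<Longrightarrow> g * h \<in> integral_gl2"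
  using aval_ge_mat2_mult[of _ 0 "mat_of g" 0 "mat_of h"]
  by (auto simp: integral_gl2_def gl2_inverse_mult mat_of_mult det_mul intro: aval_ge_mult_left)

lemma integral_gl2_inverse: "g \<in> integral_gl2 \<Longrightarrow> inverse g \<in> integral_gl2"
  using integral_gl2_inverse_entry[of g] aval_ge_det[of _ "mat_of g"] by (auto simp: integral_gl2_def)

lemma level_iff: "k \<in> level x \<longleftrightarrow> k \<in> integral_gl2 \<and> (\<forall>i j. aval_ge x 1 ((mat_of k - mat 1)$i$j))"
  by (auto simp: level_def integral_gl2_def)

lemma integral_gl2_entry: "k \<in> integral_gl2 \<Longrightarrow> aval_ge y 0 (mat_of k$i$j)"
  by (simp add: integral_gl2_def)

lemma level_mult:
  assumes "g \<in> level x" "h \<in> level x"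
  shows "g * h \<in> level x"
proof -
  have "mat_of (g * h) - mat 1 = (mat_of g - mat 1) ** mat_of h + (mat_of h - mat 1)"
    by (simp add: mat_of_mult mat2_diff_mult)
  moreover have "aval_ge x 1 (((mat_of g - mat 1) ** mat_of h)$i$j)" for i j
    using assms aval_ge_mat2_mult[of x 1 "mat_of g - mat 1" 0 "mat_of h"] by (auto simp: level_iff integral_gl2_entry)
  ultimately have "aval_ge x 1 ((mat_of (g * h) - mat 1)$i$j)" for i j
    using assms unfolding level_iff by (metis vector_add_component aval_ge_add)
  then show ?thesis using assms by (simp add: level_iff integral_gl2_mult)
qed

lemma level_inverse:
  assumes "g \<in> level x"
  shows "inverse g \<in> level x"
proof -
  have "mat_of (inverse g) - mat 1 = - (mat_of (inverse g) ** (mat_of g - mat 1))"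
    by (simp add: mat2_mult_diff mat_of_inverse)
  moreover have "aval_ge x 1 ((mat_of (inverse g) ** (mat_of g - mat 1))$i$j)" for i j
    using assms aval_ge_mat2_mult[of x 0 "mat_of (inverse g)" 1 "mat_of g - mat 1"]
    by (auto simp: level_iff integral_gl2_inverse_entry)
  ultimately show ?thesis using assms by (simp add: level_iff integral_gl2_inverse)
qed

lemma level_1 [simp]: "1 \<in> level x"
  using gl2_inverse_unique[of 1 "1 :: 'a gl2"] by (auto simp: level_def mat_of_1 mat2_all)

subsection \<open>Families of rational matrices\<close>

definition admissible :: "('k::{field,finite} place \<Rightarrow> 'k ratfun^2^2) \<Rightarrow> bool"
  where "admissible G \<longleftrightarrow> (\<forall>y. det (G y) \<noteq> 0) \<and> finite {y. \<not> gl2O y (G y)}"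

definition gl2_of :: "('k::{field,finite} place \<Rightarrow> 'k ratfun^2^2) \<Rightarrow> 'k gl2"
  where "gl2_of G = Abs_gl2 (\<chi> i j. adele_of (\<lambda>y. G y $ i $ j))"

lemma admissible_mult:
  assumes "admissible G" "admissible H"
  shows "admissible (\<lambda>y. G y ** H y)"
proof -
  have "{y. \<not> gl2O y (G y ** H y)} \<subseteq> {y. \<not> gl2O y (G y)} \<union> {y. \<not> gl2O y (H y)}"
    using gl2O_mult by blast
  then show ?thesis using assms finite_subset by (fastforce simp: admissible_def det_mul)
qed

lemma admissible_inverse:
  assumes "admissible G"
  shows "admissible (\<lambda>y. matrix_inv (G y))"
proof -
  have "{y. \<not> gl2O y (matrix_inv (G y))} \<subseteq> {y. \<not> gl2O y (G y)}" using gl2O_inverse by blast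
  then show ?thesis using assms finite_subset by (fastforce simp: admissible_def matrix_inv_field)
qed

lemma admissible_entry: "admissible G \<Longrightarrow> finite {y. \<not> val_ge y 0 (G y $ i $ j)}"
  unfolding admissible_def by (elim conjE, rule finite_subset[rotated], assumption) (auto simp: gl2O_def)

lemma comp_adele_of_mat:
  "admissible G \<Longrightarrow> comp ((\<chi> i j. adele_of (\<lambda>y. G y $ i $ j)) $ i $ j) y = emb y (G y $ i $ j)"
  by (simp add: comp_adele_of admissible_entry)

lemma adele_of_mat_mult:
  assumes "admissible G" "admissible H"
  shows "(\<chi> i j. adele_of (\<lambda>y. G y $ i $ j)) ** (\<chi> i j. adele_of (\<lambda>y. H y $ i $ j)) = (\<chi> i j. adele_of (\<lambda>y. (G y ** H y) $ i $ j))"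
proof (unfold vec_eq_iff, intro allI adele_eqI)
  fix i j y
  show "comp (((\<chi> i j. adele_of (\<lambda>y. G y $ i $ j)) ** (\<chi> i j. adele_of (\<lambda>y. H y $ i $ j))) $ i $ j) y =
    comp ((\<chi> i j. adele_of (\<lambda>y. (G y ** H y) $ i $ j)) $ i $ j) y"
    unfolding comp_adele_of_mat[OF admissible_mult[OF assms]]
    unfolding mat2_mult comp_add comp_mult comp_adele_of_mat[OF assms(1)] comp_adele_of_mat[OF assms(2)]
    by (simp add: emb_add emb_mult)
qed

lemma adele_of_mat_1: "(\<chi> i j. adele_of (\<lambda>y. (mat 1 :: 'k::{field,finite} ratfun^2^2) $ i $ j)) = mat 1"
  unfolding mat2_eq_iff by (auto intro!: adele_eqI simp: comp_adele_of comp_0 comp_1 emb_0 emb_1)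

lemma mat_of_gl2_of:
  assumes "admissible G"
  shows "mat_of (gl2_of G) = (\<chi> i j. adele_of (\<lambda>y. G y $ i $ j))"
proof -
  have inv: "G y ** matrix_inv (G y) = mat 1" "matrix_inv (G y) ** G y = mat 1" for y
    using assms by (auto simp: admissible_def matrix_inv_field)
  have "invertible (\<chi> i j. adele_of (\<lambda>y. G y $ i $ j))"
    unfolding invertible_def
    by (intro exI[of _ "\<chi> i j. adele_of (\<lambda>y. matrix_inv (G y) $ i $ j)"] conjI)
      (simp_all only: adele_of_mat_mult assms admissible_inverse inv adele_of_mat_1)
  then show ?thesis unfolding gl2_of_def by (simp add: Abs_gl2_inverse)
qed

lemma entry_gl2_of: "admissible G \<Longrightarrow> entry (gl2_of G) i j y = emb y (G y $ i $ j)"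
  by (simp add: mat_of_gl2_of comp_adele_of admissible_entry)

lemma gl2_of_mult: "admissible G \<Longrightarrow> admissible H \<Longrightarrow> gl2_of G * gl2_of H = gl2_of (\<lambda>y. G y ** H y)"
  by (rule gl2_eqI) (simp only: mat_of_mult mat_of_gl2_of adele_of_mat_mult admissible_mult)

lemma gl2_of_1: "gl2_of (\<lambda>_. mat 1) = 1"
proof -
  have "admissible (\<lambda>_ :: 'a place. mat 1)" by (simp add: admissible_def)
  then have "mat_of (gl2_of (\<lambda>_. mat 1)) = mat_of (1 :: 'a gl2)" by (simp only: mat_of_gl2_of adele_of_mat_1 mat_of_1)
  then show ?thesis by (simp only: mat_of_inject)
qed

lemma gl2_of_inverse:
  assumes "admissible G"
  shows "inverse (gl2_of G) = gl2_of (\<lambda>y. matrix_inv (G y))"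
proof (rule gl2_inverse_unique)
  have "(\<lambda>y. G y ** matrix_inv (G y)) = (\<lambda>y. mat 1)" using assms by (auto simp: admissible_def matrix_inv_field)
  then show "gl2_of G * gl2_of (\<lambda>y. matrix_inv (G y)) = 1"
    using gl2_of_mult[OF assms admissible_inverse[OF assms]] gl2_of_1 by simp
qed

lemma aval_ge_gl2_of: "admissible G \<Longrightarrow> aval_ge y N (mat_of (gl2_of G)$i$j) \<longleftrightarrow> val_ge y N (G y $ i $ j)"
  by (simp add: aval_ge_def entry_gl2_of)

lemma comp_det_gl2_of: "admissible G \<Longrightarrow> comp (det (mat_of (gl2_of G))) y = emb y (det (G y))"
  by (simp add: det_2 comp_diff comp_mult entry_gl2_of emb_diff emb_mult)

lemma aval_ge_det_gl2_of: "admissible G \<Longrightarrow> aval_ge y N (det (mat_of (gl2_of G))) \<longleftrightarrow> val_ge y N (det (G y))"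
  by (simp add: aval_ge_def comp_det_gl2_of)

lemma gl2_of_integral:
  assumes "admissible G"
  shows "gl2_of G \<in> integral_gl2 \<longleftrightarrow> (\<forall>y. gl2O y (G y))"
proof
  assume r: "\<forall>y. gl2O y (G y)"
  then have "val_ge y 0 (inverse (det (G y)))" for y by (simp add: gl2O_def val_ge_iff val_inverse)
  then show "gl2_of G \<in> integral_gl2"
    using r assms by (auto simp: integral_gl2_def aval_ge_gl2_of gl2O_def gl2_of_inverse aval_ge_det_gl2_of
        admissible_inverse matrix_inv_field)
next
  assume l: "gl2_of G \<in> integral_gl2"
  show "\<forall>y. gl2O y (G y)"
  proof
    fix y
    have d: "det (G y) \<noteq> 0" using assms by (simp add: admissible_def)
    have e: "val_ge y 0 (G y $ i $ j)" for i j using l assms by (auto simp: integral_gl2_def aval_ge_gl2_of)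
    then have "val_ge y 0 (det (G y))" by (auto simp: det_2 intro!: val_ge_diff val_ge_mult_left)
    moreover have "val_ge y 0 (inverse (det (G y)))"
      using l assms d by (auto simp: integral_gl2_def gl2_of_inverse aval_ge_det_gl2_of admissible_inverse
          matrix_inv_field(3)[OF d, symmetric])
    ultimately show "gl2O y (G y)" using d e by (simp add: gl2O_def val_ge_iff val_inverse)
  qed
qed

lemma gl2_of_level:
  assumes "admissible G"
  shows "gl2_of G \<in> level x \<longleftrightarrow> (\<forall>y. gl2O y (G y)) \<and> (\<forall>i j. val_ge x 1 (G x $ i $ j - mat 1 $ i $ j))"
proof -
  have "aval_ge x 1 (mat_of (gl2_of G)$i$j - mat 1$i$j) \<longleftrightarrow> val_ge x 1 (G x $ i $ j - mat 1 $ i $ j)" for i j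
  proof -
    have "comp ((mat 1 :: 'a adele^2^2)$i$j) x = emb x (mat 1 $ i $ j)"
      by (cases "i = j") (auto simp: mat_def comp_1 comp_0 emb_0 emb_1)
    then show ?thesis using assms by (simp add: aval_ge_def comp_diff entry_gl2_of emb_diff[symmetric])
  qed
  then show ?thesis using gl2_of_integral[OF assms] by (simp add: level_iff)
qed

section \<open>Approximation\<close>

lemma aval_ge_det_near_1:
  fixes E :: "'k::{field,finite} adele^2^2"
  assumes "\<And>i j. aval_ge y 1 ((E - mat 1)$i$j)"
  shows "aval_ge y 1 (det E - 1)"
proof -
  have e: "aval_ge y 1 (E$1$1 - 1)" "aval_ge y 1 (E$1$2)" "aval_ge y 1 (E$2$1)" "aval_ge y 1 (E$2$2 - 1)"
    using assms[of 1 1] assms[of 1 2] assms[of 2 1] assms[of 2 2] by simp_all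
  have "aval_ge y 0 (E$2$2 - 1 + 1)" using aval_ge_mono[OF e(4)] by (intro aval_ge_add) auto
  then have "aval_ge y 1 ((E$1$1 - 1) * E$2$2)" using aval_ge_mult_right[OF e(1)] by simp
  moreover have "aval_ge y 1 (E$1$2 * E$2$1)" using aval_ge_mult_right[OF e(2) aval_ge_mono[OF e(3)]] by simp
  ultimately have "aval_ge y 1 ((E$1$1 - 1) * E$2$2 + (E$2$2 - 1) - E$1$2 * E$2$1)"
    using e(4) by (metis aval_ge_add aval_ge_diff)
  then show ?thesis by (simp add: det_2 algebra_simps)
qed

text \<open>
  At each place one approximates \<open>g\<close> by a rational matrix to a precision that beats the
  denominators of the inverse of \<open>g\<close>.  The error then becomes a factor that is congruent to the
  identity at every place.
\<close>

lemma family_approximation: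
  fixes g :: "'k::{field,finite} gl2"
  obtains G k where "admissible G" "\<And>x. k \<in> level x" "g = gl2_of G * k"
proof -
  define B C where "B = mat_of g" and "C = mat_of (inverse g)"
  have CB: "C ** B = mat 1" by (simp add: B_def C_def mat_of_inverse)
  have "\<exists>N. (\<forall>i j. aval_ge y N (C$i$j)) \<and> ((\<forall>i j. aval_ge y 0 (C$i$j)) \<longrightarrow> N = 0)" for y
  proof (cases "\<forall>i j. aval_ge y 0 (C$i$j)")
    case False
    have "\<forall>i j. \<exists>N. aval_ge y N (C$i$j)" by (metis aval_ge_bounded)
    then obtain M where M: "\<And>i j. aval_ge y (M i j) (C$i$j)" by metis
    define N where "N = min (min (M 1 1) (M 1 2)) (min (M 2 1) (M 2 2))"
    have "\<forall>i j. aval_ge y N (C$i$j)" unfolding mat2_all N_def by (auto intro: aval_ge_mono[OF M])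
    then show ?thesis using False by blast
  qed blast
  then obtain N where N: "\<And>y i j. aval_ge y (N y) (C$i$j)"
    "\<And>y. (\<forall>i j. aval_ge y 0 (C$i$j)) \<Longrightarrow> N y = 0" by metis
  have "\<forall>i j y. \<exists>f. cval_ge y (1 - N y) (comp (B$i$j) y \<ominus>\<^bsub>local_field y\<^esub> emb y f)"
    by (metis local_approximation)
  then obtain F where F: "\<And>i j y. cval_ge y (1 - N y) (comp (B$i$j) y \<ominus>\<^bsub>local_field y\<^esub> emb y (F i j y))"
    by metis
  define G where "G y = (\<chi> i j. F i j y)" for y
  have G: "cval_ge y (1 - N y) (comp (B$i$j) y \<ominus>\<^bsub>local_field y\<^esub> emb y (G y$i$j))" for i j y
    using F by (simp add: G_def)
  \<comment> \<open>Outside the finitely many bad places both \<open>g\<close> and its inverse are integral.\<close>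
  define good where "good y \<longleftrightarrow> (\<forall>i j. aval_ge y 0 (B$i$j) \<and> aval_ge y 0 (C$i$j))" for y
  have "{y. \<not> good y} \<subseteq> (\<Union>i j. {y. \<not> aval_ge y 0 (B$i$j)} \<union> {y. \<not> aval_ge y 0 (C$i$j)})"
    by (auto simp: good_def)
  moreover have "finite (\<Union>i j. {y. \<not> aval_ge y 0 (B$i$j)} \<union> {y. \<not> aval_ge y 0 (C$i$j)})"
    by (intro finite_UN_I finite_UnI finite_not_aval_ge) auto
  ultimately have fin_good: "finite {y. \<not> good y}" by (rule finite_subset)
  have G_int: "val_ge y 0 (G y$i$j)" if y: "good y" for y i j
  proof -
    interpret L: cring "local_field y" by (rule local_field_cring)
    have "N y = 0" using N(2) y by (auto simp: good_def)
    then have "cval_ge y 1 (comp (B$i$j) y \<ominus>\<^bsub>local_field y\<^esub> emb y (G y$i$j))" using G[of y i j] by simp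
    then have "cval_ge y 0 (comp (B$i$j) y \<oplus>\<^bsub>local_field y\<^esub> (\<ominus>\<^bsub>local_field y\<^esub> (comp (B$i$j) y \<ominus>\<^bsub>local_field y\<^esub> emb y (G y$i$j))))"
      using y by (intro cval_ge_add cval_ge_minus) (auto simp: good_def aval_ge_def intro: cval_ge_mono)
    also have "comp (B$i$j) y \<oplus>\<^bsub>local_field y\<^esub> (\<ominus>\<^bsub>local_field y\<^esub> (comp (B$i$j) y \<ominus>\<^bsub>local_field y\<^esub> emb y (G y$i$j))) = emb y (G y$i$j)"
      by (simp add: L.minus_eq L.minus_add L.a_assoc[symmetric] L.r_neg)
    finally show ?thesis by simp
  qed
  have fin: "finite {y. \<not> val_ge y 0 (G y$i$j)}" for i j
    by (rule finite_subset[OF _ fin_good]) (auto dest: G_int)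
  define M where "M = (\<chi> i j. adele_of (\<lambda>y. G y $ i $ j))"
  have compM: "comp (M$i$j) y = emb y (G y$i$j)" for i j y
    using comp_adele_of[OF fin] by (simp add: M_def)
  have BM: "aval_ge y (1 - N y) ((B - M)$i$j)" for i j y
    using G by (simp add: aval_ge_def comp_diff compM)
  \<comment> \<open>The valuations of \<open>C\<close> and of the error \<open>B - M\<close> add up to at least \<open>1\<close>.\<close>
  have "C ** M - mat 1 = - (C ** (B - M))" by (simp add: mat2_mult_diff CB)
  moreover have "aval_ge y (N y + (1 - N y)) ((C ** (B - M))$i$j)" for i j y
    by (rule aval_ge_mat2_mult[OF N(1) BM])
  ultimately have CM: "aval_ge y 1 ((C ** M - mat 1)$i$j)" for i j y by simp
  have detCM: "aval_ge y 1 (det C * det M - 1)" for y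
    using aval_ge_det_near_1[OF CM] by (simp add: det_mul)
  have detM: "comp (det M) y = emb y (det (G y))" for y
    by (simp add: det_2 comp_diff comp_mult compM emb_diff emb_mult)
  have not1: "\<not> aval_ge y 1 (det C * det M)" for y
    using aval_ge_diff[OF _ detCM[of y], of "det C * det M"] by auto
  have G_det: "det (G y) \<noteq> 0" for y
  proof
    assume "det (G y) = 0"
    then have "aval_ge y (1 - K) (det M)" for K by (simp add: aval_ge_def detM)
    moreover obtain K where "aval_ge y K (det C)" by (rule aval_ge_bounded)
    ultimately have "aval_ge y (K + (1 - K)) (det C * det M)" by (intro aval_ge_mult)
    then show False using not1[of y] by simp
  qed
  have "gl2O y (G y)" if y: "good y" for y
  proof -
    have "val_ge y 0 (det (G y))"
      by (auto simp: det_2 intro!: val_ge_diff val_ge_mult_left G_int y)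
    moreover have "\<not> val_ge y 1 (det (G y))"
    proof
      assume "val_ge y 1 (det (G y))"
      then have "aval_ge y 1 (det M)" by (simp add: aval_ge_def detM)
      moreover have "aval_ge y 0 (det C)" using y by (intro aval_ge_det) (simp add: good_def)
      ultimately show False using not1[of y] aval_ge_mult_left by blast
    qed
    ultimately show ?thesis using G_int[OF y] G_det[of y] by (simp add: gl2O_def val_ge_iff)
  qed
  then have "{y. \<not> gl2O y (G y)} \<subseteq> {y. \<not> good y}" by blast
  then have admissible: "admissible G" using fin_good G_det finite_subset by (auto simp: admissible_def)
  define k where "k = inverse g * gl2_of G"
  have k: "mat_of k = C ** M" by (simp add: k_def mat_of_mult mat_of_gl2_of[OF admissible] C_def M_def)
  have "k \<in> level x" for x
    unfolding level_iff integral_gl2_def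
  proof (intro conjI CollectI allI)
    fix i j y
    have "aval_ge y 0 ((C ** M - mat 1)$i$j + mat 1 $ i $ j)"
      using aval_ge_mono[OF CM] by (intro aval_ge_add) (auto simp: mat_def)
    then show "aval_ge y 0 (mat_of k $ i $ j)" by (simp add: k)
  next
    fix y show "aval_ge y 0 (det (mat_of (inverse k)))"
      using right_inverse_entries(5)[OF mat_of_inverse(1)[of k]] detCM[of y]
      by (intro aval_ge_inverse_of_unit[of "det (mat_of k)"]) (auto simp: k det_mul)
  next
    fix i j show "aval_ge x 1 ((mat_of k - mat 1) $ i $ j)" using CM by (simp add: k)
  qed
  then have "inverse k \<in> level x" for x by (rule level_inverse)
  moreover have "g = gl2_of G * inverse k"
    by (simp add: k_def gl2_inverse_mult)
  ultimately show ?thesis using that admissible by blast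
qed

section \<open>Rational, local and central elements\<close>

lemma finite_val_support: "finite {y :: 'k::{field,finite} place. val y f \<noteq> 0}"
proof -
  interpret A: coordinate "Abs_place degree_valuation" "Fract [:0, 1:] (1 :: 'k poly)"
    by (rule coordinate_degree_valuation)
  show ?thesis by (rule A.finite_support)
qed

text \<open>
  The diagonal embedding of rational matrices, and the embedding at the single place \<open>x\<close>.
\<close>

definition dia :: "'k::{field,finite} ratfun^2^2 \<Rightarrow> 'k gl2"
  where "dia \<delta> = gl2_of (\<lambda>_. \<delta>)"

definition loc :: "'k::{field,finite} place \<Rightarrow> 'k ratfun^2^2 \<Rightarrow> 'k gl2"
  where "loc x r = gl2_of (\<lambda>y. if y = x then r else mat 1)"

lemma admissible_const:
  assumes "det \<delta> \<noteq> 0"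
  shows "admissible (\<lambda>_ :: 'k::{field,finite} place. \<delta>)"
proof -
  have "{y. \<not> gl2O y \<delta>} \<subseteq> (\<Union>i j. {y. val y (\<delta>$i$j) \<noteq> 0}) \<union> {y. val y (det \<delta>) \<noteq> 0}"
    using assms by (auto simp: gl2O_def val_ge_def)
  moreover have "finite ((\<Union>i j. {y. val y (\<delta>$i$j) \<noteq> 0}) \<union> {y. val y (det \<delta>) \<noteq> 0})"
    by (intro finite_UnI finite_UN_I finite_val_support) auto
  ultimately have "finite {y :: 'k place. \<not> gl2O y \<delta>}" by (rule finite_subset)
  then show ?thesis using assms by (simp add: admissible_def)
qed

lemma admissible_local:
  assumes "det r \<noteq> 0" "admissible G"
  shows "admissible (\<lambda>y. if y = x then r else G y)"
proof -
  have "{y. \<not> gl2O y (if y = x then r else G y)} \<subseteq> insert x {y. \<not> gl2O y (G y)}" by auto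
  moreover have "finite (insert x {y. \<not> gl2O y (G y)})" using assms(2) by (simp add: admissible_def)
  ultimately have "finite {y. \<not> gl2O y (if y = x then r else G y)}" by (rule finite_subset)
  then show ?thesis using assms by (simp add: admissible_def)
qed

lemma admissible_1: "admissible (\<lambda>_ :: 'k::{field,finite} place. mat 1)"
  by (rule admissible_const) simp

lemmas admissible_loc = admissible_local[OF _ admissible_1]

lemma dia_mult: "det \<delta> \<noteq> 0 \<Longrightarrow> det \<gamma> \<noteq> 0 \<Longrightarrow> dia \<delta> * dia \<gamma> = dia (\<delta> ** \<gamma>)"
  by (simp add: dia_def gl2_of_mult admissible_const)

lemma loc_mult: "det r \<noteq> 0 \<Longrightarrow> det t \<noteq> 0 \<Longrightarrow> loc x r * loc x t = loc x (r ** t)"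
  by (simp add: loc_def gl2_of_mult admissible_loc if_distrib if_distribR cong: if_cong)

lemma dia_1: "dia (mat 1) = 1"
  by (simp add: dia_def gl2_of_1)

lemma loc_1: "loc x (mat 1) = 1"
  by (simp add: loc_def gl2_of_1 cong: if_cong)

lemma dia_inverse: "det \<delta> \<noteq> 0 \<Longrightarrow> inverse (dia \<delta>) = dia (matrix_inv \<delta>)"
  by (simp add: dia_def gl2_of_inverse admissible_const)

lemma loc_level:
  assumes "det r \<noteq> 0"
  shows "loc x r \<in> level x \<longleftrightarrow> gl2O x r \<and> (\<forall>i j. val_ge x 1 (r$i$j - mat 1$i$j))"
  unfolding loc_def gl2_of_level[OF admissible_loc[OF assms]] by auto

lemma loc_integral:
  assumes "gl2O x r"
  shows "loc x r \<in> integral_gl2"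
proof -
  have "det r \<noteq> 0" using assms by (simp add: gl2O_def)
  then show ?thesis using assms unfolding loc_def by (subst gl2_of_integral[OF admissible_loc]) auto
qed

lemma gl2_rational_eq: "gl2_rational = dia ` {\<delta>. det \<delta> \<noteq> 0}"
proof (intro equalityI subsetI)
  fix g :: "'a gl2" assume "g \<in> gl2_rational"
  then obtain \<gamma> :: "'a ratfun^2^2" where \<gamma>: "invertible \<gamma>" "\<And>i j y. entry g i j y = emb y (\<gamma>$i$j)"
    by (auto simp: gl2_rational_def)
  then have d: "det \<gamma> \<noteq> 0" by (simp add: invertible_det_nz)
  have "g = dia \<gamma>"
    by (rule gl2_eqI) (simp add: \<gamma> dia_def entry_gl2_of admissible_const[OF d])
  then show "g \<in> dia ` {\<delta>. det \<delta> \<noteq> 0}" using d by blast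
next
  fix g :: "'a gl2" assume "g \<in> dia ` {\<delta>. det \<delta> \<noteq> 0}"
  then obtain \<delta> where "g = dia \<delta>" "det \<delta> \<noteq> 0" by blast
  then show "g \<in> gl2_rational"
    by (auto simp: gl2_rational_def invertible_det_nz dia_def entry_gl2_of admissible_const intro!: exI[of _ \<delta>])
qed

lemma gl2_at_eq:
  assumes "det r \<noteq> 0"
  shows "gl2_at x (\<chi> i j. emb x (r$i$j)) = loc x r"
proof -
  have "adele_upd (mat 1 $ i $ j) x (emb x (r$i$j)) = adele_of (\<lambda>y. (if y = x then r else mat 1)$i$j)" for i j
  proof (rule adele_eqI)
    fix y
    have "comp (adele_of (\<lambda>y. (if y = x then r else mat 1)$i$j)) y = emb y ((if y = x then r else mat 1)$i$j)"
      by (rule comp_adele_of) (use admissible_entry[OF admissible_loc[OF assms]] in simp)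
    moreover have "comp (mat 1 $ i $ j) y = emb y (mat 1 $ i $ j)"
      by (cases "i = j") (auto simp: mat_def comp_1 comp_0 emb_0 emb_1)
    ultimately show "comp (adele_upd (mat 1 $ i $ j) x (emb x (r$i$j))) y = comp (adele_of (\<lambda>y. (if y = x then r else mat 1)$i$j)) y"
      by (simp add: adele_upd.rep_eq)
  qed
  then show ?thesis by (simp add: gl2_at_def loc_def gl2_of_def)
qed

definition scal :: "'a::comm_ring_1 \<Rightarrow> 'a^2^2"
  where "scal c = mat2 c 0 0 c"

lemma scal_commute: "scal c ** A = A ** scal c"
  by (simp add: scal_def mat2_eq_iff mat2_mult mult.commute)

lemma scal_mult: "scal a ** scal b = scal (a * b)"
  by (simp add: scal_def mat2_mult_mat2)

lemma det_scal [simp]: "det (scal c) = c * c"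
  by (simp add: scal_def)

lemma scal_1 [simp]: "scal 1 = mat 1"
  by (simp add: scal_def mat2_one_eq)

lemma scalar_central:
  assumes "mat_of z = scal a"
  shows "z \<in> gl2_center"
  using assms by (auto simp: gl2_center_def mat_of_inject[symmetric] mat_of_mult scal_commute)

lemma mat_of_scalar_family:
  assumes "admissible (\<lambda>y. scal (F y))"
  shows "mat_of (gl2_of (\<lambda>y. scal (F y))) = scal (adele_of F)"
proof -
  have "adele_of (\<lambda>_ :: 'a place. 0) = 0" by (rule adele_eqI) (simp add: comp_adele_of comp_0 emb_0)
  then show ?thesis unfolding mat_of_gl2_of[OF assms] by (simp add: scal_def mat2_eq_iff)
qed

lemma loc_scal_central:
  assumes "c \<noteq> 0"
  shows "loc x (scal c) \<in> gl2_center"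
proof -
  have e: "(\<lambda>y. if y = x then scal c else mat 1) = (\<lambda>y. scal (if y = x then c else 1))" by auto
  have "admissible (\<lambda>y. scal (if y = x then c else 1))" using admissible_loc[of "scal c" x] assms by (simp add: e)
  from mat_of_scalar_family[OF this] show ?thesis unfolding loc_def e by (rule scalar_central)
qed

lemma center_inverse: "z \<in> gl2_center \<Longrightarrow> inverse z \<in> gl2_center"
  by (simp add: gl2_center_def) (metis gl2_inverse_cancel mult.assoc gl2_inverse mult.right_neutral)

text \<open>Commuting with the two elementary unipotent matrices is enough.\<close>

lemma center_is_scalar:
  fixes z :: "'k::{field,finite} gl2"
  assumes "z \<in> gl2_center"
  obtains a where "mat_of z = scal a"
proof -
  have comm: "mat_of z ** mat_of g = mat_of g ** mat_of z" for g
    using assms by (simp add: gl2_center_def mat_of_mult[symmetric])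
  have inv: "invertible (mat2 1 1 0 1 :: 'k adele^2^2)" "invertible (mat2 1 0 1 1 :: 'k adele^2^2)"
    unfolding invertible_def
    by (intro exI[of _ "mat2 1 (-1) 0 1"], simp add: mat2_mult_mat2 mat2_one_eq,
        intro exI[of _ "mat2 1 0 (-1) 1"], simp add: mat2_mult_mat2 mat2_one_eq)
  have "mat_of z = scal (mat_of z$1$1)"
    using comm[of "Abs_gl2 (mat2 1 1 0 1)"] comm[of "Abs_gl2 (mat2 1 0 1 1)"]
    by (simp add: Abs_gl2_inverse inv mat2_eq_iff mat2_mult scal_def)
  then show ?thesis using that by blast
qed

text \<open>
  The upper left entries of an approximating family for a scalar matrix approximate the scalar.
\<close>

lemma idele_approximation:
  fixes z :: "'k::{field,finite} gl2"
  assumes "mat_of (inverse z) = scal a'"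
  obtains F where "\<And>y. F y \<noteq> 0" "finite {y. val y (F y) \<noteq> 0}" "\<And>y. aval_ge y 1 (a' * adele_of F - 1)"
proof -
  obtain G k where G: "admissible G" "\<And>x. k \<in> level x" "z = gl2_of G * k" using family_approximation by blast
  define F where "F = (\<lambda>y. G y $ 1 $ 1)"
  have fin: "finite {y. \<not> val_ge y 0 (F y)}" using admissible_entry[OF G(1), of 1 1] by (simp add: F_def)
  have "inverse k = inverse z * gl2_of G" by (simp add: G(3) gl2_inverse_mult mult.assoc gl2_inverse)
  then have "mat_of (inverse k) $ 1 $ 1 = a' * adele_of F"
    by (simp add: mat_of_mult assms mat_of_gl2_of[OF G(1)] mat2_mult scal_def F_def)
  then have near: "aval_ge y 1 (a' * adele_of F - 1)" for y
    using level_near[OF level_inverse[OF G(2)], of y 1 1] by simp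
  have not1: "\<not> aval_ge y 1 (a' * adele_of F)" for y
    using aval_ge_diff[OF _ near[of y], of "a' * adele_of F"] by auto
  have nz: "F y \<noteq> 0" for y
  proof
    assume "F y = 0"
    moreover obtain N where "aval_ge y N a'" by (rule aval_ge_bounded)
    ultimately have "aval_ge y (N + (1 - N)) (a' * adele_of F)" by (intro aval_ge_mult) (simp_all add: aval_ge_adele_of fin)
    then show False using not1[of y] by simp
  qed
  have "val y (F y) = 0" if y: "val_ge y 0 (F y)" "aval_ge y 0 a'" for y
  proof -
    have "\<not> val_ge y 1 (F y)"
      using not1[of y] aval_ge_mult_left[of y a' 1 "adele_of F"] y by (auto simp: aval_ge_adele_of fin)
    then show ?thesis using y nz[of y] by (simp add: val_ge_iff)
  qed
  then have "{y. val y (F y) \<noteq> 0} \<subseteq> {y. \<not> val_ge y 0 (F y)} \<union> {y. \<not> aval_ge y 0 a'}" by blast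
  moreover have "finite ({y. \<not> val_ge y 0 (F y)} \<union> {y. \<not> aval_ge y 0 a'})"
    using fin by (simp add: finite_not_aval_ge)
  ultimately have "finite {y. val y (F y) \<noteq> 0}" by (rule finite_subset)
  then show ?thesis using that nz near by blast
qed

context coordinate
begin

text \<open>
  The idele class group of the projective line is generated by the powers of \<open>s\<close> at \<open>x\<close> and the
  image of the units: the prescribed valuations away from \<open>x\<close> are those of a product of powers of
  prime polynomials, and the remaining unit at \<open>x\<close> is adjusted by a constant, since the residue
  field at \<open>x\<close> consists of constants.
\<close>

lemma center_decomposition:
  assumes "z \<in> gl2_center"
  obtains \<phi> m u where "\<phi> \<noteq> 0" "u \<in> level x" "z = dia (scal \<phi>) * loc x (scal (s powi m)) * u"
proof -
  obtain a' where a': "mat_of (inverse z) = scal a'"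
    using center_is_scalar[OF center_inverse[OF assms]] by blast
  obtain F where F: "\<And>y. F y \<noteq> 0" "finite {y. val y (F y) \<noteq> 0}" "\<And>y. aval_ge y 1 (a' * adele_of F - 1)"
    using idele_approximation[OF a'] by metis
  define S where "S = {y. val y (F y) \<noteq> 0} - {x}"
  \<comment> \<open>\<open>\<phi>0\<close> has the valuation of the idele at every place other than \<open>x\<close>.\<close>
  define \<phi>0 where "\<phi>0 = (\<Prod>y\<in>S. ev s (prime_of y) powi val y (F y))"
  have S: "finite S" "x \<notin> S" using F(2) by (auto simp: S_def)
  have nz: "ev s (prime_of y) \<noteq> 0" if "y \<in> S" for y using that S prime_of_props(1)[of y] by (cases "y = x") auto
  have prod: "(\<Prod>y\<in>T. ev s (prime_of y) powi val y (F y)) \<noteq> 0 \<and>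
      val z (\<Prod>y\<in>T. ev s (prime_of y) powi val y (F y)) = (if z \<in> T then val z (F z) else 0)"
    if "z \<noteq> x" "T \<subseteq> S" for z T
  proof -
    have "finite T" using that S finite_subset by blast
    then show ?thesis using that(2)
    proof (induction T)
      case (insert y T)
      have y: "y \<noteq> x" using insert S by auto
      have "val z (ev s (prime_of y) powi val y (F y)) = (if z = y then val z (F z) else 0)"
        using that(1) y insert nz val_prime_of_other[OF y that(1)] by (auto simp: val_powi)
      then show ?case using insert nz by (auto simp: val_mult)
    qed simp
  qed
  have \<phi>0: "\<phi>0 \<noteq> 0" using S nz by (simp add: \<phi>0_def)
  have val_\<phi>0: "val y \<phi>0 = val y (F y)" if "y \<noteq> x" for y
    using prod[OF that, of S] that by (auto simp: \<phi>0_def S_def)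
  define m where "m = - val x (F x / \<phi>0)"
  have sm: "s powi m \<noteq> 0" by simp
  define e where "e = F x / \<phi>0 / s powi m"
  have vm: "val x (s powi m) = - m" by (simp add: val_powi val_s)
  have "val x e = val x (F x / \<phi>0) - val x (s powi m)"
    unfolding e_def by (rule val_divide) (use F(1) \<phi>0 sm in auto)
  then have e: "e \<noteq> 0" "val x e = 0"
    unfolding vm using F(1)[of x] \<phi>0 by (simp_all add: e_def m_def)
  obtain c where c: "val_ge x 1 (e - const_rat c)"
    using residue_at_pole[of e] e by (auto simp: val_ge_iff)
  have c0: "c \<noteq> 0" using c e by (auto simp: val_ge_iff)
  define \<phi> where "\<phi> = \<phi>0 * const_rat c"
  have \<phi>: "\<phi> \<noteq> 0" using \<phi>0 c0 by (simp add: \<phi>_def)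
  have val_\<phi>: "val y \<phi> = val y (F y)" if "y \<noteq> x" for y
    using val_\<phi>0[OF that] \<phi>0 c0 by (simp add: \<phi>_def val_mult val_const)
  \<comment> \<open>\<open>H\<close> is the main part and \<open>R\<close> the unit part of the approximating family \<open>F\<close>.\<close>
  define H where "H y = (if y = x then \<phi> * s powi m else \<phi>)" for y
  define R where "R y = F y / H y" for y
  have H0: "H y \<noteq> 0" for y using \<phi> by (simp add: H_def)
  have R: "R y \<noteq> 0" "val y (R y) = 0" for y
  proof -
    show "R y \<noteq> 0" using F(1) H0 by (simp add: R_def)
    show "val y (R y) = 0"
    proof (cases "y = x")
      case True
      have "R x = e / const_rat c" using \<phi>0 c0 by (simp add: R_def H_def e_def \<phi>_def field_simps)
      then show ?thesis using True e c0 by (simp add: val_divide val_const)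
    next
      case False
      then show ?thesis using F(1) \<phi> val_\<phi>[OF False] by (simp add: R_def H_def val_divide)
    qed
  qed
  have R1: "val_ge x 1 (R x - 1)"
  proof -
    have "R x = e * inverse (const_rat c)" using \<phi>0 c0 by (simp add: R_def H_def e_def \<phi>_def field_simps)
    then have "R x - 1 = (e - const_rat c) * inverse (const_rat c)" using c0 by (simp add: left_diff_distrib)
    moreover have "val_ge x 0 (inverse (const_rat c))" using c0 by (simp add: val_ge_iff val_inverse val_const)
    ultimately show ?thesis using c by (simp add: val_ge_mult_right)
  qed
  have gR: "gl2O y (scal (R y))" for y
    using R by (auto simp: gl2O_def mat2_all scal_def val_ge_iff val_mult)
  have admR: "admissible (\<lambda>y. scal (R y))" using gR R by (simp add: admissible_def)
  have admH: "admissible (\<lambda>y. scal (H y))" 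
  proof -
    have "(\<lambda>y. scal (H y)) = (\<lambda>y. if y = x then scal (\<phi> * s powi m) else scal \<phi>)" by (auto simp: H_def)
    then show ?thesis using \<phi> by (auto intro!: admissible_local admissible_const)
  qed
  have HR: "scal (H y) ** scal (R y) = scal (F y)" for y using H0 by (simp add: scal_mult R_def)
  have admF: "admissible (\<lambda>y. scal (F y))" using admissible_mult[OF admH admR] by (simp add: HR)
  have Hd: "gl2_of (\<lambda>y. scal (H y)) = dia (scal \<phi>) * loc x (scal (s powi m))"
    using \<phi> by (auto simp: dia_def loc_def gl2_of_mult admissible_const admissible_loc H_def scal_mult intro!: arg_cong[of _ _ gl2_of])
  have FH: "gl2_of (\<lambda>y. scal (F y)) = gl2_of (\<lambda>y. scal (H y)) * gl2_of (\<lambda>y. scal (R y))"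
    by (simp add: gl2_of_mult[OF admH admR] HR)
  have Rl: "gl2_of (\<lambda>y. scal (R y)) \<in> level x"
    unfolding gl2_of_level[OF admR] mat2_all using gR R1 by (simp add: scal_def)
  define k where "k = inverse z * gl2_of (\<lambda>y. scal (F y))"
  have k: "mat_of k = scal (a' * adele_of F)"
    by (simp add: k_def mat_of_mult a' mat_of_scalar_family[OF admF] scal_mult)
  have near: "aval_ge y 1 ((mat_of k - mat 1)$i$j)" for i j y
  proof -
    have "\<forall>i j. aval_ge y 1 ((mat_of k - mat 1)$i$j)"
      unfolding mat2_all using F(3)[of y] by (simp add: k scal_def)
    then show ?thesis by blast
  qed
  have "k \<in> level x"
    unfolding level_iff integral_gl2_def
  proof (intro conjI CollectI allI near)
    fix i j y
    have "aval_ge y 0 ((mat_of k - mat 1)$i$j + mat 1 $ i $ j)"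
      using aval_ge_mono[OF near] by (intro aval_ge_add) (auto simp: mat_def)
    then show "aval_ge y 0 (mat_of k $ i $ j)" by simp
  next
    fix y show "aval_ge y 0 (det (mat_of (inverse k)))"
      using right_inverse_entries(5)[OF mat_of_inverse(1)[of k]] aval_ge_det_near_1[OF near]
      by (intro aval_ge_inverse_of_unit[of "det (mat_of k)"]) auto
  qed
  then have "gl2_of (\<lambda>y. scal (R y)) * inverse k \<in> level x" using Rl by (simp add: level_mult level_inverse)
  moreover have "z = dia (scal \<phi>) * loc x (scal (s powi m)) * (gl2_of (\<lambda>y. scal (R y)) * inverse k)"
    unfolding Hd[symmetric] mult.assoc[symmetric] FH[symmetric] by (simp add: k_def gl2_inverse_mult)
  ultimately show ?thesis using that \<phi> by blast
qed

end

section \<open>Representatives for the double cosets\<close>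

lemma gl2O_mat2: "gl2O y (mat2 a b c d) \<longleftrightarrow> val_ge y 0 a \<and> val_ge y 0 b \<and> val_ge y 0 c \<and> val_ge y 0 d \<and>
    a * d - b * c \<noteq> 0 \<and> val y (a * d - b * c) = 0"
  by (simp add: gl2O_def mat2_all)

lemma gl2O_det: "gl2O y A \<Longrightarrow> det A \<noteq> 0"
  by (simp add: gl2O_def)

text \<open>The entry of larger valuation in the bottom row is a multiple of the other one.\<close>

lemma iwasawa:
  fixes r :: "'k::{field,finite} ratfun^2^2"
  assumes "det r \<noteq> 0"
  obtains k where "gl2O y k" "(r ** k)$2$1 = 0"
proof -
  define c d where "c = r$2$1" and "d = r$2$2"
  have cd: "c \<noteq> 0 \<or> d \<noteq> 0" using assms by (auto simp: det_2 c_def d_def)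
  consider "c = 0" | "c \<noteq> 0" "d \<noteq> 0" "val y d \<le> val y c" | "c \<noteq> 0" "d \<noteq> 0 \<Longrightarrow> val y c \<le> val y d"
    by (cases "c = 0"; cases "val y d \<le> val y c"; cases "d = 0"; force)
  then show ?thesis
  proof cases
    case 1
    then show ?thesis using that[of "mat 1"] by (simp add: c_def)
  next
    case 2
    then have "gl2O y (mat2 1 0 (- c / d) 1)" by (simp add: gl2O_mat2 val_ge_iff val_divide)
    moreover have "(r ** mat2 1 0 (- c / d) 1)$2$1 = c + d * (- c / d)" by (simp add: mat2_mult c_def d_def)
    ultimately show ?thesis using that 2 by simp
  next
    case 3
    have "val_ge y 0 (d / c)" using 3 by (cases "d = 0") (auto simp: val_ge_iff val_divide)
    then have "gl2O y (mat2 (- d / c) 1 1 0)" by (simp add: gl2O_mat2)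
    moreover have "(r ** mat2 (- d / c) 1 1 0)$2$1 = c * (- d / c) + d" by (simp add: mat2_mult c_def d_def)
    ultimately show ?thesis using that 3 by simp
  qed
qed

definition const_mat :: "'k::{field,finite}^2^2 \<Rightarrow> 'k ratfun^2^2"
  where "const_mat K = (\<chi> i j. const_rat (K$i$j))"

lemma const_mat_entry [simp]: "const_mat K $ i $ j = const_rat (K$i$j)"
  by (simp add: const_mat_def)

lemma const_mat_mult: "const_mat (K ** L) = const_mat K ** const_mat L"
  by (simp add: mat2_eq_iff mat2_mult const_rat_add const_rat_mult)

lemma det_const_mat: "det (const_mat K) = const_rat (det K)"
  by (simp add: det_2 const_rat_diff const_rat_mult)

lemma const_mat_1: "const_mat (mat 1) = mat 1"
  by (simp add: mat2_eq_iff)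

lemma const_mat_mat2: "const_mat (mat2 a b c d) = mat2 (const_rat a) (const_rat b) (const_rat c) (const_rat d)"
  by (simp add: mat2_eq_iff)

lemma gl2O_const_mat: "det K \<noteq> 0 \<Longrightarrow> gl2O y (const_mat K)"
  by (simp add: gl2O_def det_const_mat val_const)

context coordinate
begin

text \<open>
  \<open>GL\<^sub>2\<close> of the ring of polynomials in \<open>s\<close>, described by local conditions.
\<close>

definition regular :: "'k ratfun^2^2 \<Rightarrow> bool"
  where "regular \<gamma> \<longleftrightarrow> det \<gamma> \<noteq> 0 \<and> (\<forall>y. y \<noteq> x \<longrightarrow> gl2O y \<gamma>)"

lemma regular_mult: "regular \<gamma> \<Longrightarrow> regular \<delta> \<Longrightarrow> regular (\<gamma> ** \<delta>)"
  by (simp add: regular_def det_mul gl2O_mult)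

lemma regular_inverse: "regular \<gamma> \<Longrightarrow> regular (matrix_inv \<gamma>)"
  by (simp add: regular_def matrix_inv_field gl2O_inverse)

lemma regular_const_mat: "det K \<noteq> 0 \<Longrightarrow> regular (const_mat K)"
  by (simp add: regular_def gl2O_const_mat det_const_mat)

lemma regular_unipotent: "regular (mat2 1 (ev s P) 0 1)"
  by (simp add: regular_def gl2O_mat2 val_ge_ev')

text \<open>
  By the Iwasawa decomposition at \<open>y\<close> one may take \<open>r\<close> upper triangular.  Its off-diagonal entry is
  approximated by a function without further poles away from \<open>x\<close>, so the resulting upper
  triangular \<open>\<gamma>\<close> has determinant a power of \<open>prime_of y\<close> and spoils no place other than \<open>x\<close>.
\<close>

lemma make_integral_at:
  assumes "y \<noteq> x" "det r \<noteq> 0"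
  obtains \<gamma> where "det \<gamma> \<noteq> 0" "gl2O y (\<gamma> ** r)" "\<And>z. z \<noteq> x \<Longrightarrow> z \<noteq> y \<Longrightarrow> gl2O z \<gamma>"
proof -
  obtain k where k: "gl2O y k" "(r ** k)$2$1 = 0" using iwasawa[OF assms(2)] by blast
  define a b d where "a = (r ** k)$1$1" and "b = (r ** k)$1$2" and "d = (r ** k)$2$2"
  have rk: "r ** k = mat2 a b 0 d" using k by (simp add: mat2_eq_iff a_def b_def d_def)
  have "det (r ** k) \<noteq> 0" using assms gl2O_det[OF k(1)] by (simp add: det_mul)
  then have ad: "a \<noteq> 0" "d \<noteq> 0" by (auto simp: rk)
  define p where "p = ev s (prime_of y)"
  have p: "p \<noteq> 0" "val y p = 1" using prime_of_props(1) assms by (auto simp: p_def)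
  have pz: "val z p = 0" if "z \<noteq> x" "z \<noteq> y" for z
    using val_prime_of_other[OF assms(1) that(1)] that by (simp add: p_def)
  define i j where "i = val y a" and "j = val y d"
  obtain b' where b': "\<And>z. z \<noteq> x \<Longrightarrow> z \<noteq> y \<Longrightarrow> val_ge z 0 b'" "val_ge y i (b * p powi j / d - b')"
    using strong_approximation[OF assms(1)] by metis
  define \<gamma> where "\<gamma> = mat2 (p powi (- i)) (- b' * p powi (- i) * p powi (- j)) 0 (p powi (- j))"
  have pn: "p powi n \<noteq> 0" for n using p by simp
  have det\<gamma>: "det \<gamma> = p powi (- i) * p powi (- j)" by (simp add: \<gamma>_def)
  have "gl2O y (\<gamma> ** (r ** k))"
  proof -
    have "\<gamma> ** (r ** k) = mat2 (p powi (- i) * a) (p powi (- i) * (p powi (- j) * d) * (b * p powi j / d - b')) 0 (p powi (- j) * d)"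
      using ad p by (simp add: rk \<gamma>_def mat2_mult_mat2 mat2_eq_iff power_int_minus field_simps)
    moreover have u: "val y (p powi (- i) * a) = 0" "val y (p powi (- j) * d) = 0"
      using p ad by (simp_all add: val_mult val_powi i_def j_def)
    moreover have "val_ge y 0 (p powi (- i) * (p powi (- j) * d) * (b * p powi j / d - b'))"
    proof -
      have "val_ge y (- i) (p powi (- i) * (p powi (- j) * d))"
        using p ad u(2) by (simp add: val_ge_iff val_mult val_powi)
      from val_ge_mult[OF this b'(2)] show ?thesis by simp
    qed
    ultimately show ?thesis using p ad by (simp add: gl2O_mat2 val_ge_iff val_mult)
  qed
  then have "gl2O y (\<gamma> ** (r ** k) ** matrix_inv k)" by (rule gl2O_mult[OF _ gl2O_inverse[OF k(1)]])
  moreover have "\<gamma> ** (r ** k) ** matrix_inv k = \<gamma> ** r"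
    using matrix_inv_field(1)[OF gl2O_det[OF k(1)]] by (metis matrix_mul_assoc matrix_mul_rid)
  moreover have "gl2O z \<gamma>" if "z \<noteq> x" "z \<noteq> y" for z
  proof -
    have "val z (p powi n) = 0" for n using p pz[OF that] by (simp add: val_powi)
    then show ?thesis using p b'(1)[OF that] unfolding \<gamma>_def gl2O_mat2
      by (auto simp: val_ge_iff val_mult intro!: val_ge_mult_right)
  qed
  ultimately show ?thesis using that[of \<gamma>] det\<gamma> p by simp
qed

lemma make_integral_away:
  assumes "admissible G"
  shows "\<exists>\<delta>. det \<delta> \<noteq> 0 \<and> (\<forall>y. y \<noteq> x \<longrightarrow> gl2O y (\<delta> ** G y))"
  using assms
proof (induction "card {y. y \<noteq> x \<and> \<not> gl2O y (G y)}" arbitrary: G rule: less_induct)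
  case less
  let ?bad = "\<lambda>G. {y. y \<noteq> x \<and> \<not> gl2O y (G y)}"
  have fin: "finite (?bad G)"
    using less.prems by (auto simp: admissible_def elim: finite_subset[rotated])
  show ?case
  proof (cases "?bad G = {}")
    case True
    then show ?thesis by (intro exI[of _ "mat 1"]) auto
  next
    case False
    then obtain y where y: "y \<noteq> x" "\<not> gl2O y (G y)" by blast
    have "det (G y) \<noteq> 0" using less.prems by (simp add: admissible_def)
    then obtain \<gamma> where \<gamma>: "det \<gamma> \<noteq> 0" "gl2O y (\<gamma> ** G y)" "\<And>z. z \<noteq> x \<Longrightarrow> z \<noteq> y \<Longrightarrow> gl2O z \<gamma>"
      using make_integral_at[OF y(1)] by metis
    have "?bad (\<lambda>z. \<gamma> ** G z) \<subset> ?bad G"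
      using y \<gamma> gl2O_mult by blast
    then have "card (?bad (\<lambda>z. \<gamma> ** G z)) < card (?bad G)" using fin by (rule psubset_card_mono[rotated])
    moreover have "admissible (\<lambda>z. \<gamma> ** G z)" using admissible_mult[OF admissible_const[OF \<gamma>(1)] less.prems] by simp
    ultimately obtain \<delta> where "det \<delta> \<noteq> 0" "\<forall>y. y \<noteq> x \<longrightarrow> gl2O y (\<delta> ** (\<gamma> ** G y))"
      using less.hyps[of "\<lambda>z. \<gamma> ** G z"] by blast
    then show ?thesis using \<gamma>(1) by (intro exI[of _ "\<delta> ** \<gamma>"]) (simp add: det_mul matrix_mul_assoc)
  qed
qed

text \<open>
  Strong approximation makes the components away from \<open>x\<close> integral, so that they are absorbed by
  the congruence subgroup.
\<close>

lemma global_local_decomposition: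
  obtains \<delta> r k where "det \<delta> \<noteq> 0" "det r \<noteq> 0" "k \<in> level x" "g = dia \<delta> * loc x r * k"
proof -
  obtain G k where G: "admissible G" "k \<in> level x" "g = gl2_of G * k" using family_approximation by blast
  obtain \<delta> where \<delta>: "det \<delta> \<noteq> 0" "\<And>y. y \<noteq> x \<Longrightarrow> gl2O y (\<delta> ** G y)" using make_integral_away[OF G(1)] by blast
  have Gd: "det (G y) \<noteq> 0" for y using G by (simp add: admissible_def)
  define r where "r = \<delta> ** G x"
  have r: "det r \<noteq> 0" using \<delta> Gd by (simp add: r_def det_mul)
  define U where "U y = (if y = x then mat 1 else \<delta> ** G y)" for y
  have gU: "gl2O y (U y)" for y using \<delta> by (simp add: U_def)
  then have admU: "admissible U" by (simp add: admissible_def gl2O_det[OF gU])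
  have "gl2_of U \<in> level x" using gU by (simp add: gl2_of_level[OF admU]) (simp add: U_def)
  then have "gl2_of U * k \<in> level x" using G level_mult by blast
  moreover have "g = dia (matrix_inv \<delta>) * loc x r * (gl2_of U * k)"
  proof -
    have i: "matrix_inv \<delta> ** (\<delta> ** A) = A" for A
      using matrix_inv_field(2)[OF \<delta>(1)] by (simp add: matrix_mul_assoc)
    have d: "det (matrix_inv \<delta>) \<noteq> 0" using \<delta> by (simp add: matrix_inv_field)
    have "loc x r * gl2_of U = gl2_of (\<lambda>y. \<delta> ** G y)"
      unfolding loc_def gl2_of_mult[OF admissible_loc[OF r] admU] by (rule arg_cong[of _ _ gl2_of]) (auto simp: U_def r_def)
    moreover have "dia (matrix_inv \<delta>) * gl2_of (\<lambda>y. \<delta> ** G y) = gl2_of G"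
      unfolding dia_def by (subst gl2_of_mult[OF admissible_const[OF d] admissible_mult[OF admissible_const[OF \<delta>(1)] G(1)]]) (simp add: i)
    ultimately have "dia (matrix_inv \<delta>) * (loc x r * gl2_of U) = gl2_of G" by simp
    then show ?thesis using G(3) by (metis mult.assoc)
  qed
  moreover have "det (matrix_inv \<delta>) \<noteq> 0" using \<delta> by (simp add: matrix_inv_field)
  ultimately show ?thesis using that r by blast
qed

text \<open>
  A regular matrix at \<open>x\<close> differs from the diagonally embedded one by its components away from
  \<open>x\<close>, which are integral and commute with everything at \<open>x\<close>.
\<close>

lemma loc_regular:
  assumes "regular \<gamma>" "det t \<noteq> 0"
  obtains u where "u \<in> level x" "loc x (\<gamma> ** t) = dia \<gamma> * loc x t * u"
proof -
  define U where "U y = (if y = x then mat 1 else matrix_inv \<gamma>)" for y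
  have d: "det \<gamma> \<noteq> 0" using assms by (simp add: regular_def)
  have gU: "gl2O y (U y)" for y using assms by (simp add: U_def regular_def gl2O_inverse)
  then have admU: "admissible U" by (simp add: admissible_def gl2O_det[OF gU])
  have "gl2_of U \<in> level x" using gU by (simp add: gl2_of_level[OF admU]) (simp add: U_def)
  moreover have "dia \<gamma> * loc x t * gl2_of U = loc x (\<gamma> ** t)"
    unfolding dia_def loc_def gl2_of_mult[OF admissible_const[OF d] admissible_loc[OF assms(2)]]
      gl2_of_mult[OF admissible_mult[OF admissible_const[OF d] admissible_loc[OF assms(2)]] admU]
    by (rule arg_cong[of _ _ gl2_of]) (auto simp: U_def matrix_inv_field[OF d])
  ultimately show ?thesis using that by metis
qed

subsection \<open>Reduction at the pole\<close>

text \<open>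
  The diagonal matrices with entries \<open>s\<^sup>n\<close> and \<open>1\<close> represent all double cosets of \<open>GL\<^sub>2(F)\<close> modulo regular
  matrices, powers of \<open>s\<close>, and integral matrices at \<open>x\<close>; this is the splitting of bundles.
\<close>

definition reducible :: "'k ratfun^2^2 \<Rightarrow> bool"
  where "reducible r \<longleftrightarrow> (\<exists>\<gamma> m n u. regular \<gamma> \<and> gl2O x u \<and>
    r = \<gamma> ** scal (s powi m) ** mat2 (s ^ n) 0 0 1 ** u)"

lemma reducible_diag: "reducible (mat2 (s ^ n) 0 0 1)"
  unfolding reducible_def
  by (intro exI[of _ "mat 1"] exI[of _ 0] exI[of _ n]) (simp add: regular_def)

lemma reducible_left:
  assumes "regular \<delta>" "reducible (\<delta> ** r)"
  shows "reducible r"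
proof -
  obtain \<gamma> m n u where *: "regular \<gamma>" "gl2O x u" "\<delta> ** r = \<gamma> ** scal (s powi m) ** mat2 (s ^ n) 0 0 1 ** u"
    using assms unfolding reducible_def by blast
  have "r = matrix_inv \<delta> ** (\<delta> ** r)"
    using assms by (simp add: matrix_mul_assoc matrix_inv_field regular_def)
  then have "r = (matrix_inv \<delta> ** \<gamma>) ** scal (s powi m) ** mat2 (s ^ n) 0 0 1 ** u"
    unfolding * by (simp add: matrix_mul_assoc)
  then show ?thesis unfolding reducible_def
    using * assms regular_mult regular_inverse by blast
qed

lemma reducible_right:
  assumes "gl2O x v" "reducible (r ** v)"
  shows "reducible r"
proof -
  obtain \<gamma> m n u where *: "regular \<gamma>" "gl2O x u" "r ** v = \<gamma> ** scal (s powi m) ** mat2 (s ^ n) 0 0 1 ** u"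
    using assms unfolding reducible_def by blast
  have "r = (r ** v) ** matrix_inv v"
    using matrix_inv_field(1)[OF gl2O_det[OF assms(1)]] by (simp add: matrix_mul_assoc[symmetric])
  then have "r = \<gamma> ** scal (s powi m) ** mat2 (s ^ n) 0 0 1 ** (u ** matrix_inv v)"
    unfolding * by (simp add: matrix_mul_assoc)
  then show ?thesis unfolding reducible_def
    using * assms gl2O_mult gl2O_inverse by blast
qed

lemma reducible_scal:
  assumes "reducible (scal (s powi l) ** r)"
  shows "reducible r"
proof -
  obtain \<gamma> m n u where *: "regular \<gamma>" "gl2O x u"
    "scal (s powi l) ** r = \<gamma> ** scal (s powi m) ** mat2 (s ^ n) 0 0 1 ** u"
    using assms unfolding reducible_def by blast
  have "r = scal (s powi (- l)) ** (scal (s powi l) ** r)"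
    by (simp add: matrix_mul_assoc scal_mult power_int_minus)
  also have "\<dots> = \<gamma> ** (scal (s powi (- l)) ** scal (s powi m)) ** mat2 (s ^ n) 0 0 1 ** u"
    unfolding * by (simp add: matrix_mul_assoc scal_commute[of "s powi (- l)" \<gamma>])
  also have "\<dots> = \<gamma> ** scal (s powi (- l + m)) ** mat2 (s ^ n) 0 0 1 ** u"
    unfolding scal_mult power_int_add[OF disjI1[OF s_nz]] ..
  finally show ?thesis unfolding reducible_def using * by blast
qed

lemma regular_swap: "regular (mat2 0 1 1 0)"
  by (simp add: regular_def gl2O_mat2)

lemma gl2O_swap: "gl2O y (mat2 0 1 1 0)"
  by (simp add: gl2O_mat2)

lemma val_s_powi: "val x (s powi n) = - n"
  by (simp add: val_powi val_s)

text \<open>The matrix identity behind one step of the reduction below.\<close>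

lemma triangular_exchange:
  fixes A S c :: "'b::field"
  assumes "c \<noteq> 0" "S \<noteq> 0"
  shows "scal S ** (mat2 0 1 1 0 ** mat2 A c 0 1) ** (mat2 1 0 (- A / c) 1 ** mat2 (- (c * S)) 0 0 (inverse (c * S))) =
    mat2 (S * (A * S)) (S * inverse (c * S)) 0 1"
  using assms by (simp add: scal_def mat2_mult_mat2 mat2_eq_iff field_simps)

lemma triangular_normalize:
  fixes a b d S T U :: "'b::field"
  assumes "a \<noteq> 0" "d \<noteq> 0" "S \<noteq> 0" "U * T = 1"
  shows "scal S ** mat2 a b 0 d ** mat2 (inverse (a * S * T)) 0 0 (inverse (d * S)) =
    mat2 U (S * b * inverse (d * S)) 0 1"
proof -
  have "T \<noteq> 0" "U = inverse T" using assms(4) by (auto simp: inverse_unique mult.commute)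
  then show ?thesis using assms by (simp add: scal_def mat2_mult_mat2 mat2_eq_iff field_simps)
qed

text \<open>
  The Euclidean algorithm for the lattice spanned by the columns: either the lattice is already
  diagonal, or exchanging the basis vectors makes the exponent \<open>i\<close> larger.
\<close>

lemma reducible_triangular: "reducible (mat2 (s powi i) b 0 1)"
proof (induction "nat (- i)" arbitrary: i b rule: less_induct)
  case less
  obtain P where P: "val_ge x 1 (b - ev s P)" using polynomial_part by blast
  define c where "c = b - ev s P"
  have c: "val_ge x 1 c" using P by (simp add: c_def)
  have "reducible (mat2 (s powi i) c 0 1)"
  proof (cases "val_ge x (- i) c")
    case True
    have "val_ge x 0 (- c / s powi i)"
      using True by (cases "c = 0") (auto simp: val_ge_iff val_divide val_s_powi)
    then have "gl2O x (mat2 1 (- c / s powi i) 0 1)" by (simp add: gl2O_mat2)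
    moreover have "mat2 (s powi i) c 0 1 ** mat2 1 (- c / s powi i) 0 1 = mat2 (s powi i) 0 0 1"
      by (simp add: mat2_mult_mat2)
    moreover have "reducible (mat2 (s powi i) 0 0 1)"
    proof (cases "0 \<le> i")
      case True
      then show ?thesis using reducible_diag[of "nat i"] by (simp add: power_int_def)
    next
      case False
      have "mat2 0 1 1 0 ** (scal (s powi (- i)) ** mat2 (s powi i) 0 0 1) ** mat2 0 1 1 0 = mat2 (s ^ nat (- i)) 0 0 1"
        using False by (simp add: scal_def mat2_mult_mat2 power_int_def power_inverse)
      then show ?thesis
        using reducible_scal reducible_left[OF regular_swap] reducible_right[OF gl2O_swap] reducible_diag
        by metis
    qed
    ultimately show ?thesis using reducible_right by metis
  next
    case False
    then have c0: "c \<noteq> 0" by auto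
    define l where "l = val x c"
    have l: "1 \<le> l" "l < - i" using c False c0 by (auto simp: val_ge_iff l_def)
    \<comment> \<open>The entry \<open>c\<close> strictly dominates the diagonal entry, so swapping the columns moves \<open>i\<close> to \<open>i + 2 l\<close>.\<close>
    define \<beta> where "\<beta> = c * s powi l"
    have \<beta>: "\<beta> \<noteq> 0" "val x \<beta> = 0" using c0 by (simp_all add: \<beta>_def val_mult val_s_powi l_def)
    have u: "gl2O x (mat2 1 0 (- (s powi i) / c) 1 ** mat2 (- \<beta>) 0 0 (inverse \<beta>))"
      using c0 l \<beta> by (intro gl2O_mult)
        (auto simp: gl2O_mat2 val_ge_iff val_divide val_s_powi l_def[symmetric] val_inverse)
    have "scal (s powi l) ** (mat2 0 1 1 0 ** mat2 (s powi i) c 0 1) **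
        (mat2 1 0 (- (s powi i) / c) 1 ** mat2 (- \<beta>) 0 0 (inverse \<beta>)) =
      mat2 (s powi (i + 2 * l)) (s powi l * inverse \<beta>) 0 1"
    proof -
      have "s powi (i + 2 * l) = s powi l * (s powi i * s powi l)"
        unfolding mult_2 power_int_add[OF disjI1[OF s_nz]] by (simp only: ac_simps)
      moreover have "s powi l \<noteq> 0" by simp
      ultimately show ?thesis unfolding \<beta>_def using triangular_exchange[OF c0] by simp
    qed
    moreover have "reducible (mat2 (s powi (i + 2 * l)) (s powi l * inverse \<beta>) 0 1)"
      using l by (intro less) auto
    ultimately show ?thesis
      using reducible_scal reducible_left[OF regular_swap] reducible_right[OF u] by metis
  qed
  moreover have "mat2 1 (ev s (- P)) 0 1 ** mat2 (s powi i) b 0 1 = mat2 (s powi i) c 0 1"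
    by (simp add: mat2_mult_mat2 c_def ev_minus)
  ultimately show ?case using reducible_left[OF regular_unipotent] by metis
qed

lemma reducible:
  assumes "det r \<noteq> 0"
  shows "reducible r"
proof -
  obtain k where k: "gl2O x k" "(r ** k)$2$1 = 0" using iwasawa[OF assms] by blast
  define a b d where "a = (r ** k)$1$1" and "b = (r ** k)$1$2" and "d = (r ** k)$2$2"
  have rk: "r ** k = mat2 a b 0 d" using k by (simp add: mat2_eq_iff a_def b_def d_def)
  have "det (r ** k) \<noteq> 0" using assms gl2O_det[OF k(1)] by (simp add: det_mul)
  then have ad: "a \<noteq> 0" "d \<noteq> 0" by (auto simp: rk)
  define l where "l = val x d"
  define i where "i = l - val x a"
  define e where "e = d * s powi l"
  define h where "h = a * s powi l * s powi (- i)"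
  have e: "e \<noteq> 0" "val x e = 0" using ad by (simp_all add: e_def val_mult val_s_powi l_def)
  have h: "h \<noteq> 0" "val x h = 0" using ad by (simp_all add: h_def val_mult val_s_powi l_def i_def)
  have u: "gl2O x (mat2 (inverse h) 0 0 (inverse e))"
    using e h by (simp add: gl2O_mat2 val_ge_iff val_inverse val_mult)
  have si: "s powi i * s powi (- i) = 1" by (simp add: power_int_minus)
  have "scal (s powi l) ** (r ** k) ** mat2 (inverse h) 0 0 (inverse e) =
      mat2 (s powi i) (s powi l * b * inverse e) 0 1"
    unfolding rk e_def h_def by (rule triangular_normalize) (use ad si in auto)
  then have "reducible (scal (s powi l) ** (r ** k) ** mat2 (inverse h) 0 0 (inverse e))"
    using reducible_triangular by metis
  then show ?thesis using reducible_right[OF u] reducible_scal reducible_right[OF k(1)] by metis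
qed

text \<open>
  A matrix that is congruent to the identity is automatically invertible over the local ring.
\<close>

lemma near_constant:
  assumes "det \<kappa> \<noteq> 0" "\<And>i j. val_ge x 1 (u$i$j - const_mat \<kappa>$i$j)"
  obtains k where "gl2O x k" "\<And>i j. val_ge x 1 (k$i$j - mat 1$i$j)" "u = const_mat \<kappa> ** k"
proof -
  define N where "N = u - const_mat \<kappa>"
  have N: "val_ge x 1 (N$i$j)" for i j using assms by (simp add: N_def)
  note c = gl2O_const_mat[OF assms(1), of x]
  note inv = matrix_inv_field[OF gl2O_det[OF c]]
  define k where "k = matrix_inv (const_mat \<kappa>) ** u"
  have kN: "k - mat 1 = matrix_inv (const_mat \<kappa>) ** N" by (simp add: k_def N_def mat2_mult_diff inv)
  have "val_ge x 1 ((k - mat 1)$i$j)" for i j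
    unfolding kN using gl2O_entry[OF gl2O_inverse[OF c]] N
    by (auto simp: mat2_mult intro!: val_ge_add val_ge_mult_left)
  then have k1: "val_ge x 1 (k$i$j - mat 1$i$j)" for i j by simp
  have "\<forall>i j. val_ge x 0 (k$i$j)"
    unfolding mat2_all
    using val_ge_add[OF val_ge_mono[OF k1[of 1 1]], of 0 1] val_ge_mono[OF k1[of 1 2], of 0]
      val_ge_mono[OF k1[of 2 1], of 0] val_ge_add[OF val_ge_mono[OF k1[of 2 2]], of 0 1] by simp
  then have k0: "val_ge x 0 (k$i$j)" for i j by blast
  have "det k - 1 = (k$1$1 - 1) * k$2$2 + (k$2$2 - 1) - k$1$2 * k$2$1" by (simp add: det_2 algebra_simps)
  also have "val_ge x 1 \<dots>"
    using k1[of 1 1] k1[of 2 2] k1[of 1 2] k0[of 2 2] k0[of 2 1]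
    by (intro val_ge_diff[of x 1 "_ + _"] val_ge_add val_ge_mult_right) auto
  finally have "val_ge x 1 (det k - 1)" .
  then have "det k \<noteq> 0 \<and> val x (det k) = 0"
    using val_eq_if_close[of 1 x "det k"] by simp
  then have "gl2O x k" using k0 by (simp add: gl2O_def)
  moreover have "u = const_mat \<kappa> ** k" by (simp add: k_def matrix_mul_assoc inv)
  ultimately show ?thesis using that k1 by blast
qed

lemma integral_constant_part:
  assumes "gl2O x u"
  obtains \<kappa> k where "det \<kappa> \<noteq> 0" "gl2O x k" "\<And>i j. val_ge x 1 (k$i$j - mat 1$i$j)" "u = const_mat \<kappa> ** k"
proof -
  have "\<forall>i j. \<exists>c. val_ge x 1 (u$i$j - const_rat c)" using residue_at_pole gl2O_entry[OF assms] by metis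
  then obtain C where C: "\<And>i j. val_ge x 1 (u$i$j - const_rat (C i j))" by metis
  define \<kappa> where "\<kappa> = (\<chi> i j. C i j)"
  have N: "val_ge x 1 (u$i$j - const_mat \<kappa>$i$j)" for i j using C by (simp add: \<kappa>_def)
  have "det u - det (const_mat \<kappa>) =
      u$1$1 * (u$2$2 - const_mat \<kappa>$2$2) + (u$1$1 - const_mat \<kappa>$1$1) * const_rat (\<kappa>$2$2) -
      (u$1$2 * (u$2$1 - const_mat \<kappa>$2$1) + (u$1$2 - const_mat \<kappa>$1$2) * const_rat (\<kappa>$2$1))"
    by (simp add: det_2 algebra_simps)
  also have "val_ge x 1 \<dots>"
    by (intro val_ge_diff[of x 1 "_ + _"] val_ge_add val_ge_mult_left[OF gl2O_entry[OF assms] N] val_ge_mult_right[OF N]) auto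
  finally have "val_ge x 1 (det u - const_rat (det \<kappa>))" by (simp add: det_const_mat)
  then have "det \<kappa> \<noteq> 0" using assms by (auto simp: gl2O_def val_ge_iff)
  from near_constant[OF this N] show ?thesis using that \<open>det \<kappa> \<noteq> 0\<close> by metis
qed

text \<open>
  The bundle \<open>O(n) \<oplus> O\<close> with the basis \<open>\<kappa>\<close> of its fibre at \<open>x\<close>.
\<close>

definition point :: "nat \<Rightarrow> 'k^2^2 \<Rightarrow> 'k ratfun^2^2"
  where "point n \<kappa> = mat2 (s ^ n) 0 0 1 ** const_mat \<kappa>"

lemma det_point: "det (point n \<kappa>) = s ^ n * const_rat (det \<kappa>)"
  by (simp add: point_def det_mul det_const_mat)

text \<open>
  The point \<open>(n, \<kappa>)\<close> represents the double coset of \<open>g\<close>; \<open>\<kappa>\<close> is not determined by \<open>g\<close>.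
\<close>

definition located :: "'k gl2 \<Rightarrow> nat \<Rightarrow> 'k^2^2 \<Rightarrow> bool"
  where "located g n \<kappa> \<longleftrightarrow> det \<kappa> \<noteq> 0 \<and> (\<exists>\<delta> m k. det \<delta> \<noteq> 0 \<and> k \<in> level x \<and>
    g = dia \<delta> * loc x (scal (s powi m) ** point n \<kappa>) * k)"

lemma locatedI:
  "det \<kappa> \<noteq> 0 \<Longrightarrow> det \<delta> \<noteq> 0 \<Longrightarrow> k \<in> level x \<Longrightarrow> g = dia \<delta> * loc x (scal (s powi m) ** point n \<kappa>) * k \<Longrightarrow>
    located g n \<kappa>"
  unfolding located_def by blast

lemma det_scal_point: "det \<kappa> \<noteq> 0 \<Longrightarrow> det (scal (s powi m) ** point n \<kappa>) \<noteq> 0"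
  by (simp add: det_mul det_point)

lemma located_exists: "\<exists>n \<kappa>. located g n \<kappa>"
proof -
  obtain \<delta> r k where g: "det \<delta> \<noteq> 0" "det r \<noteq> 0" "k \<in> level x" "g = dia \<delta> * loc x r * k"
    by (rule global_local_decomposition)
  obtain \<gamma> m n u where r: "regular \<gamma>" "gl2O x u" "r = \<gamma> ** scal (s powi m) ** mat2 (s ^ n) 0 0 1 ** u"
    using reducible[OF g(2)] unfolding reducible_def by blast
  obtain \<kappa> k' where k': "det \<kappa> \<noteq> 0" "gl2O x k'" "\<And>i j. val_ge x 1 (k'$i$j - mat 1$i$j)" "u = const_mat \<kappa> ** k'"
    using integral_constant_part[OF r(2)] by metis
  define t where "t = scal (s powi m) ** point n \<kappa>"
  have t: "det t \<noteq> 0" using det_scal_point k' by (simp add: t_def)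
  have rt: "r = (\<gamma> ** t) ** k'" by (simp add: r(3) k'(4) t_def point_def matrix_mul_assoc)
  have d: "det \<gamma> \<noteq> 0" "det k' \<noteq> 0" using r k' by (auto simp: regular_def gl2O_det)
  obtain w where w: "w \<in> level x" "loc x (\<gamma> ** t) = dia \<gamma> * loc x t * w" using loc_regular[OF r(1) t] by blast
  have "loc x r = loc x (\<gamma> ** t) * loc x k'" using t d by (simp add: rt loc_mult det_mul)
  then have "g = dia (\<delta> ** \<gamma>) * loc x t * (w * loc x k' * k)"
    using g d by (simp add: w dia_mult[symmetric] mult.assoc)
  moreover have "w * loc x k' * k \<in> level x"
    using w g k' d by (intro level_mult) (auto simp: loc_level)
  ultimately have "located g n \<kappa>" using g d k' by (intro locatedI[of \<kappa> "\<delta> ** \<gamma>"]) (auto simp: det_mul t_def)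
  then show ?thesis by blast
qed

end

subsection \<open>Uniqueness of the representatives\<close>

context coordinate
begin

text \<open>The determinant and its inverse are both polynomials in \<open>s\<close>, hence constants.\<close>

lemma regular_det: "regular \<gamma> \<Longrightarrow> val x (det \<gamma>) = 0"
proof -
  assume r: "regular \<gamma>"
  have d: "det \<gamma> \<noteq> 0" "val y (det \<gamma>) = 0" if "y \<noteq> x" for y
    using r that by (auto simp: regular_def gl2O_def)
  have d0: "det \<gamma> \<noteq> 0" using r by (simp add: regular_def)
  obtain P where P: "det \<gamma> = ev s P"
    by (rule regular_is_polynomial[of "det \<gamma>"]) (use d in \<open>auto simp: val_ge_def\<close>)
  obtain Q where Q: "inverse (det \<gamma>) = ev s Q"
    by (rule regular_is_polynomial[of "inverse (det \<gamma>)"]) (use d in \<open>auto simp: val_ge_def val_inverse\<close>)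
  have "ev s (P * Q) = ev s 1" using d0 by (simp add: ev_mult P[symmetric] Q[symmetric])
  then have "P * Q = 1" by (simp only: ev_inj)
  then have "degree P + degree Q = 0" by (metis degree_1 degree_mult_eq mult_eq_0_iff zero_neq_one)
  moreover have "P \<noteq> 0" using d0 P by auto
  ultimately show ?thesis using P by (simp add: val_x_ev)
qed

lemma regular_entry:
  assumes "regular \<gamma>"
  obtains P where "\<gamma>$i$j = ev s P"
  using regular_is_polynomial[of "\<gamma>$i$j"] assms by (auto simp: regular_def gl2O_def)

lemma regular_entry_val: "regular \<gamma> \<Longrightarrow> \<gamma>$i$j \<noteq> 0 \<Longrightarrow> val x (\<gamma>$i$j) \<le> 0"
  using regular_entry[of \<gamma> i j] by (metis ev_nz val_x_ev neg_0_le_iff_le neg_le_0_iff_le of_nat_0_le_iff)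

text \<open>
  If \<open>n + n' > 0\<close>, the lower left entry of \<open>\<gamma>\<close> is a polynomial in \<open>s\<close> that vanishes at \<open>x\<close>, hence zero.
  Then \<open>\<gamma>\<close> is upper triangular, and the valuations of its diagonal entries give \<open>n = n'\<close>.  Modulo the
  maximal ideal it acts on \<open>\<kappa>\<close> by a constant upper triangular matrix, which cannot change whether
  \<open>\<kappa>\<^sub>2\<^sub>2\<close> vanishes.
\<close>

lemma regular_between_points:
  assumes \<gamma>: "regular \<gamma>" and e: "gl2O x e" "\<And>i j. val_ge x 1 (e$i$j - mat 1$i$j)"
    and \<kappa>: "det \<kappa> \<noteq> 0" "det \<kappa>' \<noteq> 0"
    and eq: "\<gamma> ** (scal (s powi m) ** point n \<kappa>) = (scal (s powi m') ** point n' \<kappa>') ** e"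
  shows "n = n' \<and> (n = 0 \<or> (\<kappa>$2$2 = 0 \<longleftrightarrow> \<kappa>'$2$2 = 0))"
proof (cases "n + n' = 0")
  case False
  define W where "W = const_mat \<kappa>' ** e ** matrix_inv (const_mat \<kappa>)"
  note inv = matrix_inv_field[OF gl2O_det[OF gl2O_const_mat[OF \<kappa>(1)]]]
  have W: "gl2O x W" unfolding W_def by (intro gl2O_mult gl2O_inverse gl2O_const_mat \<kappa> e)
  have W\<kappa>: "W ** const_mat \<kappa> = const_mat \<kappa>' ** e"
    unfolding W_def matrix_mul_assoc[symmetric] inv by simp
  define t where "t = m - m'"
  define A where "A = s powi t"
  have "scal (s powi (- m')) ** (\<gamma> ** (scal (s powi m) ** point n \<kappa>)) ** matrix_inv (const_mat \<kappa>) =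
    \<gamma> ** (scal (s powi (- m')) ** scal (s powi m)) ** mat2 (s ^ n) 0 0 1 ** (const_mat \<kappa> ** matrix_inv (const_mat \<kappa>))"
    by (simp only: point_def matrix_mul_assoc scal_commute[of "s powi (- m')" \<gamma>])
  also have "\<dots> = \<gamma> ** scal A ** mat2 (s ^ n) 0 0 1"
    unfolding inv scal_mult power_int_add[OF disjI1[OF s_nz], symmetric] A_def t_def by (simp add: add.commute)
  finally have l: "scal (s powi (- m')) ** (\<gamma> ** (scal (s powi m) ** point n \<kappa>)) ** matrix_inv (const_mat \<kappa>) =
    \<gamma> ** scal A ** mat2 (s ^ n) 0 0 1" .
  have "scal (s powi (- m')) ** ((scal (s powi m') ** point n' \<kappa>') ** e) ** matrix_inv (const_mat \<kappa>) =
     (scal (s powi (- m')) ** scal (s powi m')) ** mat2 (s ^ n') 0 0 1 ** W"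
    by (simp only: point_def matrix_mul_assoc W_def)
  also have "\<dots> = mat2 (s ^ n') 0 0 1 ** W"
    unfolding scal_mult power_int_add[OF disjI1[OF s_nz], symmetric] by simp
  finally have E: "\<gamma> ** scal A ** mat2 (s ^ n) 0 0 1 = mat2 (s ^ n') 0 0 1 ** W"
    using l eq by simp
  have A: "A \<noteq> 0" "val x A = - t" by (simp_all add: A_def val_s_powi)
  have sn: "val x (s ^ k) = - int k" for k by (simp add: val_power val_s)
  have ent: "\<gamma>$1$1 * A * s ^ n = s ^ n' * W$1$1" "\<gamma>$2$1 * A * s ^ n = W$2$1" "\<gamma>$2$2 * A = W$2$2"
    using E by (simp_all add: mat2_eq_iff mat2_mult scal_def)
  have dW: "det W \<noteq> 0" "val x (det W) = 0" using W by (auto simp: gl2O_def)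
  have d\<gamma>: "det \<gamma> \<noteq> 0" "val x (det \<gamma>) = 0" using \<gamma> regular_det by (auto simp: regular_def)
  have "det \<gamma> * (A * A) * s ^ n = s ^ n' * det W"
    using arg_cong[OF E, of det] by (simp add: det_mul)
  then have "val x (det \<gamma> * (A * A) * s ^ n) = val x (s ^ n' * det W)" by simp
  then have nt: "int n' = 2 * t + int n" using A dW d\<gamma> by (simp add: val_mult sn)
  have "val_ge x 1 (\<gamma>$2$1)"
  proof (cases "\<gamma>$2$1 = 0")
    case False
    have "val_ge x 0 (\<gamma>$2$1 * A * s ^ n)" unfolding ent(2) by (rule gl2O_entry[OF W])
    then have "0 \<le> val x (\<gamma>$2$1) - t - int n" using False A by (simp add: val_ge_iff val_mult sn)
    moreover have "1 \<le> t + int n" using nt \<open>n + n' \<noteq> 0\<close> by linarith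
    ultimately show ?thesis using False by (simp add: val_ge_iff)
  qed simp
  then have \<gamma>21: "\<gamma>$2$1 = 0" using regular_entry[OF \<gamma>, of 2 1] vanishing_at_pole by (metis ev_0)
  have \<gamma>d: "\<gamma>$1$1 \<noteq> 0" "\<gamma>$2$2 \<noteq> 0" "det \<gamma> = \<gamma>$1$1 * \<gamma>$2$2" using d\<gamma> \<gamma>21 by (auto simp: det_2)
  have W21: "W$2$1 = 0" using ent(2) \<gamma>21 by simp
  have Wd: "W$1$1 \<noteq> 0" "W$2$2 \<noteq> 0" "det W = W$1$1 * W$2$2" using dW W21 by (auto simp: det_2)
  have "val x (W$1$1) + val x (W$2$2) = 0" using Wd dW(2) by (simp add: val_mult)
  moreover have "val x (W$1$1) \<ge> 0" "val x (W$2$2) \<ge> 0"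
    using gl2O_entry[OF W, of 1 1] gl2O_entry[OF W, of 2 2] Wd by (simp_all add: val_ge_iff)
  ultimately have vW: "val x (W$2$2) = 0" by linarith
  have "val x (\<gamma>$1$1) + val x (\<gamma>$2$2) = 0" using \<gamma>d d\<gamma>(2) by (simp add: val_mult)
  moreover have "val x (\<gamma>$1$1) \<le> 0" "val x (\<gamma>$2$2) \<le> 0" using regular_entry_val[OF \<gamma>] \<gamma>d by auto
  ultimately have "val x (\<gamma>$2$2) = 0" by linarith
  moreover have "val x (\<gamma>$2$2 * A) = 0" using ent(3) vW by simp
  ultimately have "t = 0" using A \<gamma>d by (simp add: val_mult)
  then have "n = n'" using nt by simp
  have "W$2$2 * const_rat (\<kappa>$2$2) = const_rat (\<kappa>'$2$1) * e$1$2 + const_rat (\<kappa>'$2$2) * e$2$2"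
    using W\<kappa> W21 by (simp add: mat2_eq_iff mat2_mult)
  also have "\<dots> = const_rat (\<kappa>'$2$2) + (const_rat (\<kappa>'$2$1) * e$1$2 + const_rat (\<kappa>'$2$2) * (e$2$2 - 1))"
    by (simp add: algebra_simps)
  finally have "W$2$2 * const_rat (\<kappa>$2$2) - const_rat (\<kappa>'$2$2) =
    const_rat (\<kappa>'$2$1) * e$1$2 + const_rat (\<kappa>'$2$2) * (e$2$2 - 1)" by simp
  also have "val_ge x 1 \<dots>"
    using e(2)[of 1 2] e(2)[of 2 2] by (intro val_ge_add val_ge_mult_left) auto
  finally have "val_ge x 1 (W$2$2 * const_rat (\<kappa>$2$2) - const_rat (\<kappa>'$2$2))" .
  then have "\<kappa>$2$2 = 0 \<longleftrightarrow> \<kappa>'$2$2 = 0"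
    using Wd vW by (cases "\<kappa>$2$2 = 0"; cases "\<kappa>'$2$2 = 0") (auto simp: val_ge_iff val_mult val_const)
  then show ?thesis using \<open>n = n'\<close> by simp
qed auto

lemma located_unique:
  assumes "located g n \<kappa>" "located g n' \<kappa>'"
  shows "n = n' \<and> (n = 0 \<or> (\<kappa>$2$2 = 0 \<longleftrightarrow> \<kappa>'$2$2 = 0))"
proof -
  obtain \<delta> m k where 1: "det \<kappa> \<noteq> 0" "det \<delta> \<noteq> 0" "k \<in> level x" "g = dia \<delta> * loc x (scal (s powi m) ** point n \<kappa>) * k"
    using assms(1) unfolding located_def by blast
  obtain \<delta>' m' k' where 2: "det \<kappa>' \<noteq> 0" "det \<delta>' \<noteq> 0" "k' \<in> level x" "g = dia \<delta>' * loc x (scal (s powi m') ** point n' \<kappa>') * k'"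
    using assms(2) unfolding located_def by blast
  define r r' where "r = scal (s powi m) ** point n \<kappa>" and "r' = scal (s powi m') ** point n' \<kappa>'"
  have r: "det r \<noteq> 0" "det r' \<noteq> 0" using 1 2 det_scal_point by (auto simp: r_def r'_def)
  define \<gamma> where "\<gamma> = matrix_inv \<delta>' ** \<delta>"
  have \<gamma>0: "det \<gamma> \<noteq> 0" using 1 2 by (simp add: \<gamma>_def det_mul matrix_inv_field)
  define e where "e = matrix_inv r' ** (\<gamma> ** r)"
  have e0: "det e \<noteq> 0" using r \<gamma>0 by (simp add: e_def det_mul matrix_inv_field)
  define E where "E y = (if y = x then e else \<gamma>)" for y
  have admE: "admissible E" unfolding E_def using admissible_local[OF e0 admissible_const[OF \<gamma>0]] .
  have "dia \<gamma> * loc x r = gl2_of (\<lambda>y. if y = x then \<gamma> ** r else \<gamma>)"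
    unfolding dia_def loc_def gl2_of_mult[OF admissible_const[OF \<gamma>0] admissible_loc[OF r(1)]]
    by (rule arg_cong[of _ _ gl2_of]) auto
  moreover have "loc x r' * gl2_of E = gl2_of (\<lambda>y. if y = x then \<gamma> ** r else \<gamma>)"
    unfolding loc_def gl2_of_mult[OF admissible_loc[OF r(2)] admE]
    by (rule arg_cong[of _ _ gl2_of]) (auto simp: E_def e_def matrix_mul_assoc matrix_inv_field[OF r(2)])
  ultimately have 3: "dia \<gamma> * loc x r = loc x r' * gl2_of E" by simp
  have "dia \<gamma> = inverse (dia \<delta>') * dia \<delta>"
    using 1 2 by (simp add: \<gamma>_def dia_inverse dia_mult matrix_inv_field)
  then have "dia \<gamma> * loc x r * k = inverse (dia \<delta>') * g" using 1 by (simp add: r_def mult.assoc)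
  also have "\<dots> = loc x r' * k'" using 2 by (simp add: r'_def mult.assoc)
  finally have "loc x r' * gl2_of E * k = loc x r' * k'" by (simp add: 3)
  then have "gl2_of E * k = k'" by (metis gl2_inverse_cancel(1) mult.assoc)
  then have "gl2_of E = k' * inverse k" by (metis gl2_inverse(2) mult.assoc mult.right_neutral)
  then have "gl2_of E \<in> level x" using 1 2 by (simp add: level_mult level_inverse)
  then have E: "\<And>y. gl2O y (E y)" "\<And>i j. val_ge x 1 (E x $ i $ j - mat 1 $ i $ j)"
    by (auto simp: gl2_of_level[OF admE])
  have "gl2O y \<gamma>" if "y \<noteq> x" for y using E(1)[of y] that by (simp add: E_def)
  then have "regular \<gamma>" using \<gamma>0 by (simp add: regular_def)
  moreover have "gl2O x e" "\<And>i j. val_ge x 1 (e$i$j - mat 1$i$j)" using E(1)[of x] E(2) by (auto simp: E_def)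
  moreover have "\<gamma> ** r = r' ** e"
    by (simp add: e_def matrix_mul_assoc matrix_inv_field[OF r(2)])
  ultimately show ?thesis using regular_between_points 1 2 unfolding r_def r'_def by blast
qed

section \<open>The Hecke operator on representatives\<close>

definition invariant :: "('k gl2 \<Rightarrow> complex) \<Rightarrow> bool"
  where "invariant f \<longleftrightarrow> (\<forall>\<gamma>\<in>gl2_rational. \<forall>g. f (\<gamma> * g) = f g) \<and> (\<forall>z\<in>gl2_center. \<forall>g. f (z * g) = f g) \<and>
    (\<forall>k\<in>level x. \<forall>g. f (g * k) = f g)"

lemma invariant_dia: "invariant f \<Longrightarrow> det \<delta> \<noteq> 0 \<Longrightarrow> f (dia \<delta> * g) = f g"
  by (auto simp: invariant_def gl2_rational_eq)

lemma invariant_level: "invariant f \<Longrightarrow> k \<in> level x \<Longrightarrow> f (g * k) = f g"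
  by (simp add: invariant_def)

lemma invariant_scal: "invariant f \<Longrightarrow> c \<noteq> 0 \<Longrightarrow> f (loc x (scal c) * g) = f g"
  using loc_scal_central[of c x] unfolding invariant_def by blast

lemma invariant_regular:
  assumes "invariant f" "regular \<gamma>" "det t \<noteq> 0"
  shows "f (loc x (\<gamma> ** t)) = f (loc x t)"
proof -
  obtain u where u: "u \<in> level x" "loc x (\<gamma> ** t) = dia \<gamma> * loc x t * u" using loc_regular[OF assms(2,3)] by blast
  have "det \<gamma> \<noteq> 0" using assms(2) by (simp add: regular_def)
  then show ?thesis using assms(1) u by (simp add: invariant_level invariant_dia)
qed

lemma invariant_near_constant:
  assumes f: "invariant f" and \<kappa>: "det \<kappa> \<noteq> 0" "\<And>i j. val_ge x 1 (u$i$j - const_mat \<kappa>$i$j)" and t: "det t \<noteq> 0"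
  shows "f (loc x (t ** u)) = f (loc x (t ** const_mat \<kappa>))"
proof -
  obtain k where k: "gl2O x k" "\<And>i j. val_ge x 1 (k$i$j - mat 1$i$j)" "u = const_mat \<kappa> ** k"
    using near_constant[OF \<kappa>] by metis
  have d: "det k \<noteq> 0" "det (t ** const_mat \<kappa>) \<noteq> 0" using k t \<kappa> by (auto simp: gl2O_det det_mul det_const_mat)
  have "loc x k \<in> level x" using k d by (simp add: loc_level)
  moreover have "loc x (t ** u) = loc x (t ** const_mat \<kappa>) * loc x k"
    using d by (simp add: k loc_mult matrix_mul_assoc)
  ultimately show ?thesis using f by (simp add: invariant_level)
qed

text \<open>
  Constant upper triangular matrices extend to automorphisms of \<open>O(n) \<oplus> O\<close>.
\<close>

lemma point_borel:
  "point n (mat2 a b 0 d ** \<kappa>) = mat2 (const_rat a) (const_rat b * s ^ n) 0 (const_rat d) ** point n \<kappa>"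
  unfolding point_def const_mat_mult matrix_mul_assoc by (simp add: const_mat_mat2 mat2_mult_mat2 mult.commute)

lemma regular_borel:
  assumes "a \<noteq> 0" "d \<noteq> 0"
  shows "regular (mat2 (const_rat a) (const_rat b * s ^ n) 0 (const_rat d))"
  unfolding regular_def gl2O_mat2
  using assms by (auto simp: val_mult val_const intro!: val_ge_mult_left val_ge_power val_ge_s)

lemma invariant_borel:
  assumes "invariant f" "a \<noteq> 0" "d \<noteq> 0" "det \<kappa> \<noteq> 0" "det t \<noteq> 0"
  shows "f (loc x (point n (mat2 a b 0 d ** \<kappa>) ** t)) = f (loc x (point n \<kappa> ** t))"
  unfolding point_borel matrix_mul_assoc[symmetric]
  using assms by (intro invariant_regular regular_borel) (auto simp: det_mul det_point)

lemma invariant_point_0: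
  assumes "invariant f" "det \<kappa> \<noteq> 0" "det \<kappa>' \<noteq> 0" "det t \<noteq> 0"
  shows "f (loc x (point 0 \<kappa> ** t)) = f (loc x (point 0 \<kappa>' ** t))"
proof -
  have "f (loc x (point 0 \<kappa> ** t)) = f (loc x t)" if "det \<kappa> \<noteq> 0" for \<kappa>
  proof -
    have "point 0 \<kappa> = const_mat \<kappa>" by (simp add: point_def mat2_one_eq[symmetric])
    then show ?thesis using invariant_regular[OF assms(1) regular_const_mat[OF that] assms(4)] by simp
  qed
  then show ?thesis using assms by simp
qed

lemma borel_upper_cell:
  fixes \<kappa> :: "'k^2^2"
  assumes "det \<kappa> \<noteq> 0" "\<kappa>$2$2 \<noteq> 0"
  shows "\<kappa> = mat2 (det \<kappa> / \<kappa>$2$2) (\<kappa>$1$2) 0 (\<kappa>$2$2) ** mat2 1 0 (\<kappa>$2$1 / \<kappa>$2$2) 1"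
  using assms(2) by (simp add: mat2_eq_iff mat2_mult det_2 field_simps)

lemma borel_lower_cell:
  fixes \<kappa> :: "'k^2^2"
  assumes "\<kappa>$2$2 = 0"
  shows "\<kappa> = mat2 (\<kappa>$1$2) (\<kappa>$1$1) 0 (\<kappa>$2$1) ** mat2 0 1 1 0"
  using assms by (simp add: mat2_eq_iff mat2_mult)

lemma lower_cell_nonzero:
  fixes \<kappa> :: "'k^2^2"
  assumes "det \<kappa> \<noteq> 0" "\<kappa>$2$2 = 0"
  shows "\<kappa>$1$2 \<noteq> 0" "\<kappa>$2$1 \<noteq> 0"
  using assms by (auto simp: det_2)

text \<open>
  The Bruhat decomposition: for an invariant function only the cell of \<open>\<kappa>\<close> matters, up to the
  remaining coordinate on the big cell.
\<close>

lemma invariant_cells: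
  assumes f: "invariant f" and \<kappa>: "det \<kappa> \<noteq> 0" and t: "det t \<noteq> 0"
  shows "\<kappa>$2$2 \<noteq> 0 \<Longrightarrow> f (loc x (point n \<kappa> ** t)) = f (loc x (point n (mat2 1 0 (\<kappa>$2$1 / \<kappa>$2$2) 1) ** t))"
    and "\<kappa>$2$2 = 0 \<Longrightarrow> f (loc x (point n \<kappa> ** t)) = f (loc x (point n (mat2 0 1 1 0) ** t))"
proof -
  assume "\<kappa>$2$2 \<noteq> 0"
  then show "f (loc x (point n \<kappa> ** t)) = f (loc x (point n (mat2 1 0 (\<kappa>$2$1 / \<kappa>$2$2) 1) ** t))"
    by (subst borel_upper_cell[OF \<kappa>], assumption)
      (rule invariant_borel[OF f], use \<kappa> t in auto)
next
  assume 0: "\<kappa>$2$2 = 0"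
  then show "f (loc x (point n \<kappa> ** t)) = f (loc x (point n (mat2 0 1 1 0) ** t))"
    by (subst borel_lower_cell, assumption)
      (rule invariant_borel[OF f], use lower_cell_nonzero[OF \<kappa> 0] t in auto)
qed

text \<open>
  The representatives of the cosets in the double coset of \<open>diag(\<pi>, 1)\<close>.  The upper right entries run
  through the multiples of the uniformizer \<open>1/s\<close> by constants, that is, modulo higher order terms,
  through the maximal ideal at \<open>x\<close>.
\<close>

definition hecke_rep :: "'k ratfun \<Rightarrow> 'k \<Rightarrow> 'k ratfun^2^2"
  where "hecke_rep \<pi> b = mat2 \<pi> (const_rat b * inverse s) 0 1"

lemma val_inverse_s: "val x (inverse s) = 1"
  by (simp add: val_inverse val_s)

context
  fixes \<pi> \<epsilon> f
  assumes \<pi>: "uniformizer x \<pi>" and \<epsilon>: "\<epsilon> \<noteq> 0" "val_ge x 1 (s * \<pi> - const_rat \<epsilon>)"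
    and f: "invariant f"
begin

lemma pi_nz: "\<pi> \<noteq> 0" and val_pi: "val x \<pi> = 1"
  using \<pi> by (auto simp: uniformizer_def)

lemma det_hecke_rep: "det (hecke_rep \<pi> b) \<noteq> 0"
  by (simp add: hecke_rep_def pi_nz)

text \<open>
  Moving one factor \<open>s\<close> to the right turns the product into \<open>diag(s\<^sup>n, 1)\<close> times a matrix that is congruent
  to a constant upper triangular one, which extends to an automorphism of \<open>O(n) \<oplus> O\<close>.
\<close>

lemma hecke_down:
  assumes "det \<kappa> \<noteq> 0" "\<kappa>$2$2 \<noteq> 0"
  shows "f (loc x (point (Suc n) \<kappa> ** hecke_rep \<pi> b)) = f (loc x (point n (mat 1)))"
proof -
  define c where "c = \<kappa>$2$1 / \<kappa>$2$2"
  define u where "u = mat2 (s * \<pi>) (const_rat b) (const_rat c * \<pi>) (const_rat c * (const_rat b * inverse s) + 1)"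
  have "point (Suc n) (mat2 1 0 c 1) ** hecke_rep \<pi> b = mat2 (s ^ n) 0 0 1 ** u"
    by (simp add: point_def hecke_rep_def u_def const_mat_mat2 mat2_mult_mat2 mat2_eq_iff)
  moreover have "f (loc x (mat2 (s ^ n) 0 0 1 ** u)) = f (loc x (mat2 (s ^ n) 0 0 1 ** const_mat (mat2 \<epsilon> b 0 1)))"
  proof (rule invariant_near_constant[OF f])
    have "\<forall>i j. val_ge x 1 (u$i$j - const_mat (mat2 \<epsilon> b 0 1)$i$j)"
      unfolding mat2_all using \<epsilon> val_inverse_s val_pi
      by (auto simp: u_def val_ge_iff pi_nz intro!: val_ge_mult_left)
    then show "val_ge x 1 (u$i$j - const_mat (mat2 \<epsilon> b 0 1)$i$j)" for i j by blast
  qed (use \<epsilon> in auto)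
  moreover have "mat2 (s ^ n) 0 0 1 ** const_mat (mat2 \<epsilon> b 0 1) = point n (mat2 \<epsilon> b 0 1 ** mat 1) ** mat 1"
    by (simp add: point_def)
  ultimately have "f (loc x (point (Suc n) (mat2 1 0 c 1) ** hecke_rep \<pi> b)) = f (loc x (point n (mat 1) ** mat 1))"
    using invariant_borel[OF f \<epsilon>(1), of 1 "mat 1" "mat 1" n b] by simp
  then show ?thesis using invariant_cells(1)[OF f assms(1) det_hecke_rep assms(2)] by (simp add: c_def)
qed

text \<open>
  Here pulling out the central factor \<open>1/s\<close> raises the exponent, and the remaining constant matrix
  remembers the coset through its entry \<open>b\<close>.
\<close>

lemma hecke_up:
  assumes "det \<kappa> \<noteq> 0" "\<kappa>$2$2 = 0 \<or> n = 0"
  shows "f (loc x (point n \<kappa> ** hecke_rep \<pi> b)) = f (loc x (point (Suc n) (mat2 0 1 \<epsilon> b)))"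
proof -
  define u where "u = mat2 0 1 (s * \<pi>) (const_rat b)"
  have e: "point n (mat2 0 1 1 0) ** hecke_rep \<pi> b = scal (inverse s) ** (mat2 (s ^ Suc n) 0 0 1 ** u)"
    by (simp add: point_def hecke_rep_def u_def const_mat_mat2 mat2_mult_mat2 mat2_eq_iff scal_def mult.commute)
  have du: "det (mat2 (s ^ Suc n) 0 0 1 ** u) \<noteq> 0" by (simp add: det_mul u_def pi_nz)
  have "f (loc x (point n (mat2 0 1 1 0) ** hecke_rep \<pi> b)) = f (loc x (scal (inverse s)) * loc x (mat2 (s ^ Suc n) 0 0 1 ** u))"
    unfolding e using du by (subst loc_mult) auto
  also have "\<dots> = f (loc x (mat2 (s ^ Suc n) 0 0 1 ** u))" by (rule invariant_scal[OF f]) simp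
  also have "\<dots> = f (loc x (mat2 (s ^ Suc n) 0 0 1 ** const_mat (mat2 0 1 \<epsilon> b)))"
  proof (rule invariant_near_constant[OF f])
    have "\<forall>i j. val_ge x 1 (u$i$j - const_mat (mat2 0 1 \<epsilon> b)$i$j)"
      unfolding mat2_all using \<epsilon> by (auto simp: u_def)
    then show "val_ge x 1 (u$i$j - const_mat (mat2 0 1 \<epsilon> b)$i$j)" for i j by blast
  qed (use \<epsilon> in auto)
  finally have J: "f (loc x (point n (mat2 0 1 1 0) ** hecke_rep \<pi> b)) = f (loc x (point (Suc n) (mat2 0 1 \<epsilon> b)))"
    by (simp add: point_def)
  from assms(2) show ?thesis
  proof
    assume "\<kappa>$2$2 = 0"
    then show ?thesis using invariant_cells(2)[OF f assms(1) det_hecke_rep] J by simp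
  next
    assume "n = 0"
    then show ?thesis using invariant_point_0[OF f assms(1) _ det_hecke_rep, of "mat2 0 1 1 0"] J by simp
  qed
qed

end

end

section \<open>The Hecke double coset\<close>

text \<open>
  The adeles that agree with \<open>f\<close> at \<open>x\<close> and with \<open>0\<close>, respectively \<open>1\<close>, elsewhere.
\<close>

definition at0 :: "'k::{field,finite} place \<Rightarrow> 'k ratfun \<Rightarrow> 'k adele"
  where "at0 x f = adele_of (\<lambda>y. if y = x then f else 0)"

definition at1 :: "'k::{field,finite} place \<Rightarrow> 'k ratfun \<Rightarrow> 'k adele"
  where "at1 x f = adele_of (\<lambda>y. if y = x then f else 1)"

lemma finite_at: "(\<And>y. val_ge y 0 c) \<Longrightarrow> finite {y :: 'k::{field,finite} place. \<not> val_ge y 0 (if y = x then f else c)}"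
  by (rule finite_subset[of _ "{x}"]) auto

lemma comp_at0: "comp (at0 x f) y = emb y (if y = x then f else 0)"
  unfolding at0_def by (rule comp_adele_of) (rule finite_at, auto)

lemma comp_at1: "comp (at1 x f) y = emb y (if y = x then f else 1)"
  unfolding at1_def by (rule comp_adele_of) (rule finite_at, auto)

lemma aval_ge_at0: "aval_ge y N (at0 x f) \<longleftrightarrow> y \<noteq> x \<or> val_ge y N f"
  by (simp add: aval_ge_def comp_at0)

lemma aval_ge_at1: "aval_ge y N (at1 x f) \<longleftrightarrow> (if y = x then val_ge y N f else N \<le> 0)"
  by (auto simp: aval_ge_def comp_at1 val_ge_iff)

lemma at0_diff: "at0 x f - at0 x g = at0 x (f - g)"
  by (rule adele_eqI) (simp add: comp_diff comp_at0 emb_diff[symmetric])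

lemma at1_mult: "at1 x f * at1 x g = at1 x (f * g)"
  by (rule adele_eqI) (simp add: comp_mult comp_at1 emb_mult[symmetric])

lemma at1_1: "at1 x 1 = 1"
  by (rule adele_eqI) (simp add: comp_1 comp_at1 emb_1)

lemma entry_loc: "det r \<noteq> 0 \<Longrightarrow> entry (loc x r) i j y = emb y ((if y = x then r else mat 1)$i$j)"
  by (simp add: loc_def entry_gl2_of[OF admissible_loc])

lemma mat_of_loc_unipotent: "mat_of (loc x (mat2 1 p 0 1)) = mat2 1 (at0 x p) 0 1"
  unfolding mat2_eq_iff
  by (intro conjI adele_eqI) (simp_all add: entry_loc comp_at0 comp_1 comp_0 emb_1 emb_0)

lemma mat_of_loc_diagonal: "a \<noteq> 0 \<Longrightarrow> mat_of (loc x (mat2 a 0 0 1)) = mat2 (at1 x a) 0 0 1"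
  unfolding mat2_eq_iff
  by (intro conjI adele_eqI) (simp_all add: entry_loc comp_at1 comp_1 comp_0 emb_1 emb_0)

text \<open>
  Conjugation by the inverse of \<open>diag(\<pi>, 1)\<close> divides the upper right entry by \<open>\<pi>\<close> and multiplies the lower
  left one, so second order vanishing of the former keeps the result congruent to the identity.
\<close>

lemma level_conjugate:
  assumes \<pi>: "\<pi> \<noteq> 0" "val x \<pi> = 1" and k: "k \<in> level x" "aval_ge x 2 (mat_of k$1$2)"
  shows "inverse (loc x (mat2 \<pi> 0 0 1)) * k * loc x (mat2 \<pi> 0 0 1) \<in> level x"
proof -
  let ?d = "loc x (mat2 \<pi> 0 0 1)"
  define w where "w = inverse ?d * k * ?d"
  have inv: "inverse ?d = loc x (mat2 (inverse \<pi>) 0 0 1)"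
    using \<pi> by (intro gl2_inverse_unique) (simp add: loc_mult mat2_mult_mat2 mat2_one_eq[symmetric] loc_1)
  define P P' where "P = at1 x \<pi>" and "P' = at1 x (inverse \<pi>)"
  have PP: "P' * P = 1" using \<pi> by (simp add: P_def P'_def at1_mult at1_1)
  have P: "aval_ge y 0 P" "aval_ge x 1 P" "aval_ge x (-1) P'" for y
    using \<pi> by (auto simp: P_def P'_def aval_ge_at1 val_ge_iff val_inverse)
  have P'y: "aval_ge y 0 P'" if "y \<noteq> x" for y using that by (simp add: P'_def aval_ge_at1)
  have mw: "mat_of w = mat2 P' 0 0 1 ** mat_of k ** mat2 P 0 0 1"
    using \<pi> by (simp add: w_def mat_of_mult inv mat_of_loc_diagonal P_def P'_def)
  have conj: "P' * (a * P) = a" for a using PP by (metis mult.commute mult.left_commute mult_1)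
  have w: "mat_of w$1$1 = mat_of k$1$1" "mat_of w$1$2 = P' * mat_of k$1$2"
    "mat_of w$2$1 = mat_of k$2$1 * P" "mat_of w$2$2 = mat_of k$2$2"
    unfolding mw using conj by (simp_all add: mat2_mult mult.assoc)
  have k0: "aval_ge y 0 (mat_of k$i$j)" for i j y using k by (auto simp: level_iff integral_gl2_def)
  have k1: "aval_ge x 1 (mat_of k$1$1 - 1)" "aval_ge x 1 (mat_of k$2$1)" "aval_ge x 1 (mat_of k$2$2 - 1)"
    using level_near[OF k(1), of 1 1] level_near[OF k(1), of 2 1] level_near[OF k(1), of 2 2] by simp_all
  have w12: "aval_ge x 1 (mat_of w$1$2)" using aval_ge_mult[OF P(3) k(2)] by (simp add: w)
  have "\<forall>i j. aval_ge y 0 (mat_of w$i$j)" for y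
  proof (cases "y = x")
    case True
    then show ?thesis unfolding mat2_all using w12 k0 P by (auto simp: w intro: aval_ge_mono aval_ge_mult_left)
  next
    case False
    then show ?thesis unfolding mat2_all using k0 P P'y by (auto simp: w intro: aval_ge_mult_left)
  qed
  moreover have "\<forall>i j. aval_ge x 1 ((mat_of w - mat 1)$i$j)"
    unfolding mat2_all using w12 k1 P by (auto simp: w intro: aval_ge_mult_right)
  moreover have "aval_ge y 0 (det (mat_of (inverse w)))" for y
  proof -
    have "inverse w = inverse ?d * (inverse k * ?d)" by (simp add: w_def gl2_inverse_mult mult.assoc)
    then have "mat_of (inverse w) = mat2 P' 0 0 1 ** (mat_of (inverse k) ** mat2 P 0 0 1)"
      using \<pi> by (simp add: mat_of_mult inv mat_of_loc_diagonal P_def P'_def)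
    then have "det (mat_of (inverse w)) = (P' * P) * det (mat_of (inverse k))"
      by (simp add: det_mul mult.commute mult.left_commute)
    then show ?thesis using k by (simp add: PP level_iff integral_gl2_def)
  qed
  ultimately show ?thesis unfolding w_def[symmetric] level_iff integral_gl2_def by blast
qed

context coordinate
begin

text \<open>
  Subtracting the leading term \<open>c/s\<close> of the upper right entry of \<open>k\<close> by a row operation leaves an
  element to which \<open>level_conjugate\<close> applies.
\<close>

lemma hecke_rep_cosets_cover:
  assumes \<pi>: "uniformizer x \<pi>" and k: "k \<in> level x"
  obtains c k' where "k' \<in> level x" "k * loc x (mat2 \<pi> 0 0 1) = loc x (hecke_rep \<pi> c) * k'"
proof -
  have \<pi>': "\<pi> \<noteq> 0" "val x \<pi> = 1" using \<pi> by (auto simp: uniformizer_def)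
  define a where "a = mat_of k$1$2"
  have a: "aval_ge x 1 a" and k22: "aval_ge x 1 (mat_of k$2$2 - 1)"
    using level_near[OF k, of 1 2] level_near[OF k, of 2 2] by (simp_all add: a_def)
  obtain f where "cval_ge x 2 (comp a x \<ominus>\<^bsub>local_field x\<^esub> emb x f)" using local_approximation by blast
  then have f: "aval_ge x 2 (a - at0 x f)" by (simp add: aval_ge_def comp_diff comp_at0)
  have "aval_ge x 1 (a - (a - at0 x f))" by (intro aval_ge_diff a aval_ge_mono[OF f]) simp
  then have "val_ge x 1 f" by (simp add: aval_ge_at0)
  then have "val_ge x 0 (f * s)" using val_ge_mult[of x 1 f "-1" s] by (simp add: val_ge_iff val_s)
  then obtain c where c: "val_ge x 1 (f * s - const_rat c)" using residue_at_pole by blast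
  \<comment> \<open>The function \<open>p\<close> is the leading term of the upper right entry.\<close>
  define p where "p = const_rat c * inverse s"
  have p: "val_ge x 1 p" unfolding p_def by (intro val_ge_mult_left) (simp_all add: val_ge_iff val_inverse_s)
  have "val_ge x (1 + 1) ((f * s - const_rat c) * inverse s)"
    by (intro val_ge_mult c) (simp add: val_ge_iff val_inverse_s)
  moreover have "(f * s - const_rat c) * inverse s = f - p" by (simp add: p_def left_diff_distrib)
  ultimately have "aval_ge x 2 (at0 x f - at0 x p)" by (simp add: at0_diff aval_ge_at0)
  from aval_ge_add[OF f this] have ap: "aval_ge x 2 (a - at0 x p)" by simp
  let ?v = "loc x (mat2 1 p 0 1)"
  have v: "?v \<in> level x"
    using p by (subst loc_level) (auto simp: gl2O_mat2 mat2_all intro: val_ge_mono)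
  have vinv: "inverse ?v = loc x (mat2 1 (- p) 0 1)"
    by (intro gl2_inverse_unique) (simp add: loc_mult mat2_mult_mat2 mat2_one_eq[symmetric] loc_1)
  define k2 where "k2 = inverse ?v * k"
  have "k2 \<in> level x" using v k by (simp add: k2_def level_mult level_inverse)
  moreover have "aval_ge x 2 (mat_of k2$1$2)"
  proof -
    have "at0 x (- p) = - at0 x p" by (rule adele_eqI) (simp add: comp_minus comp_at0 emb_minus emb_0[symmetric] flip: emb_minus)
    then have "mat_of k2$1$2 = (a - at0 x p) - at0 x p * (mat_of k$2$2 - 1)"
      by (simp add: k2_def vinv mat_of_mult mat_of_loc_unipotent mat2_mult a_def right_diff_distrib)
    moreover have "aval_ge x (1 + 1) (at0 x p * (mat_of k$2$2 - 1))"
      using p by (intro aval_ge_mult k22) (simp add: aval_ge_at0)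
    ultimately show ?thesis using ap by (simp add: aval_ge_diff)
  qed
  ultimately have w: "inverse (loc x (mat2 \<pi> 0 0 1)) * k2 * loc x (mat2 \<pi> 0 0 1) \<in> level x"
    using level_conjugate[OF \<pi>'] by blast
  have "?v * loc x (mat2 \<pi> 0 0 1) = loc x (hecke_rep \<pi> c)"
    using \<pi>' by (simp add: loc_mult mat2_mult_mat2 hecke_rep_def p_def)
  then have "k * loc x (mat2 \<pi> 0 0 1) = loc x (hecke_rep \<pi> c) * (inverse (loc x (mat2 \<pi> 0 0 1)) * k2 * loc x (mat2 \<pi> 0 0 1))"
    by (simp add: k2_def mult.assoc flip: \<open>?v * _ = _\<close>)
  then show ?thesis using that w by blast
qed

text \<open>
  Two representatives differ by a unipotent matrix at \<open>x\<close> whose entry is a unit unless \<open>c = c'\<close>.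
\<close>

lemma hecke_rep_cosets_disjoint:
  assumes \<pi>: "uniformizer x \<pi>" and k: "k \<in> level x" "k' \<in> level x"
    and eq: "loc x (hecke_rep \<pi> c) * k = loc x (hecke_rep \<pi> c') * k'"
  shows "c = c'"
proof (rule ccontr)
  assume ne: "c \<noteq> c'"
  have \<pi>': "\<pi> \<noteq> 0" "val x \<pi> = 1" using \<pi> by (auto simp: uniformizer_def)
  define q where "q = const_rat (c' - c) * inverse s * inverse \<pi>"
  have "\<pi> * q = const_rat (c' - c) * inverse s" using \<pi>' by (simp add: q_def)
  then have "\<pi> * q + const_rat c * inverse s = const_rat c' * inverse s"
    by (simp add: const_rat_diff left_diff_distrib)
  then have "hecke_rep \<pi> c ** mat2 1 q 0 1 = hecke_rep \<pi> c'" by (simp add: hecke_rep_def mat2_mult_mat2)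
  then have "loc x (hecke_rep \<pi> c') = loc x (hecke_rep \<pi> c) * loc x (mat2 1 q 0 1)"
    using \<pi>' by (subst loc_mult) (simp_all add: hecke_rep_def)
  then have "k = loc x (mat2 1 q 0 1) * k'"
    using eq by (metis gl2_inverse_cancel(1) mult.assoc)
  then have "loc x (mat2 1 q 0 1) = k * inverse k'" by (simp add: mult.assoc gl2_inverse)
  then have "loc x (mat2 1 q 0 1) \<in> level x" using k by (simp add: level_mult level_inverse)
  then have "val_ge x 1 q" by (subst (asm) loc_level) (auto simp: mat2_all)
  moreover have "q \<noteq> 0" "val x q = 0"
    using ne \<pi>' by (simp_all add: q_def val_mult val_const val_inverse val_s)
  ultimately show False by (simp add: val_ge_iff)
qed

lemma hecke_double_coset:
  assumes "uniformizer x \<pi>"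
  shows "{k * loc x (mat2 \<pi> 0 0 1) * k' | k k'. k \<in> level x \<and> k' \<in> level x} =
    (\<Union>c. (*) (loc x (hecke_rep \<pi> c)) ` level x)"
proof (intro equalityI subsetI)
  fix g assume "g \<in> {k * loc x (mat2 \<pi> 0 0 1) * k' | k k'. k \<in> level x \<and> k' \<in> level x}"
  then obtain k k' where k: "g = k * loc x (mat2 \<pi> 0 0 1) * k'" "k \<in> level x" "k' \<in> level x" by blast
  obtain c w where "w \<in> level x" "k * loc x (mat2 \<pi> 0 0 1) = loc x (hecke_rep \<pi> c) * w"
    using hecke_rep_cosets_cover[OF assms k(2)] by blast
  then have "g = loc x (hecke_rep \<pi> c) * (w * k')" "w * k' \<in> level x" using k by (simp_all add: mult.assoc level_mult)
  then show "g \<in> (\<Union>c. (*) (loc x (hecke_rep \<pi> c)) ` level x)" by blast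
next
  fix g assume "g \<in> (\<Union>c. (*) (loc x (hecke_rep \<pi> c)) ` level x)"
  then obtain c k where k: "g = loc x (hecke_rep \<pi> c) * k" "k \<in> level x" by blast
  have \<pi>': "\<pi> \<noteq> 0" using assms by (auto simp: uniformizer_def)
  define p where "p = const_rat c * inverse s"
  have "val_ge x 1 p" unfolding p_def by (intro val_ge_mult_left) (simp_all add: val_ge_iff val_inverse_s)
  then have "loc x (mat2 1 p 0 1) \<in> level x"
    by (subst loc_level) (auto simp: gl2O_mat2 mat2_all intro: val_ge_mono)
  moreover have "g = loc x (mat2 1 p 0 1) * loc x (mat2 \<pi> 0 0 1) * k"
    using \<pi>' by (simp add: k loc_mult mat2_mult_mat2 hecke_rep_def p_def)
  ultimately show "g \<in> {k * loc x (mat2 \<pi> 0 0 1) * k' | k k'. k \<in> level x \<and> k' \<in> level x}" using k by blast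
qed

text \<open>Left multiplication by the congruence subgroup permutes the cosets.\<close>

lemma hecke_sum_shift:
  fixes f :: "'k gl2 \<Rightarrow> complex"
  assumes \<pi>: "uniformizer x \<pi>" and k: "k \<in> level x" and f: "\<And>g k. k \<in> level x \<Longrightarrow> f (g * k) = f g"
  shows "(\<Sum>c\<in>UNIV. f (g * k * loc x (hecke_rep \<pi> c))) = (\<Sum>c\<in>UNIV. f (g * loc x (hecke_rep \<pi> c)))"
proof -
  have "\<forall>c. \<exists>c' w. w \<in> level x \<and> k * loc x (hecke_rep \<pi> c) = loc x (hecke_rep \<pi> c') * w"
  proof
    fix c
    have "loc x (hecke_rep \<pi> c) \<in> (\<Union>c. (*) (loc x (hecke_rep \<pi> c)) ` level x)"
      by (intro UN_I[of c]) (auto intro: image_eqI[of _ _ 1])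
    then obtain k1 k2 where "loc x (hecke_rep \<pi> c) = k1 * loc x (mat2 \<pi> 0 0 1) * k2" "k1 \<in> level x" "k2 \<in> level x"
      unfolding hecke_double_coset[OF \<pi>, symmetric] by blast
    then have "k * loc x (hecke_rep \<pi> c) = (k * k1) * loc x (mat2 \<pi> 0 0 1) * k2" "k * k1 \<in> level x" "k2 \<in> level x"
      using k by (simp_all add: mult.assoc level_mult)
    then have "k * loc x (hecke_rep \<pi> c) \<in> (\<Union>c. (*) (loc x (hecke_rep \<pi> c)) ` level x)"
      unfolding hecke_double_coset[OF \<pi>, symmetric] by blast
    then show "\<exists>c' w. w \<in> level x \<and> k * loc x (hecke_rep \<pi> c) = loc x (hecke_rep \<pi> c') * w" by blast
  qed
  then obtain \<sigma> w where \<sigma>: "\<And>c. w c \<in> level x" "\<And>c. k * loc x (hecke_rep \<pi> c) = loc x (hecke_rep \<pi> (\<sigma> c)) * w c" by metis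
  have "inj \<sigma>"
  proof (rule injI)
    fix c c' assume "\<sigma> c = \<sigma> c'"
    then have "inverse k * (k * loc x (hecke_rep \<pi> c)) * inverse (w c) = inverse k * (k * loc x (hecke_rep \<pi> c')) * inverse (w c')"
      unfolding \<sigma>(2) by (simp add: mult.assoc gl2_inverse)
    then have "loc x (hecke_rep \<pi> c) * inverse (w c) = loc x (hecke_rep \<pi> c') * inverse (w c')" by simp
    then show "c = c'" using hecke_rep_cosets_disjoint[OF \<pi>] level_inverse[OF \<sigma>(1)] by blast
  qed
  then have bij: "bij \<sigma>" by (simp add: finite_UNIV_inj_surj bij_def)
  have "(\<Sum>c\<in>UNIV. f (g * k * loc x (hecke_rep \<pi> c))) = (\<Sum>c\<in>UNIV. f (g * loc x (hecke_rep \<pi> (\<sigma> c))))"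
    using \<sigma> f by (simp add: mult.assoc) (simp add: mult.assoc[symmetric])
  also have "\<dots> = (\<Sum>c\<in>UNIV. f (g * loc x (hecke_rep \<pi> c)))"
    by (rule sum.reindex_bij_betw[OF bij])
  finally show ?thesis .
qed

end

section \<open>The Haar measure\<close>

lemma cval_ge_1_of_small:
  assumes "c \<in> carrier (local_field y)" "cabs y (c :: 'k::{field,finite} celem) < 1"
  shows "cval_ge y 1 c"
proof (cases "c = \<zero>\<^bsub>local_field y\<^esub>")
  case False
  have "real CARD('k) > 1" using card_field_ge_2[where 'k='k] by linarith
  then have "1 \<le> cabs y c" if "0 \<le> - (int (place_degree y) * cval y c)"
    using that False unfolding cabs_def if_not_P[OF False] by (intro one_le_power_int) auto
  then have "\<not> 0 \<le> - (int (place_degree y) * cval y c)" using assms(2) by linarith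
  then have "cval y c > 0" by (auto simp: not_le zero_less_mult_iff)
  then show ?thesis using assms by (simp add: cval_ge_def)
qed simp

text \<open>
  Elements at distance less than one are congruent modulo the maximal ideal, so stability under
  congruence makes a set open.
\<close>

lemma open_at_congruence:
  assumes "U \<subseteq> carrier (local_field y)"
    and "\<And>a b. a \<in> U \<Longrightarrow> b \<in> carrier (local_field y) \<Longrightarrow> cval_ge y 1 (b \<ominus>\<^bsub>local_field y\<^esub> a) \<Longrightarrow> b \<in> U"
  shows "open_at y U"
  unfolding open_at_def
proof (intro conjI ballI assms(1))
  interpret cring "local_field y" by (rule local_field_cring)
  fix a assume a: "a \<in> U"
  then have ac: "a \<in> carrier (local_field y)" using assms(1) by blast
  have "b \<in> U" if "b \<in> carrier (local_field y)" "cabs y (b \<ominus>\<^bsub>local_field y\<^esub> a) < 1" for b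
    using that by (intro assms(2)[OF a] cval_ge_1_of_small minus_closed ac)
  then show "\<exists>e>0. \<forall>b\<in>carrier (local_field y). cabs y (b \<ominus>\<^bsub>local_field y\<^esub> a) < e \<longrightarrow> b \<in> U"
    by (intro exI[of _ 1]) simp
qed

lemma open_congruence_adeles:
  fixes a :: "'k::{field,finite} adele"
  assumes "\<And>y. aval_ge y 0 a"
  shows "open {b. (\<forall>y. aval_ge y 0 b) \<and> aval_ge x 1 (b - a)}"
proof -
  define U where "U y = {c. cval_ge y 0 c \<and> (y = x \<longrightarrow> cval_ge y 1 (c \<ominus>\<^bsub>local_field y\<^esub> comp a y))}" for y
  have "open_at y (U y)" for y
  proof (rule open_at_congruence)
    interpret cring "local_field y" by (rule local_field_cring)
    fix c b assume c: "c \<in> U y" and b: "b \<in> carrier (local_field y)" "cval_ge y 1 (b \<ominus>\<^bsub>local_field y\<^esub> c)"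
    have cc: "c \<in> carrier (local_field y)" using c by (auto simp: U_def cval_ge_carrier)
    have e: "b = (b \<ominus>\<^bsub>local_field y\<^esub> c) \<oplus>\<^bsub>local_field y\<^esub> c"
      using b cc by (simp add: minus_eq a_assoc l_neg)
    have "cval_ge y 0 ((b \<ominus>\<^bsub>local_field y\<^esub> c) \<oplus>\<^bsub>local_field y\<^esub> c)"
      using b(2) c by (intro cval_ge_add) (auto simp: U_def intro: cval_ge_mono)
    then have "cval_ge y 0 b" using e by metis
    moreover have "cval_ge y 1 (b \<ominus>\<^bsub>local_field y\<^esub> comp a y)" if "y = x"
    proof -
      have "b \<ominus>\<^bsub>local_field y\<^esub> comp a y = (b \<ominus>\<^bsub>local_field y\<^esub> c) \<oplus>\<^bsub>local_field y\<^esub> (c \<ominus>\<^bsub>local_field y\<^esub> comp a y)"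
        using e b cc by (metis minus_eq a_assoc a_inv_closed comp_carrier minus_closed)
      moreover have "cval_ge y 1 \<dots>" using b(2) c that by (intro cval_ge_add) (auto simp: U_def)
      ultimately show ?thesis by metis
    qed
    ultimately show "b \<in> U y" by (simp add: U_def)
  qed (auto simp: U_def cval_ge_carrier)
  moreover have "finite {y. U y \<noteq> ring_of_integers y}"
    by (rule finite_subset[of _ "{x}"]) (auto simp: U_def ring_of_integers_eq)
  ultimately have "{b. \<forall>y. comp b y \<in> U y} \<in> adele_boxes" unfolding adele_boxes_def by blast
  then have "open {b. \<forall>y. comp b y \<in> U y}"
    unfolding open_adele_def by (rule generate_topology.Basis)
  moreover have "{b. \<forall>y. comp b y \<in> U y} = {b. (\<forall>y. aval_ge y 0 b) \<and> aval_ge x 1 (b - a)}"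
    by (auto simp: U_def aval_ge_def comp_diff)
  ultimately show ?thesis by simp
qed

lemma open_level: "open (level x :: 'k::{field,finite} gl2 set)"
proof -
  define V :: "'k adele^2^2 \<Rightarrow> ('k adele^2^2) set" where
    "V A = {B. \<forall>i j. B$i$j \<in> {b. (\<forall>y. aval_ge y 0 b) \<and> aval_ge x 1 (b - A$i$j)}}" for A
  have "open (V (mat 1))"
  proof -
    have "open {b. (\<forall>y. aval_ge y 0 b) \<and> aval_ge x 1 (b - (mat 1 :: 'k adele^2^2)$i$j)}" for i j
      by (rule open_congruence_adeles) (simp add: mat_def)
    then have "open (\<Inter>i. \<Inter>j. (\<lambda>B :: 'k adele^2^2. B$i) -` ((\<lambda>r. r$j) -`
        {b. (\<forall>y. aval_ge y 0 b) \<and> aval_ge x 1 (b - (mat 1 :: 'k adele^2^2)$i$j)}))"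
      by (intro open_INT ballI open_vimage_vec_nth) auto
    moreover have "(\<Inter>i. \<Inter>j. (\<lambda>B :: 'k adele^2^2. B$i) -` ((\<lambda>r. r$j) -`
        {b. (\<forall>y. aval_ge y 0 b) \<and> aval_ge x 1 (b - (mat 1 :: 'k adele^2^2)$i$j)})) = V (mat 1)"
      unfolding V_def by blast
    ultimately show ?thesis by simp
  qed
  then have "open (V (mat 1) \<times> V (mat 1))" by (intro open_Times)
  moreover have "level x = {g. (mat_of g, mat_of (inverse g)) \<in> V (mat 1) \<times> V (mat 1)}"
  proof (intro equalityI subsetI)
    fix g :: "'k gl2" assume g: "g \<in> level x"
    with level_inverse[OF g] show "g \<in> {g. (mat_of g, mat_of (inverse g)) \<in> V (mat 1) \<times> V (mat 1)}"
      by (auto simp: V_def level_def)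
  next
    fix g :: "'k gl2" assume "g \<in> {g. (mat_of g, mat_of (inverse g)) \<in> V (mat 1) \<times> V (mat 1)}"
    then show "g \<in> level x" by (auto simp: V_def level_def intro!: aval_ge_det)
  qed
  ultimately show ?thesis unfolding open_gl2_def by blast
qed

context coordinate
begin

text \<open>
  Translates of the open subgroup \<open>level x\<close> have the same positive finite measure, and \<open>f\<close> is
  constant on each of the \<open>q\<close> translates.
\<close>

lemma hecke_action_sum:
  fixes f :: "'k gl2 \<Rightarrow> complex" and \<mu> :: "'k gl2 measure"
  assumes \<pi>: "uniformizer x \<pi>" and \<mu>: "haar_measure \<mu>" "emeasure \<mu> gl2_integral = 1"
    and f: "\<And>g k. k \<in> level x \<Longrightarrow> f (g * k) = f g"
  shows "measure \<mu> (level x) > 0"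
    "hecke_action \<mu> (ramified_hecke x \<pi>) f g =
      of_real (measure \<mu> (level x)) * (\<Sum>c\<in>UNIV. f (g * loc x (hecke_rep \<pi> c)))"
proof -
  let ?K = "level x"
  note haar = \<mu>(1)[unfolded haar_measure_def]
  note sets = haar[THEN conjunct1]
  note haar_inv = haar[THEN conjunct2, THEN conjunct1, rule_format]
  note haar_pos = haar[THEN conjunct2, THEN conjunct2, THEN conjunct2, THEN conjunct1, rule_format]
  have K: "?K \<in> sets \<mu>" unfolding sets by (rule borel_open[OF open_level])
  have "gl2_integral \<in> sets \<mu>" using \<mu>(2) by (metis emeasure_notin_sets zero_neq_one)
  then have "emeasure \<mu> ?K \<le> emeasure \<mu> gl2_integral"
    using level_integral by (intro emeasure_mono) (auto simp: gl2_integral_eq)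
  then have fin: "emeasure \<mu> ?K < \<infinity>" using \<mu>(2) by (simp add: le_less_trans[OF _ ennreal_one_less_top])
  have "?K \<noteq> {}" using level_1 by blast
  then have pos: "0 < emeasure \<mu> ?K" using haar_pos[OF open_level[of x]] by simp
  show "measure \<mu> ?K > 0" using fin pos by (simp add: measure_def enn2real_positive_iff)
  have tr: "emeasure \<mu> ((*) h ` ?K) = emeasure \<mu> ?K" for h
    by (rule haar_inv[OF borel_open[OF open_level]])
  \<comment> \<open>A set outside the domain of a measure gets measure zero, so translates are measurable.\<close>
  have S: "(*) h ` ?K \<in> sets \<mu>" for h
    using tr[of h] pos by (metis emeasure_notin_sets less_irrefl)
  have m: "measure \<mu> ((*) h ` ?K) = measure \<mu> ?K" for h by (simp add: measure_def tr)
  have \<pi>': "\<pi> \<noteq> 0" using \<pi> by (auto simp: uniformizer_def)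
  have "(vector [vector [emb x \<pi>, emb x 0], vector [emb x 0, emb x 1]] :: 'k celem^2^2) = (\<chi> i j. emb x (mat2 \<pi> 0 0 1$i$j))"
    by (simp add: mat2_eq_iff)
  moreover have "det (mat2 \<pi> 0 0 1) \<noteq> 0" using \<pi>' by simp
  ultimately have "gl2_at x (vector [vector [emb x \<pi>, emb x 0], vector [emb x 0, emb x 1]]) = loc x (mat2 \<pi> 0 0 1)"
    using gl2_at_eq by metis
  then have \<Phi>: "ramified_hecke x \<pi> = indicator (\<Union>c. (*) (loc x (hecke_rep \<pi> c)) ` ?K)"
    unfolding ramified_hecke_def congruence_subgroup_eq[OF \<pi>] using hecke_double_coset[OF \<pi>] by simp
  have "ramified_hecke x \<pi> h * f (g * h) =
      (\<Sum>c\<in>UNIV. indicator ((*) (loc x (hecke_rep \<pi> c)) ` ?K) h *\<^sub>R f (g * loc x (hecke_rep \<pi> c)))" for h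
  proof (cases "h \<in> (\<Union>c. (*) (loc x (hecke_rep \<pi> c)) ` ?K)")
    case False
    then show ?thesis by (simp add: \<Phi>)
  next
    case True
    then obtain c k where h: "h = loc x (hecke_rep \<pi> c) * k" "k \<in> ?K" by blast
    have ind: "indicator ((*) (loc x (hecke_rep \<pi> c')) ` ?K) h = (if c' = c then 1 else (0::real))" for c'
      using h hecke_rep_cosets_disjoint[OF \<pi>] by (auto simp: indicator_def)
    have "(\<Sum>c'\<in>UNIV. indicator ((*) (loc x (hecke_rep \<pi> c')) ` ?K) h *\<^sub>R f (g * loc x (hecke_rep \<pi> c'))) = f (g * loc x (hecke_rep \<pi> c))"
      unfolding ind by (simp add: if_distrib[of "\<lambda>r. r *\<^sub>R _"] cong: if_cong)
    moreover have "f (g * h) = f (g * loc x (hecke_rep \<pi> c))" using f h by (simp add: mult.assoc[symmetric])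
    ultimately show ?thesis using True by (simp add: \<Phi>)
  qed
  then have "hecke_action \<mu> (ramified_hecke x \<pi>) f g =
      (\<integral>h. (\<Sum>c\<in>UNIV. indicator ((*) (loc x (hecke_rep \<pi> c)) ` ?K) h *\<^sub>R f (g * loc x (hecke_rep \<pi> c))) \<partial>\<mu>)"
    by (simp add: hecke_action_def)
  also have "\<dots> = (\<Sum>c\<in>UNIV. measure \<mu> ((*) (loc x (hecke_rep \<pi> c)) ` ?K) *\<^sub>R f (g * loc x (hecke_rep \<pi> c)))"
    using S fin tr
    by (intro has_bochner_integral_integral_eq has_bochner_integral_sum has_bochner_integral_indicator
        has_bochner_integral_scaleR_left) (auto simp: has_bochner_integral_indicator)
  finally show "hecke_action \<mu> (ramified_hecke x \<pi>) f g =
      of_real (measure \<mu> (level x)) * (\<Sum>c\<in>UNIV. f (g * loc x (hecke_rep \<pi> c)))"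
    by (simp add: m scaleR_conv_of_real sum_distrib_left)
qed

end

section \<open>Growth\<close>

lemma cabs_integral: "cval_ge y 0 a \<Longrightarrow> cabs y (a :: 'k::{field,finite} celem) \<le> 1"
  using cabs_le[of y 0 a] by simp

lemma inv_det:
  "inv\<^bsub>local_field y\<^esub> (comp (det (mat_of g)) y) = comp (det (mat_of (inverse g))) y"
proof -
  interpret cring "local_field y" by (rule local_field_cring)
  have "det (mat_of g) * det (mat_of (inverse g)) = 1"
    by (rule right_inverse_entries(5)[OF mat_of_inverse(1)])
  then have "comp (det (mat_of g)) y \<otimes>\<^bsub>local_field y\<^esub> comp (det (mat_of (inverse g))) y = \<one>\<^bsub>local_field y\<^esub>"
    by (metis comp_mult comp_1)
  then show ?thesis by (intro comm_inv_char) auto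
qed

lemma local_size_eq: "local_size y g = Max (insert (cabs y (comp (det (mat_of (inverse g))) y))
    ((\<lambda>(i, j). cabs y (entry g i j y)) ` UNIV))"
proof -
  have "{cabs y (entry g i j y) | i j. True} = (\<lambda>(i, j). cabs y (entry g i j y)) ` UNIV" by auto
  then show ?thesis by (simp add: local_size_def inv_det)
qed

lemma local_size_entry: "cabs y (entry g i j y) \<le> local_size y g"
  unfolding local_size_eq by (rule Max_ge) auto

lemma local_size_det: "cabs y (comp (det (mat_of (inverse g))) y) \<le> local_size y g"
  unfolding local_size_eq by (rule Max_ge) auto

lemma local_size_integral:
  fixes g :: "'k::{field,finite} gl2"
  assumes "\<And>i j. aval_ge y 0 (mat_of g$i$j)" "\<And>i j. aval_ge y 0 (mat_of (inverse g)$i$j)"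
  shows "local_size y g = 1"
proof -
  define a b where "a = comp (det (mat_of g)) y" and "b = comp (det (mat_of (inverse g))) y"
  have "det (mat_of g) * det (mat_of (inverse g)) = 1"
    by (rule right_inverse_entries(5)[OF mat_of_inverse(1)])
  then have "a \<otimes>\<^bsub>local_field y\<^esub> b = \<one>\<^bsub>local_field y\<^esub>" by (metis comp_mult comp_1 a_def b_def)
  moreover have "cabs y (\<one>\<^bsub>local_field y\<^esub> :: 'k celem) = 1"
    using cabs_emb[of 1 y] by (simp add: emb_1)
  ultimately have "cabs y a * cabs y b = 1"
    using cabs_mult[of a y b] by (simp add: a_def b_def)
  moreover have ab: "cabs y a \<le> 1" "cabs y b \<le> 1"
    using aval_ge_det[of y "mat_of g"] aval_ge_det[of y "mat_of (inverse g)"] assms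
    by (simp_all add: cabs_integral a_def b_def aval_ge_def)
  ultimately have "cabs y b = 1"
    using mult_right_mono[OF ab(1) cabs_nonneg[of y b]] by simp
  moreover have "cabs y (entry g i j y) \<le> 1" for i j
    using assms(1) by (simp add: cabs_integral aval_ge_def)
  ultimately show ?thesis unfolding local_size_eq by (intro Max_eqI) (auto simp: b_def[symmetric])
qed

lemma finite_local_size: "finite {y. local_size y g \<noteq> 1}"
proof (rule finite_subset)
  show "{y. local_size y g \<noteq> 1} \<subseteq> (\<Union>i j. {y. \<not> aval_ge y 0 (mat_of g$i$j)} \<union> {y. \<not> aval_ge y 0 (mat_of (inverse g)$i$j)})"
  proof
    fix y assume "y \<in> {y. local_size y g \<noteq> 1}"
    then have "\<not> ((\<forall>i j. aval_ge y 0 (mat_of g$i$j)) \<and> (\<forall>i j. aval_ge y 0 (mat_of (inverse g)$i$j)))"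
      using local_size_integral[of y g] by auto
    then show "y \<in> (\<Union>i j. {y. \<not> aval_ge y 0 (mat_of g$i$j)} \<union> {y. \<not> aval_ge y 0 (mat_of (inverse g)$i$j)})"
      by auto
  qed
  show "finite (\<Union>i j. {y. \<not> aval_ge y 0 (mat_of g$i$j)} \<union> {y. \<not> aval_ge y 0 (mat_of (inverse g)$i$j)})"
    by (intro finite_UN_I finite_UnI finite_not_aval_ge) auto
qed

lemma prod_powi:
  fixes q :: real
  assumes "q \<noteq> 0"
  shows "(\<Prod>y\<in>T. q powi e y) = q powi (\<Sum>y\<in>T. e y)"
  using assms by (induction T rule: infinite_finite_induct) (auto simp: power_int_add)

text \<open>
  With \<open>c\<close> an entry of the first column of \<open>\<delta>\<close> and \<open>D\<close> its determinant, the size of \<open>g\<close> dominates both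
  \<open>c\<close> and \<open>1/D\<close> at each place, up to the factors of \<open>r\<close> at \<open>x\<close>.  In the product \<open>c\<^sup>2/D\<close> the central part
  of \<open>r\<close> cancels.
\<close>

lemma local_size_cube:
  fixes \<delta> r :: "'k::{field,finite} ratfun^2^2"
  assumes g: "g = dia \<delta> * loc x r * k" and k: "k \<in> integral_gl2" and d: "det \<delta> \<noteq> 0" "det r \<noteq> 0"
    and r: "r$2$1 = 0" and c: "\<delta>$i$1 \<noteq> 0"
    and h: "h = (if y = x then (\<delta>$i$1 * r$1$1)^2 / (det \<delta> * det r) else (\<delta>$i$1)^2 / det \<delta>)"
  shows "real CARD('k) powi (- (int (place_degree y) * val y h)) \<le> local_size y g ^ 3"
proof -
  define R where "R = (if y = x then r else mat 1)"
  have R: "det R \<noteq> 0" "R$2$1 = 0" "R$1$1 \<noteq> 0" using d r by (auto simp: R_def det_2)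
  have h': "h = (\<delta>$i$1 * R$1$1)^2 / (det \<delta> * det R)" by (simp add: h R_def)
  define w where "w = dia \<delta> * loc x r"
  have adele_of: "w = gl2_of (\<lambda>y. \<delta> ** (if y = x then r else mat 1))"
    and admissible: "admissible (\<lambda>y. \<delta> ** (if y = x then r else mat 1))"
    unfolding w_def dia_def loc_def
    by (simp_all only: gl2_of_mult[OF admissible_const[OF d(1)] admissible_loc[OF d(2)]] admissible_mult[OF admissible_const[OF d(1)] admissible_loc[OF d(2)]])
  have wg: "w = g * inverse k" by (simp add: w_def g mult.assoc gl2_inverse)
  have ki: "inverse k \<in> integral_gl2" using k by (rule integral_gl2_inverse)
  let ?L = "local_size y g"
  interpret L: cring "local_field y" by (rule local_field_cring)
  have "emb y (\<delta>$i$1 * R$1$1) = entry w i 1 y"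
    using R(2) by (simp add: adele_of entry_gl2_of[OF admissible] mat2_mult R_def)
  also have "\<dots> = entry g i 1 y \<otimes>\<^bsub>local_field y\<^esub> entry (inverse k) 1 1 y \<oplus>\<^bsub>local_field y\<^esub>
      entry g i 2 y \<otimes>\<^bsub>local_field y\<^esub> entry (inverse k) 2 1 y"
    by (simp add: wg mat_of_mult mat2_mult comp_add comp_mult)
  also have "cabs y \<dots> \<le> ?L"
  proof (rule cabs_add_le)
    have *: "cabs y (entry g i j y \<otimes>\<^bsub>local_field y\<^esub> entry (inverse k) j 1 y) \<le> ?L" for j
    proof -
      have "cabs y (entry (inverse k) j 1 y) \<le> 1"
        using integral_gl2_entry[OF ki] by (simp add: cabs_integral aval_ge_def)
      then have "cabs y (entry g i j y) * cabs y (entry (inverse k) j 1 y) \<le> cabs y (entry g i j y) * 1"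
        by (intro mult_left_mono) auto
      then show ?thesis using local_size_entry[of y g i j] by (simp add: cabs_mult)
    qed
    show "cabs y (entry g i 1 y \<otimes>\<^bsub>local_field y\<^esub> entry (inverse k) 1 1 y) \<le> ?L"
      "cabs y (entry g i 2 y \<otimes>\<^bsub>local_field y\<^esub> entry (inverse k) 2 1 y) \<le> ?L" by (rule *)+
  qed (simp_all add: L.m_closed)
  finally have 1: "cabs y (emb y (\<delta>$i$1 * R$1$1)) \<le> ?L" .
  have "emb y (inverse (det \<delta> * det R)) = comp (det (mat_of (inverse w))) y"
    using d R by (simp add: adele_of gl2_of_inverse[OF admissible] comp_det_gl2_of[OF admissible_inverse[OF admissible]]
        matrix_inv_field det_mul R_def[symmetric])
  also have "inverse w = k * inverse g" by (simp add: wg gl2_inverse_mult)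
  also have "comp (det (mat_of (k * inverse g))) y = comp (det (mat_of k)) y \<otimes>\<^bsub>local_field y\<^esub> comp (det (mat_of (inverse g))) y"
    by (simp add: mat_of_mult det_mul comp_mult)
  also have "cabs y \<dots> \<le> 1 * ?L"
    using aval_ge_det[OF integral_gl2_entry[OF k], of y] local_size_det[of y g]
    by (simp only: cabs_mult comp_carrier) (intro mult_mono, auto simp: cabs_integral aval_ge_def)
  finally have 2: "cabs y (emb y (inverse (det \<delta> * det R))) \<le> ?L" by simp
  have "h = (\<delta>$i$1 * R$1$1) * (\<delta>$i$1 * R$1$1) * inverse (det \<delta> * det R)"
    by (simp add: h' power2_eq_square divide_inverse)
  then have "cabs y (emb y h) = cabs y (emb y (\<delta>$i$1 * R$1$1)) * cabs y (emb y (\<delta>$i$1 * R$1$1)) * cabs y (emb y (inverse (det \<delta> * det R)))"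
    by (simp only: emb_mult[of y "_ * _" "inverse _"] emb_mult[of y "_ * R$1$1"] cabs_mult emb_carrier L.m_closed)
  also have "\<dots> \<le> ?L * ?L * ?L"
    using 1 2 order_trans[OF cabs_nonneg 1] by (intro mult_mono) auto
  finally have "cabs y (emb y h) \<le> ?L ^ 3" by (simp add: power3_eq_cube)
  moreover have "h \<noteq> 0" using c d R by (simp add: h')
  ultimately show ?thesis by (simp add: cabs_emb)
qed

context coordinate
begin

text \<open>
  Multiplying the local bounds, the product formula cancels everything but the factor \<open>s\<^sup>n\<close> at \<open>x\<close>.
\<close>

lemma adelic_size_lower_bound:
  assumes x1: "place_degree x = 1" and g: "located g n \<kappa>"
  shows "real CARD('k) ^ n \<le> adelic_size g ^ 3"
proof -
  let ?q = "real CARD('k)"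
  have q: "?q > 0" "?q \<noteq> 0" using card_field_ge_2[where 'k='k] by auto
  obtain \<delta> m k where \<delta>: "det \<kappa> \<noteq> 0" "det \<delta> \<noteq> 0" "k \<in> level x" "g = dia \<delta> * loc x (scal (s powi m) ** point n \<kappa>) * k"
    using g unfolding located_def by blast
  define r where "r = scal (s powi m) ** mat2 (s ^ n) 0 0 1"
  have r: "r = mat2 (s powi m * s ^ n) 0 0 (s powi m)" by (simp add: r_def scal_def mat2_mult_mat2)
  have dr: "det r \<noteq> 0" by (simp add: r)
  have "scal (s powi m) ** point n \<kappa> = r ** const_mat \<kappa>" by (simp add: r_def point_def matrix_mul_assoc)
  then have gr: "g = dia \<delta> * loc x r * (loc x (const_mat \<kappa>) * k)"
    using \<delta> dr by (simp add: loc_mult[symmetric] det_const_mat mult.assoc)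
  have ki: "loc x (const_mat \<kappa>) * k \<in> integral_gl2"
    using \<delta> level_integral by (intro integral_gl2_mult loc_integral gl2O_const_mat) auto
  have "\<delta>$1$1 \<noteq> 0 \<or> \<delta>$2$1 \<noteq> 0" using \<delta>(2) by (auto simp: det_2)
  then obtain i where i: "\<delta>$i$1 \<noteq> 0" by blast
  define c where "c = (\<delta>$i$1)^2 / det \<delta>"
  have c: "c \<noteq> 0" using i \<delta> by (simp add: c_def)
  define h where "h y = (if y = x then c * s ^ n else c)" for y
  have hx: "(\<delta>$i$1 * r$1$1)^2 / (det \<delta> * det r) = c * s ^ n"
    using \<delta>(2) by (simp add: r c_def power2_eq_square)
  have ls: "?q powi (- (int (place_degree y) * val y (h y))) \<le> local_size y g ^ 3" for y
  proof -
    have "h y = (if y = x then (\<delta>$i$1 * r$1$1)^2 / (det \<delta> * det r) else (\<delta>$i$1)^2 / det \<delta>)"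
      unfolding hx by (simp add: h_def c_def)
    then show ?thesis by (intro local_size_cube[OF gr ki \<delta>(2) dr _ i]) (simp add: r)
  qed
  define T where "T = {y. local_size y g \<noteq> 1} \<union> {y. val y c \<noteq> 0} \<union> {x}"
  have T: "finite T" by (simp add: T_def finite_local_size finite_val_support)
  have size: "adelic_size g = (\<Prod>y\<in>T. local_size y g)"
    unfolding adelic_size_def by (rule Prod_any.expand_superset[OF T]) (auto simp: T_def)
  have deg: "place_degree y = pdeg y" for y using x1 place_degree_eq by (simp add: pdeg_def)
  have "(\<Sum>y\<in>T. int (place_degree y) * val y (h y)) = (\<Sum>y\<in>T. int (pdeg y) * val y c + (if y = x then - int n else 0))"
    by (rule sum.cong) (auto simp: h_def deg val_mult c val_power val_s pdeg_def)
  also have "\<dots> = - int n"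
    using T balancedD[OF product_formula[OF c] T] by (simp add: sum.distrib T_def)
  finally have "(\<Sum>y\<in>T. - (int (place_degree y) * val y (h y))) = int n" by (simp add: sum_negf)
  then have "?q ^ n = (\<Prod>y\<in>T. ?q powi (- (int (place_degree y) * val y (h y))))"
    unfolding prod_powi[OF q(2)] by simp
  also have "\<dots> \<le> (\<Prod>y\<in>T. local_size y g ^ 3)"
    using ls q by (intro prod_mono) auto
  finally show ?thesis by (simp add: size prod_power_distrib)
qed

lemma moderate_growth_bound:
  assumes x1: "place_degree x = 1" and M: "M \<ge> 1"
    and f: "\<And>g n \<kappa>. located g n \<kappa> \<Longrightarrow> norm (f g) \<le> M ^ n"
  shows "moderate_growth (f :: 'k gl2 \<Rightarrow> complex)"
proof -
  let ?q = "real CARD('k)"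
  have q: "?q > 1" using card_field_ge_2[where 'k='k] by auto
  \<comment> \<open>The exponent turns the bound by \<open>M\<^sup>n\<close> into one by a power of \<open>q\<^sup>n\<close>.\<close>
  define e where "e = log ?q M"
  have e: "e \<ge> 0" using q M by (simp add: e_def zero_le_log_cancel_iff)
  have "norm (f g) \<le> 1 * adelic_size g powr (3 * e)" for g
  proof -
    obtain n \<kappa> where n: "located g n \<kappa>" using located_exists by blast
    have qn: "?q ^ n \<le> adelic_size g ^ 3" by (rule adelic_size_lower_bound[OF x1 n])
    moreover have "0 < ?q ^ n" using q by simp
    ultimately have "0 < adelic_size g ^ 3" by linarith
    then have pos: "0 < adelic_size g" by (simp add: zero_less_power_eq)
    have "norm (f g) \<le> M ^ n" by (rule f[OF n])
    also have "M = ?q powr e" using q M by (simp add: e_def)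
    also have "(?q powr e) ^ n = (?q ^ n) powr e"
      using q powr_realpow[of ?q n] powr_powr[of ?q "real n" e] powr_realpow[of "?q powr e" n]
        powr_powr[of ?q e "real n"] by (simp add: mult.commute)
    also have "\<dots> \<le> (adelic_size g ^ 3) powr e" using qn q e by (intro powr_mono2) auto
    also have "\<dots> = adelic_size g powr (3 * e)"
      using pos powr_realpow[of "adelic_size g" 3] powr_powr[of "adelic_size g" 3 e] by simp
    finally show ?thesis by simp
  qed
  then show ?thesis unfolding moderate_growth_def by blast
qed

section \<open>The eigenform\<close>

lemma invariant_located:
  assumes f: "invariant f" and g: "located g n \<kappa>"
  shows "f g = f (loc x (point n \<kappa>))"
proof -
  obtain \<delta> m k where \<delta>: "det \<kappa> \<noteq> 0" "det \<delta> \<noteq> 0" "k \<in> level x" "g = dia \<delta> * loc x (scal (s powi m) ** point n \<kappa>) * k"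
    using g unfolding located_def by blast
  have "f g = f (loc x (scal (s powi m) ** point n \<kappa>))"
    using f \<delta> by (simp add: invariant_level invariant_dia)
  also have "\<dots> = f (loc x (scal (s powi m)) * loc x (point n \<kappa>))"
    using \<delta> by (subst loc_mult) (auto simp: det_point)
  also have "\<dots> = f (loc x (point n \<kappa>))" by (rule invariant_scal[OF f]) simp
  finally show ?thesis .
qed

end

text \<open>
  The eigenform has the value \<open>(q/l)\<^sup>n\<close> at transversal points; its values at special points solve the
  recursion obtained from \<open>hecke_up\<close>.  At \<open>n = 0\<close> both agree, as they must.
\<close>

primrec special_value :: "complex \<Rightarrow> complex \<Rightarrow> nat \<Rightarrow> complex" where
  "special_value q l 0 = 1"
| "special_value q l (Suc n) = l * special_value q l n - (q - 1) * (q / l) ^ Suc n"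

definition form_value :: "complex \<Rightarrow> complex \<Rightarrow> nat \<Rightarrow> 'k::field^2^2 \<Rightarrow> complex"
  where "form_value q l n \<kappa> = (if \<kappa>$2$2 = 0 then special_value q l n else (q / l) ^ n)"

lemma form_value_bound:
  obtains M where "M \<ge> 1" "\<And>n \<kappa>. norm (form_value q l n \<kappa>) \<le> M ^ n"
proof -
  define a b m where "a = norm l" and "b = norm (q - 1)" and "m = norm (q / l)"
  define M where "M = 1 + a + b * m + m"
  have nn: "0 \<le> a" "0 \<le> b" "0 \<le> m" by (simp_all add: a_def b_def m_def)
  then have M: "m \<le> M" "1 \<le> M" "a + b * m \<le> M" by (simp_all add: M_def)
  have g: "norm ((q / l) ^ n) \<le> M ^ n" for n
    using M nn by (simp add: norm_power m_def[symmetric] power_mono)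
  have "norm (special_value q l n) \<le> M ^ n" for n
  proof (induction n)
    case (Suc n)
    have "norm (special_value q l (Suc n)) \<le> a * norm (special_value q l n) + b * (m * norm ((q / l) ^ n))"
      using norm_triangle_ineq4[of "l * special_value q l n" "(q - 1) * (q / l) ^ Suc n"]
      by (simp only: special_value.simps norm_mult power_Suc a_def b_def m_def)
    also have "\<dots> \<le> a * M ^ n + b * (m * M ^ n)"
      using Suc g nn by (intro add_mono mult_left_mono) auto
    also have "\<dots> = (a + b * m) * M ^ n" by (simp add: algebra_simps)
    also have "\<dots> \<le> M * M ^ n" using M nn by (intro mult_right_mono) auto
    finally show ?case by simp
  qed simp
  then show ?thesis using that[of M] M g by (simp add: form_value_def)
qed

context coordinate
begin

text \<open>
  The choice is immaterial because \<open>located_unique\<close> shows that all representatives give the same value.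
\<close>

definition eigenform :: "complex \<Rightarrow> 'k gl2 \<Rightarrow> complex"
  where "eigenform l g = (SOME v. \<exists>n \<kappa>. located g n \<kappa> \<and> v = form_value (of_nat CARD('k)) l n \<kappa>)"

lemma eigenform_eq:
  assumes "located g n \<kappa>"
  shows "eigenform l g = form_value (of_nat CARD('k)) l n \<kappa>"
proof -
  have "\<exists>v n \<kappa>. located g n \<kappa> \<and> v = form_value (of_nat CARD('k)) l n \<kappa>" using assms by blast
  from someI_ex[OF this] obtain n' \<kappa>' where "located g n' \<kappa>'" "eigenform l g = form_value (of_nat CARD('k)) l n' \<kappa>'"
    unfolding eigenform_def by blast
  then show ?thesis using located_unique[OF assms] by (fastforce simp: form_value_def)
qed

lemma located_dia:
  assumes "det \<gamma> \<noteq> 0" "located g n \<kappa>"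
  shows "located (dia \<gamma> * g) n \<kappa>"
proof -
  obtain \<delta> m k where \<delta>: "det \<kappa> \<noteq> 0" "det \<delta> \<noteq> 0" "k \<in> level x" "g = dia \<delta> * loc x (scal (s powi m) ** point n \<kappa>) * k"
    using assms unfolding located_def by blast
  then show ?thesis
    using assms(1) by (intro locatedI[of \<kappa> "\<gamma> ** \<delta>" k _ m]) (auto simp: det_mul dia_mult[symmetric] mult.assoc)
qed

lemma located_level:
  assumes "k' \<in> level x" "located g n \<kappa>"
  shows "located (g * k') n \<kappa>"
proof -
  obtain \<delta> m k where \<delta>: "det \<kappa> \<noteq> 0" "det \<delta> \<noteq> 0" "k \<in> level x" "g = dia \<delta> * loc x (scal (s powi m) ** point n \<kappa>) * k"
    using assms unfolding located_def by blast
  then show ?thesis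
    using assms(1) by (intro locatedI[of \<kappa> \<delta> "k * k'" _ m]) (auto simp: mult.assoc level_mult)
qed

text \<open>
  The center is absorbed by the scalars at \<open>x\<close>, by the rational scalars, and by the congruence subgroup.
\<close>

lemma located_center:
  assumes "z \<in> gl2_center" "located g n \<kappa>"
  shows "located (z * g) n \<kappa>"
proof -
  obtain \<delta> m k where \<delta>: "det \<kappa> \<noteq> 0" "det \<delta> \<noteq> 0" "k \<in> level x" "g = dia \<delta> * loc x (scal (s powi m) ** point n \<kappa>) * k"
    using assms unfolding located_def by blast
  obtain \<phi> m' u where z: "\<phi> \<noteq> 0" "u \<in> level x" "z = dia (scal \<phi>) * loc x (scal (s powi m')) * u"
    by (rule center_decomposition[OF assms(1)])
  define r where "r = scal (s powi m) ** point n \<kappa>"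
  have r: "det r \<noteq> 0" using det_scal_point \<delta> by (simp add: r_def)
  have zc: "z * h = h * z" for h using assms(1) by (simp add: gl2_center_def)
  have lc: "loc x (scal (s powi m')) * h = h * loc x (scal (s powi m'))" for h
    using loc_scal_central[of "s powi m'" x] by (simp add: gl2_center_def)
  have "scal (s powi m') ** r = scal (s powi (m' + m)) ** point n \<kappa>"
    unfolding r_def matrix_mul_assoc scal_mult power_int_add[OF disjI1[OF s_nz]] ..
  moreover have "loc x (scal (s powi m')) * loc x r = loc x (scal (s powi m') ** r)"
    using r by (simp add: loc_mult)
  ultimately have lr: "loc x (scal (s powi m')) * loc x r = loc x (scal (s powi (m' + m)) ** point n \<kappa>)" by simp
  have dd: "dia \<delta> * dia (scal \<phi>) = dia (scal \<phi> ** \<delta>)"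
    using \<delta> z by (simp add: dia_mult scal_commute)
  have pc: "dia (scal \<phi>) * h = h * dia (scal \<phi>)" for h
  proof -
    have "admissible (\<lambda>_ :: 'k place. scal \<phi>)" using z by (intro admissible_const) simp
    from scalar_central[OF mat_of_scalar_family[OF this]]
    show ?thesis by (simp add: dia_def gl2_center_def)
  qed
  have "z * g = dia \<delta> * loc x r * (z * k)" by (simp add: \<delta>(4) r_def zc[symmetric] mult.assoc) (metis zc mult.assoc)
  also have "\<dots> = dia \<delta> * (loc x r * dia (scal \<phi>)) * (loc x (scal (s powi m')) * u * k)"
    by (simp add: z(3) mult.assoc)
  also have "\<dots> = (dia \<delta> * dia (scal \<phi>)) * (loc x r * loc x (scal (s powi m'))) * (u * k)"
    by (simp only: pc[of "loc x r", symmetric] mult.assoc)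
  also have "\<dots> = dia (scal \<phi> ** \<delta>) * loc x (scal (s powi (m' + m)) ** point n \<kappa>) * (u * k)"
    by (simp only: dd lc[of "loc x r", symmetric] lr)
  finally show ?thesis
    using \<delta> z by (intro locatedI[of \<kappa> "scal \<phi> ** \<delta>" "u * k" _ "m' + m"]) (auto simp: det_mul level_mult)
qed

lemma eigenform_invariant: "invariant (eigenform l)"
  unfolding invariant_def gl2_rational_eq
proof (intro conjI ballI allI)
  fix \<gamma> g :: "'k gl2" assume "\<gamma> \<in> dia ` {\<delta>. det \<delta> \<noteq> 0}"
  then obtain \<delta> where "\<gamma> = dia \<delta>" "det \<delta> \<noteq> 0" by blast
  then show "eigenform l (\<gamma> * g) = eigenform l g"
    using located_exists[of g] located_dia eigenform_eq by metis
next
  fix z g :: "'k gl2" assume "z \<in> gl2_center"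
  then show "eigenform l (z * g) = eigenform l g"
    using located_exists[of g] located_center eigenform_eq by metis
next
  fix k g :: "'k gl2" assume "k \<in> level x"
  then show "eigenform l (g * k) = eigenform l g"
    using located_exists[of g] located_level eigenform_eq by metis
qed

lemma located_point: "det \<kappa> \<noteq> 0 \<Longrightarrow> located (loc x (point n \<kappa>)) n \<kappa>"
  by (rule locatedI[of \<kappa> "mat 1" 1 _ 0]) (auto simp: dia_1)

lemma eigenform_point: "det \<kappa> \<noteq> 0 \<Longrightarrow> eigenform l (loc x (point n \<kappa>)) = form_value (of_nat CARD('k)) l n \<kappa>"
  by (rule eigenform_eq[OF located_point])

lemma sum_split_0:
  fixes F :: "'k \<Rightarrow> complex"
  assumes "\<And>b. b \<noteq> 0 \<Longrightarrow> F b = v"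
  shows "(\<Sum>b\<in>UNIV. F b) = F 0 + (of_nat CARD('k) - 1) * v"
proof -
  have "(\<Sum>b\<in>UNIV. F b) = F 0 + (\<Sum>b\<in>UNIV - {0}. F b)" by (rule sum.remove) auto
  also have "(\<Sum>b\<in>UNIV - {0}. F b) = (\<Sum>b\<in>UNIV - {0 :: 'k}. v)" by (rule sum.cong) (use assms in auto)
  also have "\<dots> = (of_nat CARD('k) - 1) * v"
    using card_field_ge_2[where 'k='k] by (simp add: card_Diff_singleton of_nat_diff)
  finally show ?thesis .
qed

context
  fixes \<pi> \<epsilon> l
  assumes \<pi>: "uniformizer x \<pi>" and \<epsilon>: "\<epsilon> \<noteq> 0" "val_ge x 1 (s * \<pi> - const_rat \<epsilon>)" and l: "l \<noteq> (0::complex)"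
begin

lemma loc_point_hecke_rep:
  assumes "det \<kappa> \<noteq> 0"
  shows "loc x (point n \<kappa>) * loc x (hecke_rep \<pi> c) = loc x (point n \<kappa> ** hecke_rep \<pi> c)"
proof -
  have "\<pi> \<noteq> 0" using \<pi> by (auto simp: uniformizer_def)
  then show ?thesis using assms by (intro loc_mult) (auto simp: det_point hecke_rep_def)
qed

lemma hecke_sum_down:
  assumes "invariant f" "det \<kappa> \<noteq> 0" "\<kappa>$2$2 \<noteq> 0"
  shows "(\<Sum>c\<in>UNIV. f (loc x (point (Suc n) \<kappa>) * loc x (hecke_rep \<pi> c))) = of_nat CARD('k) * f (loc x (point n (mat 1)))"
  using assms by (simp add: loc_point_hecke_rep hecke_down[OF \<pi> \<epsilon>])

lemma hecke_sum_up:
  assumes "invariant f" "det \<kappa> \<noteq> 0" "\<kappa>$2$2 = 0 \<or> n = 0"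
  shows "(\<Sum>c\<in>UNIV. f (loc x (point n \<kappa>) * loc x (hecke_rep \<pi> c))) = (\<Sum>c\<in>UNIV. f (loc x (point (Suc n) (mat2 0 1 \<epsilon> c))))"
  using assms by (simp add: loc_point_hecke_rep hecke_up[OF \<pi> \<epsilon>])

lemma eigenform_hecke:
  "(\<Sum>c\<in>UNIV. eigenform l (g * loc x (hecke_rep \<pi> c))) = l * eigenform l g"
proof -
  let ?f = "eigenform l"
  let ?q = "of_nat CARD('k) :: complex"
  note inv = eigenform_invariant[of l]
  obtain n \<kappa> where n: "located g n \<kappa>" using located_exists by blast
  then obtain \<delta> m k where \<delta>: "det \<kappa> \<noteq> 0" "det \<delta> \<noteq> 0" "k \<in> level x" "g = dia \<delta> * loc x (scal (s powi m) ** point n \<kappa>) * k"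
    unfolding located_def by blast
  have "loc x (scal (s powi m) ** point n \<kappa>) = loc x (scal (s powi m)) * loc x (point n \<kappa>)"
    using \<delta> by (subst loc_mult) (auto simp: det_point)
  then have "?f (g * h) = ?f (loc x (point n \<kappa>) * k * h)" for h
    using \<delta> by (simp add: mult.assoc invariant_dia[OF inv] invariant_scal[OF inv])
  then have "(\<Sum>c\<in>UNIV. ?f (g * loc x (hecke_rep \<pi> c))) = (\<Sum>c\<in>UNIV. ?f (loc x (point n \<kappa>) * k * loc x (hecke_rep \<pi> c)))" by simp
  also have "\<dots> = (\<Sum>c\<in>UNIV. ?f (loc x (point n \<kappa>) * loc x (hecke_rep \<pi> c)))"
    by (rule hecke_sum_shift[OF \<pi> \<delta>(3)]) (rule invariant_level[OF inv])
  also have "\<dots> = l * form_value ?q l n \<kappa>"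
  proof (cases "\<kappa>$2$2 = 0 \<or> n = 0")
    case True
    have "(\<Sum>c\<in>UNIV. ?f (loc x (point n \<kappa>) * loc x (hecke_rep \<pi> c))) = (\<Sum>c\<in>UNIV. form_value ?q l (Suc n) (mat2 0 1 \<epsilon> c))"
      using hecke_sum_up[OF inv \<delta>(1) True] \<epsilon> by (simp add: eigenform_point)
    also have "\<dots> = special_value ?q l (Suc n) + (?q - 1) * (?q / l) ^ Suc n"
      by (subst sum_split_0[where v = "(?q / l) ^ Suc n"]) (auto simp: form_value_def)
    also have "\<dots> = l * special_value ?q l n" by simp
    also have "special_value ?q l n = form_value ?q l n \<kappa>" using True by (auto simp: form_value_def)
    finally show ?thesis .
  next
    case False
    then obtain j where j: "n = Suc j" "\<kappa>$2$2 \<noteq> 0" by (cases n) auto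
    have "(\<Sum>c\<in>UNIV. ?f (loc x (point n \<kappa>) * loc x (hecke_rep \<pi> c))) = ?q * form_value ?q l j (mat 1 :: 'k^2^2)"
      using hecke_sum_down[OF inv \<delta>(1) j(2)] by (simp add: j eigenform_point)
    also have "\<dots> = l * form_value ?q l n \<kappa>" using j l by (simp add: form_value_def)
    finally show ?thesis .
  qed
  also have "form_value ?q l n \<kappa> = ?f g" using eigenform_eq[OF n] by simp
  finally show ?thesis .
qed

text \<open>
  Conversely the eigenvalue equation propagates the value at the trivial bundle to all
  representatives, one step of \<open>n\<close> at a time.
\<close>

lemma eigenfunction_at_point:
  assumes f: "invariant f" and eq: "\<And>g. (\<Sum>c\<in>UNIV. f (g * loc x (hecke_rep \<pi> c))) = l * f g"
    and \<kappa>: "det \<kappa> \<noteq> 0"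
  shows "f (loc x (point n \<kappa>)) = f 1 * form_value (of_nat CARD('k)) l n \<kappa>"
  using \<kappa>
proof (induction n arbitrary: \<kappa>)
  case 0
  have "f (loc x (point 0 \<kappa>)) = f (loc x (point 0 (mat 1)))"
    using invariant_point_0[OF f 0, of "mat 1" "mat 1"] by simp
  moreover have "point 0 (mat 1) = mat 1" by (simp add: point_def const_mat_1 mat2_one_eq[symmetric])
  ultimately show ?case by (simp add: loc_1 form_value_def)
next
  case (Suc n)
  let ?q = "of_nat CARD('k) :: complex"
  have transversal: "f (loc x (point (Suc n) \<kappa>)) = f 1 * (?q / l) ^ Suc n" if "det \<kappa> \<noteq> 0" "\<kappa>$2$2 \<noteq> 0" for \<kappa>
  proof -
    have "l * f (loc x (point (Suc n) \<kappa>)) = ?q * f (loc x (point n (mat 1)))"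
      unfolding eq[symmetric] by (rule hecke_sum_down[OF f that])
    also have "\<dots> = ?q * (f 1 * (?q / l) ^ n)" using Suc.IH[of "mat 1"] by (simp add: form_value_def)
    finally show ?thesis using l by (simp add: field_simps)
  qed
  show ?case
  proof (cases "\<kappa>$2$2 = 0")
    case False
    then show ?thesis using transversal Suc.prems by (simp add: form_value_def)
  next
    case True
    let ?J = "mat2 0 1 1 0 :: 'k^2^2"
    have J: "det ?J \<noteq> 0" "?J$2$2 = 0" by simp_all
    have same: "f (loc x (point (Suc n) \<kappa>)) = f (loc x (point (Suc n) (mat2 0 1 \<epsilon> 0)))"
      using invariant_cells(2)[OF f Suc.prems, of "mat 1" "Suc n"] True
        invariant_cells(2)[OF f, of "mat2 0 1 \<epsilon> 0" "mat 1" "Suc n"] \<epsilon> by simp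
    have "l * f (loc x (point n ?J)) = (\<Sum>c\<in>UNIV. f (loc x (point (Suc n) (mat2 0 1 \<epsilon> c))))"
      unfolding eq[symmetric] by (rule hecke_sum_up[OF f]) auto
    also have "\<dots> = f (loc x (point (Suc n) (mat2 0 1 \<epsilon> 0))) + (?q - 1) * (f 1 * (?q / l) ^ Suc n)"
      by (rule sum_split_0) (use \<epsilon> in \<open>intro transversal, auto\<close>)
    finally have "f (loc x (point (Suc n) \<kappa>)) = l * f (loc x (point n ?J)) - (?q - 1) * (f 1 * (?q / l) ^ Suc n)"
      by (simp add: same)
    also have "f (loc x (point n ?J)) = f 1 * special_value ?q l n" using Suc.IH[OF J(1)] by (simp add: form_value_def)
    finally show ?thesis using True by (simp add: form_value_def algebra_simps)
  qed
qed

lemma eigenfunction_unique: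
  assumes f: "invariant f" and eq: "\<And>g. (\<Sum>c\<in>UNIV. f (g * loc x (hecke_rep \<pi> c))) = l * f g"
  shows "f g = f 1 * eigenform l g"
proof -
  obtain n \<kappa> where n: "located g n \<kappa>" using located_exists by blast
  then have "det \<kappa> \<noteq> 0" by (simp add: located_def)
  then show ?thesis
    using invariant_located[OF f n] eigenfunction_at_point[OF f eq] eigenform_eq[OF n] by simp
qed

lemma eigenform_1: "eigenform l 1 = 1"
proof -
  have "point 0 (mat 1) = mat 1" by (simp add: point_def const_mat_1 mat2_one_eq[symmetric])
  then show ?thesis using eigenform_point[of "mat 1" l 0] by (simp add: loc_1 form_value_def)
qed

end

end

section \<open>The dimension of the eigenspace\<close>

theorem theorem2:
  fixes x :: "'k::{field,finite} place"
    and \<pi> :: "'k ratfun"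
    and \<mu> :: "'k gl2 measure"
    and l :: complex
  assumes "place_degree x = 1"
    and "uniformizer x \<pi>"
    and "haar_measure \<mu>"
    and "emeasure \<mu> gl2_integral = 1"
    and "l \<noteq> 0"
  shows "cfun.dim (hecke_eigenspace \<mu> (congruence_subgroup x \<pi>) (ramified_hecke x \<pi>) l) = 1"
proof -
  obtain s where "coordinate x s" using degree_one_coordinate[OF assms(1)] by blast
  then interpret coordinate x s .
  have \<pi>: "\<pi> \<noteq> 0" "val x \<pi> = 1" using assms(2) by (auto simp: uniformizer_def)
  have s\<pi>: "s * \<pi> \<noteq> 0" "val x (s * \<pi>) = 0" using \<pi> by (simp_all add: val_mult val_s)
  \<comment> \<open>\<open>\<pi>\<close> and \<open>1/s\<close> are both uniformizers; \<open>\<epsilon>\<close> is the residue of their quotient.\<close>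
  then obtain \<epsilon> where \<epsilon>: "val_ge x 1 (s * \<pi> - const_rat \<epsilon>)"
    using residue_at_pole[of "s * \<pi>"] by (auto simp: val_ge_iff)
  then have \<epsilon>0: "\<epsilon> \<noteq> 0" using s\<pi> by (auto simp: val_ge_iff)
  define v where "v = complex_of_real (measure \<mu> (level x))"
  \<comment> \<open>Dividing by the volume turns the Hecke operator into a plain sum over the cosets.\<close>
  define l' where "l' = l / v"
  have v: "v \<noteq> 0" using hecke_action_sum(1)[OF assms(2-4), of "\<lambda>_. 0"] by (simp add: v_def)
  have l': "l' \<noteq> 0" using v assms(5) by (simp add: l'_def)
  note ctx = assms(2) \<epsilon>0 \<epsilon> l'
  let ?E = "hecke_eigenspace \<mu> (congruence_subgroup x \<pi>) (ramified_hecke x \<pi>) l"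
  have E_iff: "f \<in> ?E \<longleftrightarrow> invariant f \<and> moderate_growth f \<and>
      (\<forall>g. (\<Sum>c\<in>UNIV. f (g * loc x (hecke_rep \<pi> c))) = l' * f g)" for f
  proof -
    have "hecke_action \<mu> (ramified_hecke x \<pi>) f = (\<lambda>g. l * f g) \<longleftrightarrow>
        (\<forall>g. (\<Sum>c\<in>UNIV. f (g * loc x (hecke_rep \<pi> c))) = l' * f g)" if "invariant f"
    proof -
      have "hecke_action \<mu> (ramified_hecke x \<pi>) f g = v * (\<Sum>c\<in>UNIV. f (g * loc x (hecke_rep \<pi> c)))" for g
        unfolding v_def by (rule hecke_action_sum(2)[OF assms(2-4)]) (rule invariant_level[OF that])
      then show ?thesis using v by (auto simp: fun_eq_iff l'_def field_simps)
    qed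
    then show ?thesis
      by (auto simp: hecke_eigenspace_def automorphic_forms_def congruence_subgroup_eq[OF assms(2)] invariant_def)
  qed
  let ?f = "eigenform l'"
  obtain M where M: "M \<ge> 1" "\<And>n \<kappa>. norm (form_value (of_nat CARD('k)) l' n (\<kappa> :: 'k^2^2)) \<le> M ^ n"
    by (rule form_value_bound) blast
  have "moderate_growth ?f"
    by (rule moderate_growth_bound[OF assms(1) M(1)]) (simp add: eigenform_eq M(2))
  then have f: "?f \<in> ?E" using eigenform_invariant eigenform_hecke[OF ctx] by (simp add: E_iff)
  have f1: "?f 1 = 1" by (rule eigenform_1[OF ctx])
  have "?E = cfun.span {?f}"
  proof (intro equalityI subsetI)
    fix h assume "h \<in> ?E"
    then have "h = (\<lambda>g. h 1 * ?f g)" using eigenfunction_unique[OF ctx] unfolding E_iff by (intro ext) blast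
    then show "h \<in> cfun.span {?f}" unfolding cfun.span_singleton by blast
  next
    fix h assume "h \<in> cfun.span {?f}"
    then obtain c where h: "h = (\<lambda>g. c * ?f g)" unfolding cfun.span_singleton by blast
    have inv: "invariant h" using eigenform_invariant by (simp add: h invariant_def)
    have "moderate_growth h"
    proof -
      obtain C N where "\<And>g. norm (?f g) \<le> C * adelic_size g powr N"
        using \<open>moderate_growth ?f\<close> unfolding moderate_growth_def by blast
      then have "norm (h g) \<le> (norm c * C) * adelic_size g powr N" for g
        by (simp add: h norm_mult mult.assoc mult_left_mono)
      then show ?thesis unfolding moderate_growth_def by blast
    qed
    moreover have "(\<Sum>a\<in>UNIV. h (g * loc x (hecke_rep \<pi> a))) = l' * h g" for g
      using eigenform_hecke[OF ctx] by (simp add: h sum_distrib_left[symmetric])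
    ultimately show "h \<in> ?E" using inv by (simp add: E_iff)
  qed
  moreover have "cfun.dim (cfun.span {?f}) = 1"
  proof -
    have "?f \<noteq> 0" using f1 by (metis zero_fun_def zero_neq_one)
    then have "cfun.independent {?f}" by (simp add: cfun.dependent_single)
    then show ?thesis using cfun.dim_eq_card_independent[of "{?f}"] by (simp add: cfun.dim_span)
  qed
  ultimately show ?thesis by simp
qed

end
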